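(* Let $\lambda$ be a partition and $L\subset\mathbb R^n$ a full-rank lattice which is strongly perfect with respect to $\lambda$. Then $L$ is extreme with respect to $\lambda$, i.e. $L$ is a local maximum of $\gamma$ on the space of full-rank lattices of $\mathbb R^n$. (In particular, $L$ is perfect and strongly eutactic with respect to $\lambda$.)
   Context: Let $\lambda$ be a partition whose conjugate partition $\breve\lambda=(\breve\lambda_1\ge\dots\ge\breve\lambda_{\breve s})$ has all parts $<n$; $|\lambda|=\sum\breve\lambda_i$; let $d_1>\dots>d_\ell$ be the distinct values of the $\breve\lambda_i$ and $d=(d_1,\dots,d_\ell)$. For a lattice $\Lambda$, $\det\Lambda$ is the Gram determinant of a basis. For a full-rank lattice $L\subset\mathbb R^n$, $\gamma(L)=\inf_\Lambda\frac{\det(\Lambda_1)\cdots\det(\Lambda_{\breve s})}{\det(L)^{|\lambda|/n}}$ over chains of nested sublattices $\Lambda=(\Lambda_1,\dots,\Lambda_{\breve s})$ of $L$ with $\mathrm{rk}\,\Lambda_i=\breve\lambda_i$; the chains attaining the infimum form the finite set $\mathscr S_\lambda(L)$ of minimal flags. $\Pi_\Lambda=\sum_i\mathrm{pr}_{\mathrm{span}\Lambda_i}$ (sum of orthogonal projections). $L$ is perfect w.r.t. $\lambda$ if the $\Pi_\Lambda$, $\Lambda\in\mathscr S_\lambda(L)$, span the space of symmetric endomorphisms of $\mathbb R^n$; eutactic if $\mathrm{Id}$ is a positive linear combination of them; strongly eutactic if it is such a combination with all coefficients equal; extreme if $\gamma$ attains a local maximum at $L$. $L$ is strongly perfect w.r.t.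 $\lambda$ if the set of flags of subspaces of shape $d$ determined by the minimal flags (spans of the $\Lambda_i$) is a vexillar $4$-design in $\mathscr D_d$. Here $\mathscr D_d$ is the variety of flags $\{0\}\subsetneq V_\ell\subsetneq\dots\subsetneq V_1\subsetneq\mathbb R^n$, $\dim V_i=d_i$, with $\mathbf O(n)$-invariant probability measure; with $m=d_1$ a flag is represented by $X_\Delta\in M_{n\times m}(\mathbb R)$ with orthonormal columns whose first $d_i$ columns span $V_i$, unique up to right multiplication by the block diagonal group $\mathbf O(d_\ell)\times\mathbf O(d_{\ell-1}-d_\ell)\times\dots\times\mathbf O(d_1-d_2)$; polynomial functions of degree $\le t$ on $\mathscr D_d$ are $\Delta\mapsto P(X_\Delta)$ with $P$ a polynomial of degree $\le t$ in the matrix entries invariant under that group; a vexillar $t$-design is a finite $\mathcal D\subset\mathscr D_d$ with $\int_{\mathscr D_d}f=\frac1{|\mathcal D|}\sum_{\Delta\in\mathcal D}f(\Delta)$ for all such $f$. *)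

theory Defs
  imports "HOL-Probability.Probability"
begin

definition gram_det :: "nat \<Rightarrow> (nat \<Rightarrow> real^'n) \<Rightarrow> real" where
  "gram_det k b = (\<Sum>p\<in>{p. p permutes {..<k}}. of_int (sign p) * (\<Prod>i<k. b i \<bullet> b (p i)))"

definition is_lattice_basis :: "(real^'n) set \<Rightarrow> nat \<Rightarrow> (nat \<Rightarrow> real^'n) \<Rightarrow> bool" where
  "is_lattice_basis Lam k b \<longleftrightarrow>
     (\<forall>c::nat \<Rightarrow> real. (\<Sum>i<k. c i *\<^sub>R b i) = 0 \<longrightarrow> (\<forall>i<k. c i = 0)) \<and>
     Lam = {\<Sum>i<k. of_int (z i) *\<^sub>R b i | z :: nat \<Rightarrow> int. True}"

definition lat_det :: "(real^'n) set \<Rightarrow> nat \<Rightarrow> real" where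
  "lat_det Lam k = gram_det k (SOME b. is_lattice_basis Lam k b)"

definition full_rank_lattice :: "(real^'n) set \<Rightarrow> bool" where
  "full_rank_lattice L \<longleftrightarrow> (\<exists>b. is_lattice_basis L CARD('n) b)"

text \<open>Conjugate partition (lam = conjugate of the partition lambda), parts non-increasing,
  positive and smaller than n.\<close>
definition conj_partition_ok :: "nat list \<Rightarrow> nat \<Rightarrow> bool" where
  "conj_partition_ok lam n \<longleftrightarrow> lam \<noteq> [] \<and> sorted_wrt (\<ge>) lam \<and> (\<forall>x\<in>set lam. 0 < x \<and> x < n)"

definition lat_chain :: "(real^'n) set \<Rightarrow> nat list \<Rightarrow> (real^'n) set list \<Rightarrow> bool" where
  "lat_chain L lam Ls \<longleftrightarrow> length Ls = length lam \<and>
     (\<forall>i<length lam. Ls!i \<subseteq> L \<and> (\<exists>b. is_lattice_basis (Ls!i) (lam!i) b)) \<and>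
     (\<forall>i. Suc i < length lam \<longrightarrow> Ls!(Suc i) \<subseteq> Ls!i)"

definition chain_ratio :: "(real^'n) set \<Rightarrow> nat list \<Rightarrow> (real^'n) set list \<Rightarrow> real" where
  "chain_ratio L lam Ls =
     (\<Prod>i<length lam. lat_det (Ls!i) (lam!i)) /
     (lat_det L CARD('n)) powr (real (sum_list lam) / real CARD('n))"

definition gamma_lam :: "(real^'n) set \<Rightarrow> nat list \<Rightarrow> real" where
  "gamma_lam L lam = Inf (chain_ratio L lam ` {Ls. lat_chain L lam Ls})"

definition min_flags :: "(real^'n) set \<Rightarrow> nat list \<Rightarrow> (real^'n) set list set" where
  "min_flags L lam = {Ls. lat_chain L lam Ls \<and> chain_ratio L lam Ls = gamma_lam L lam}"

definition orth_proj :: "(real^'n) set \<Rightarrow> real^'n \<Rightarrow> real^'n" where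
  "orth_proj V x = (THE y. y \<in> V \<and> (\<forall>z\<in>V. (x - y) \<bullet> z = 0))"

definition Pi_flag :: "(real^'n) set list \<Rightarrow> real^'n^'n" where
  "Pi_flag Ls = (\<Sum>i<length Ls. matrix (orth_proj (span (Ls!i))))"

definition perfect_lam :: "(real^'n) set \<Rightarrow> nat list \<Rightarrow> bool" where
  "perfect_lam L lam \<longleftrightarrow> span (Pi_flag ` min_flags L lam) = {A. transpose A = A}"

definition strongly_eutactic_lam :: "(real^'n) set \<Rightarrow> nat list \<Rightarrow> bool" where
  "strongly_eutactic_lam L lam \<longleftrightarrow>
     (\<exists>c>0. (\<Sum>Ls\<in>min_flags L lam. c *\<^sub>R Pi_flag Ls) = mat 1)"

text \<open>Local maximum of gamma on the space of full-rank lattices: lattices near L are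
  exactly the g L with g close to the identity.\<close>
definition extreme_lam :: "(real^'n) set \<Rightarrow> nat list \<Rightarrow> bool" where
  "extreme_lam L lam \<longleftrightarrow>
     (\<exists>\<epsilon>>0. \<forall>g::real^'n^'n. invertible g \<and> norm (g - mat 1) < \<epsilon> \<longrightarrow>
        gamma_lam ((\<lambda>x. g *v x) ` L) lam \<le> gamma_lam L lam)"

text \<open>A flag of shape d (d strictly decreasing): list of subspaces Delta!r = V_(r+1),
  dim V_(r+1) = d!r, nested V_1 \<supset> V_2 \<supset> ...\<close>
definition is_flag :: "nat list \<Rightarrow> (real^'n) set list \<Rightarrow> bool" where
  "is_flag d Delta \<longleftrightarrow> length Delta = length d \<and>
     (\<forall>r<length d. subspace (Delta!r) \<and> dim (Delta!r) = d!r) \<and>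
     (\<forall>r. Suc r < length d \<longrightarrow> Delta!(Suc r) \<subseteq> Delta!r)"

text \<open>n x m matrices are functions X i j, i row (type 'n), j < m column.\<close>
definition col :: "('n \<Rightarrow> nat \<Rightarrow> real) \<Rightarrow> nat \<Rightarrow> real^'n" where
  "col X j = (\<chi> i. X i j)"

definition represents :: "nat list \<Rightarrow> (real^'n) set list \<Rightarrow> ('n \<Rightarrow> nat \<Rightarrow> real) \<Rightarrow> bool" where
  "represents d Delta X \<longleftrightarrow>
     (\<forall>a<hd d. \<forall>b<hd d. (\<Sum>i\<in>UNIV. X i a * X i b) = (if a = b then 1 else 0)) \<and>
     (\<forall>r<length d. span {col X j | j. j < d!r} = Delta!r)"

definition rep :: "nat list \<Rightarrow> (real^'n) set list \<Rightarrow> ('n \<Rightarrow> nat \<Rightarrow> real)" where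
  "rep d Delta = (SOME X. represents d Delta X)"

definition poly_le :: "nat \<Rightarrow> nat \<Rightarrow> (('n::finite \<Rightarrow> nat \<Rightarrow> real) \<Rightarrow> real) \<Rightarrow> bool" where
  "poly_le t m P \<longleftrightarrow> (\<exists>E a. finite E \<and>
     (\<forall>e\<in>E. (\<forall>i j. m \<le> j \<longrightarrow> e (i, j) = (0::nat)) \<and> (\<Sum>p\<in>UNIV \<times> {..<m}. e p) \<le> t) \<and>
     (\<forall>X. P X = (\<Sum>e\<in>E. a e * (\<Prod>p\<in>UNIV \<times> {..<m}. X (fst p) (snd p) ^ e p))))"

text \<open>Block index of column j for shape d: blocks [0,d_l), [d_l,d_(l-1)), ..., [d_2,d_1).\<close>
definition blk :: "nat list \<Rightarrow> nat \<Rightarrow> nat" where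
  "blk d j = card {r. r < length d \<and> d!r \<le> j}"

text \<open>k is in O(d_l) x O(d_(l-1)-d_l) x ... x O(d_1-d_2) (as m x m matrix).\<close>
definition block_orth :: "nat list \<Rightarrow> (nat \<Rightarrow> nat \<Rightarrow> real) \<Rightarrow> bool" where
  "block_orth d k \<longleftrightarrow>
     (\<forall>a<hd d. \<forall>b<hd d. (\<Sum>l<hd d. k l a * k l b) = (if a = b then 1 else 0)) \<and>
     (\<forall>a<hd d. \<forall>b<hd d. blk d a \<noteq> blk d b \<longrightarrow> k a b = 0)"

definition rmul :: "('n \<Rightarrow> nat \<Rightarrow> real) \<Rightarrow> (nat \<Rightarrow> nat \<Rightarrow> real) \<Rightarrow> nat \<Rightarrow> ('n \<Rightarrow> nat \<Rightarrow> real)" where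
  "rmul X k m = (\<lambda>i j. if j < m then (\<Sum>l<m. X i l * k l j) else X i j)"

definition block_invariant :: "nat list \<Rightarrow> (('n \<Rightarrow> nat \<Rightarrow> real) \<Rightarrow> real) \<Rightarrow> bool" where
  "block_invariant d P \<longleftrightarrow> (\<forall>k X. block_orth d k \<longrightarrow> P (rmul X k (hd d)) = P X)"

text \<open>Haar probability measure on O(n) (left invariant, concentrated on orthogonal matrices).
  The O(n)-invariant probability measure on the flag variety is its image under
  g \<mapsto> flag spanned by the first columns of g.\<close>
definition haar_On :: "(real^'n^'n) measure \<Rightarrow> bool" where
  "haar_On \<mu> \<longleftrightarrow> prob_space \<mu> \<and> sets \<mu> = sets borel \<and>
     emeasure \<mu> {g. orthogonal_matrix g} = 1 \<and>
     (\<forall>h. orthogonal_matrix h \<longrightarrow> distr \<mu> borel (\<lambda>g. h ** g) = \<mu>)"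

definition idx :: "nat \<Rightarrow> 'n::finite" where
  "idx = (SOME f. bij_betw f {..<CARD('n)} (UNIV :: 'n set))"

definition vexillar_design :: "nat \<Rightarrow> nat list \<Rightarrow> (real^'n) set list set \<Rightarrow> bool" where
  "vexillar_design t d D \<longleftrightarrow> finite D \<and> D \<noteq> {} \<and> (\<forall>Delta\<in>D. is_flag d Delta) \<and>
     (\<forall>P. poly_le t (hd d) P \<and> block_invariant d P \<longrightarrow>
       (\<forall>\<mu>. haar_On \<mu> \<longrightarrow>
          (\<integral>g. P (\<lambda>i j. g $ i $ idx j) \<partial>\<mu>) = (\<Sum>Delta\<in>D. P (rep d Delta)) / real (card D)))"

definition strongly_perfect_lam :: "(real^'n) set \<Rightarrow> nat list \<Rightarrow> bool" where
  "strongly_perfect_lam L lam \<longleftrightarrow>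
     vexillar_design 4 (remdups lam) ((\<lambda>Ls. remdups (map span Ls)) ` min_flags L lam)"

end

theory Submission
  imports Defs "HOL-Computational_Algebra.Polynomial" "Jordan_Normal_Form.Determinant"
begin

text \<open>By Haar averaging (the Haar measure is the law of the Gram-Schmidt orthonormalisation of a
  uniformly random matrix) the design property makes the moments $\sum_\Lambda \Pi_\Lambda$ and
  $\sum_\Lambda \langle \Pi_\Lambda, H\rangle^2$ over the minimal flags invariant under
  orthogonal conjugation. Hence the former is $c\,\mathrm{Id}$ and the latter is
  $B\,(\mathrm{tr} H)^2 + 2C\,\|H\|^2$. Here $C > 0$, as otherwise every $\Pi_\Lambda$ would be
  scalar. This gives perfection and strong eutaxy. For traceless $H$ the numbers
  $\langle \Pi_\Lambda, H\rangle$ have sum $0$ and sum of squares $2C\|H\|^2$, so one of them is at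
  most $-\kappa\|H\|$; the flag ratio of $gL$, where $g^T g = t(\mathrm{Id} + H)$, is at most that of
  $L$ times $\exp(\langle \Pi_\Lambda, H\rangle + O(\|H\|^2))$, hence it does not exceed the
  minimum of $L$ when $g$ is close to the identity.\<close>

no_notation Matrix.scalar_prod (infix "\<bullet>" 70)
no_notation Matrix.vec_index (infixl "$" 100)
hide_const (open) Matrix.mat Matrix.vec Matrix.row Matrix.col Determinant.det Matrix.rows Matrix.cols Matrix.orthogonal Transposition.transpose

text \<open>The design condition speaks about every Haar measure, so it yields information only once
  one is known to exist; hence the construction of one. The averages are never evaluated. Invariance
  alone fixes the moments up to \<open>B\<close>, \<open>C\<close> and \<open>c\<close>, and
  strength 4 is what the second moment costs: \<open>Pi_flag\<close> is quadratic in the matrix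
  entries, and the moment is quadratic in \<open>Pi_flag\<close>. The design lives on flags of
  subspaces, while perfection and eutaxy concern chains of lattices. Sums over the one become sums
  over the other because a minimal flag is recovered from its spans: each member contains every
  vector of L in its span, as otherwise enlarging it would lower the ratio. For extremality only an
  upper bound of \<gamma>(gL) is wanted, so one minimal flag of L is transported by g. Which one
  depends on g; the error constants therefore have to be uniform over chains. The gain is linear in
  the norm of H and the error quadratic, so the gain wins near the identity. The ratio is invariant
  under scaling, which allows H to be traceless.\<close>

definition pdet :: "nat \<Rightarrow> (nat \<Rightarrow> nat \<Rightarrow> 'a::comm_ring_1) \<Rightarrow> 'a" where
  "pdet k m = (\<Sum>p\<in>{p. p permutes {..<k}}. of_int (sign p) * (\<Prod>i<k. m i (p i)))"

lemma gram_det_pdet: "gram_det k b = pdet k (\<lambda>i j. b i \<bullet> b j)"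
  by (simp add: gram_det_def pdet_def)

lemma pdet_cong: "(\<And>i j. i < k \<Longrightarrow> j < k \<Longrightarrow> m i j = m' i j) \<Longrightarrow> pdet k m = pdet k m'"
  unfolding pdet_def by (intro sum.cong prod.cong arg_cong2[where f="(*)"] refl) (auto dest: permutes_in_image)

text \<open>Ranks are values such as \<open>lam ! i\<close>, not types, so the determinant theory
  comes from matrices that carry their dimension. \<open>pdet\<close> lives over a commutative ring
  because it serves integer transition matrices as well as real Gram matrices.\<close>

lemma pdet_mat: "pdet k m = Determinant.det (Matrix.mat k k (\<lambda>(i,j). m i j))"
  unfolding pdet_def
  by (subst det_def'[of _ k]) (auto simp: atLeast0LessThan sign_def intro!: sum.cong prod.cong dest: permutes_in_image)

lemma pdet_of_int: "pdet k (\<lambda>i j. of_int (m i j)) = of_int (pdet k m)"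
  unfolding pdet_def by simp

lemma pdet_mult: "pdet k (\<lambda>i j. \<Sum>l<k. A i l * B l j) = pdet k A * pdet k B"
proof -
  have "Matrix.mat k k (\<lambda>(i,j). \<Sum>l<k. A i l * B l j) = Matrix.mat k k (\<lambda>(i,j). A i j) * Matrix.mat k k (\<lambda>(i,j). B i j)"
    by (rule eq_matI) (auto simp: scalar_prod_def atLeast0LessThan)
  then show ?thesis unfolding pdet_mat by (simp add: det_mult[of _ k])
qed

lemma pdet_transpose: "pdet k (\<lambda>i j. A j i) = pdet k A"
proof -
  have "Matrix.mat k k (\<lambda>(i,j). A j i) = transpose_mat (Matrix.mat k k (\<lambda>(i,j). A i j))"
    by (rule eq_matI) auto
  then show ?thesis unfolding pdet_mat by (simp add: Determinant.det_transpose[of _ k])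
qed

lemma pdet_one: "pdet k (\<lambda>i j. if i = j then 1 else 0) = 1"
proof -
  have "Matrix.mat k k (\<lambda>(i,j). if i = j then 1 else 0) = (1\<^sub>m k :: 'a Matrix.mat)"
    by (rule eq_matI) auto
  then show ?thesis unfolding pdet_mat by simp
qed

text \<open>\<open>V\<close> is the adjugate. It avoids division, so over the integers it inverts,
  up to sign, a transition matrix of determinant 1 or -1.\<close>

lemma pdet_adjugate:
  obtains V where "\<And>i j. i < k \<Longrightarrow> j < k \<Longrightarrow> (\<Sum>l<k. V i l * A l j) = (if i = j then pdet k A else 0)"
proof -
  let ?A = "Matrix.mat k k (\<lambda>(i,j). A i j)"
  have c: "?A \<in> carrier_mat k k" by simp
  note adj = adj_mat[OF c]
  have "(\<Sum>l<k. adj_mat ?A $$ (i, l) * A l j) = (if i = j then pdet k A else 0)" if ij: "i < k" "j < k" for i j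
  proof -
    have "(\<Sum>l<k. adj_mat ?A $$ (i, l) * A l j) = (adj_mat ?A * ?A) $$ (i, j)"
      using ij adj(1) by (auto simp: scalar_prod_def atLeast0LessThan intro!: sum.cong)
    also have "\<dots> = (if i = j then pdet k A else 0)"
      using ij by (simp add: adj(3) pdet_mat)
    finally show ?thesis .
  qed
  then show ?thesis by (rule that[of "\<lambda>i l. adj_mat ?A $$ (i, l)"])
qed

text \<open>A left inverse of a square matrix is also a right inverse; here it is the transpose of
  \<open>K\<close>.\<close>

lemma pdet_orthonormal_rows:
  fixes K :: "nat \<Rightarrow> nat \<Rightarrow> 'a::field"
  assumes "\<And>a b. a < m \<Longrightarrow> b < m \<Longrightarrow> (\<Sum>l<m. K l a * K l b) = (if a = b then 1 else 0)"
    and "a < m" "b < m"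
  shows "(\<Sum>l<m. K a l * K b l) = (if a = b then 1 else 0)"
proof -
  let ?K = "Matrix.mat m m (\<lambda>(i,j). K i j)"
  have "transpose_mat ?K * ?K = 1\<^sub>m m"
    by (rule eq_matI) (auto simp: scalar_prod_def atLeast0LessThan assms(1))
  then have "?K * transpose_mat ?K = 1\<^sub>m m"
    by (rule mat_mult_left_right_inverse[rotated 2]) auto
  then have "(?K * transpose_mat ?K) $$ (a, b) = (1\<^sub>m m) $$ (a, b)" by simp
  then show ?thesis using assms(2,3) by (simp add: scalar_prod_def atLeast0LessThan)
qed

text \<open>The Gram matrix of \<open>c\<close> is U G U^T, with G the Gram matrix of
  \<open>b\<close>.\<close>

lemma gram_det_lincomb:
  assumes "\<And>i. i < k \<Longrightarrow> c i = (\<Sum>j<k. U i j *\<^sub>R b j)"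
  shows "gram_det k c = (pdet k U)\<^sup>2 * gram_det k b"
proof -
  have "gram_det k c = pdet k (\<lambda>i j. \<Sum>l<k. U i l * (\<Sum>l'<k. (b l \<bullet> b l') * U j l'))"
    unfolding gram_det_pdet
    by (intro pdet_cong, simp add: assms inner_sum_left inner_sum_right sum_distrib_left mult_ac, rule sum.swap)
  also have "\<dots> = pdet k U * (gram_det k b * pdet k (\<lambda>i j. U j i))"
    unfolding gram_det_pdet pdet_mult ..
  finally show ?thesis by (simp add: pdet_transpose[of k U] power2_eq_square)
qed

section \<open>Haar measure on the orthogonal group\<close>

lemma nn_integral_lborel_reflect:
  fixes a :: "'a::euclidean_space"
  assumes [measurable]: "h \<in> borel_measurable borel"
  shows "(\<integral>\<^sup>+x. h (a - x) \<partial>lborel) = (\<integral>\<^sup>+x. h x \<partial>lborel)"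
proof -
  have "lborel = density (distr lborel borel (\<lambda>x::'a. a + (-1) *\<^sub>R x)) (\<lambda>_. 1)"
    using lborel_affine[of "-1" a] by simp
  then have "(lborel :: 'a measure) = distr lborel borel (\<lambda>x. a - x)"
    by (simp add: density_1)
  then have "(\<integral>\<^sup>+x. h x \<partial>lborel) = (\<integral>\<^sup>+x. h x \<partial>distr lborel borel (\<lambda>x. a - x))"
    by simp
  then show ?thesis by (simp add: nn_integral_distr)
qed

lemma nn_integral_lborel_translate:
  fixes a :: "'a::euclidean_space"
  assumes [measurable]: "h \<in> borel_measurable borel"
  shows "(\<integral>\<^sup>+x. h (a + x) \<partial>lborel) = (\<integral>\<^sup>+x. h x \<partial>lborel)"
proof -
  have "(\<integral>\<^sup>+x. h x \<partial>lborel) = (\<integral>\<^sup>+x. h x \<partial>distr lborel borel ((+) a))"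
    by (simp add: lborel_distr_plus)
  then show ?thesis by (simp add: nn_integral_distr)
qed

text \<open>Both sides are translation invariant, so integrating
  $(x, w) \mapsto 1_A(x)\, 1_B(f w - x)$ in the two orders compares their values on
  $A$ with their values on the unit ball $B$, which $f$ preserves.\<close>
lemma lborel_orthogonal_invariant:
  fixes f :: "'a::euclidean_space \<Rightarrow> 'a"
  assumes f: "orthogonal_transformation f"
  shows "distr lborel borel f = lborel"
proof (rule measure_eqI)
  have lin: "linear f" using f by (rule orthogonal_transformation_linear)
  have [measurable]: "f \<in> borel_measurable borel"
    by (intro borel_measurable_continuous_onI linear_continuous_on linear_conv_bounded_linear[THEN iffD1] lin)
  show "sets (distr lborel borel f) = sets lborel" by simp
  fix A assume "A \<in> sets (distr lborel borel f)"
  then have A[measurable]: "A \<in> sets borel" by simp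
  define B where "B = ball (0::'a) 1"
  have B[measurable]: "B \<in> sets borel" by (simp add: B_def)
  have fB: "indicator B (f x) = (indicator B x :: ennreal)" for x
    by (simp add: B_def indicator_def orthogonal_transformation_norm[OF f])
  have lB: "emeasure lborel B \<noteq> 0" "emeasure lborel B \<noteq> \<infinity>"
    unfolding B_def using emeasure_lborel_ball_finite[of "0::'a" 1] content_ball_pos[of 1 "0::'a"]
    by (auto simp: measure_def)
  obtain f' where f': "\<And>x. f (f' x) = x"
    using orthogonal_transformation_surj[OF f] by (metis surj_def)
  have "(\<integral>\<^sup>+w. (\<integral>\<^sup>+x. indicator A x * indicator B (f w - x) \<partial>lborel) \<partial>lborel)
      = (\<integral>\<^sup>+x. (\<integral>\<^sup>+w. indicator A x * indicator B (f w - x) \<partial>lborel) \<partial>lborel)"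
    by (intro lborel_pair.Fubini') measurable
  also have "\<dots> = (\<integral>\<^sup>+x. indicator A x * emeasure lborel B \<partial>lborel)"
  proof (intro nn_integral_cong)
    fix x
    have "(\<integral>\<^sup>+w. indicator A x * indicator B (f w - x) \<partial>lborel)
        = indicator A x * (\<integral>\<^sup>+w. indicator B (f w - x) \<partial>lborel)"
      by (intro nn_integral_cmult) measurable
    also have "(\<integral>\<^sup>+w. indicator B (f w - x) \<partial>lborel) = (\<integral>\<^sup>+w. indicator B (- f' x + w) \<partial>lborel)"
      using fB by (intro nn_integral_cong) (metis (no_types) add.commute f' lin linear_diff uminus_add_conv_diff)
    also have "\<dots> = (\<integral>\<^sup>+w. indicator B w \<partial>lborel)"
      by (rule nn_integral_lborel_translate) measurable
    finally show "(\<integral>\<^sup>+w. indicator A x * indicator B (f w - x) \<partial>lborel) = indicator A x * emeasure lborel B"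
      by simp
  qed
  also have "\<dots> = emeasure lborel A * emeasure lborel B"
    by (subst nn_integral_multc) auto
  finally have 1: "(\<integral>\<^sup>+w. (\<integral>\<^sup>+x. indicator A x * indicator B (f w - x) \<partial>lborel) \<partial>lborel)
      = emeasure lborel A * emeasure lborel B" .
  have "(\<integral>\<^sup>+w. (\<integral>\<^sup>+x. indicator A x * indicator B (f w - x) \<partial>lborel) \<partial>lborel)
     = (\<integral>\<^sup>+w. (\<integral>\<^sup>+x. indicator A (f w - x) * indicator B x \<partial>lborel) \<partial>lborel)"
  \<comment> \<open>The substitution x \<mapsto> f w - x preserves Lebesgue measure and exchanges
    the arguments of the two indicators, so that \<open>A\<close> is now the set evaluated at points
    involving \<open>f w\<close>.\<close>
  proof (rule nn_integral_cong)
    fix w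
    show "(\<integral>\<^sup>+x. indicator A x * indicator B (f w - x) \<partial>lborel) = (\<integral>\<^sup>+x. (indicator A (f w - x) * indicator B x :: ennreal) \<partial>lborel)"
      using nn_integral_lborel_reflect[of "\<lambda>x. indicator A x * indicator B (f w - x)" "f w"] by (simp add: mult.commute)
  qed
  also have "\<dots> = (\<integral>\<^sup>+x. (\<integral>\<^sup>+w. indicator A (f w - x) * indicator B x \<partial>lborel) \<partial>lborel)"
    by (intro lborel_pair.Fubini') measurable
  also have "\<dots> = (\<integral>\<^sup>+x. emeasure (distr lborel borel f) A * indicator B x \<partial>lborel)"
  proof (intro nn_integral_cong)
    fix x
    have "(\<integral>\<^sup>+w. indicator A (f w - x) * indicator B x \<partial>lborel)
        = (\<integral>\<^sup>+w. indicator A (f w - x) \<partial>lborel) * indicator B x"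
      by (intro nn_integral_multc) measurable
    also have "(\<integral>\<^sup>+w. indicator A (f w - x) \<partial>lborel) = (\<integral>\<^sup>+w. indicator A (f (- f' x + w)) \<partial>lborel)"
      by (intro nn_integral_cong) (metis (no_types) add.commute f' lin linear_diff uminus_add_conv_diff)
    also have "\<dots> = (\<integral>\<^sup>+w. indicator A (f w) \<partial>lborel)"
      by (rule nn_integral_lborel_translate) measurable
    also have "\<dots> = (\<integral>\<^sup>+w. indicator A w \<partial>distr lborel borel f)"
      by (subst nn_integral_distr) auto
    finally show "(\<integral>\<^sup>+w. indicator A (f w - x) * indicator B x \<partial>lborel) = emeasure (distr lborel borel f) A * indicator B x"
      by simp
  qed
  also have "\<dots> = emeasure (distr lborel borel f) A * emeasure lborel B"
    by (subst nn_integral_cmult) auto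
  finally show "emeasure (distr lborel borel f) A = emeasure lborel A"
    using 1 lB by (auto simp: mult.commute[of _ "emeasure lborel B"] ennreal_mult_cancel_left)
qed

text \<open>By the Leibniz formula with linear polynomials as entries, the determinant is a
  polynomial in t. It is not zero: 1 + s A is invertible for small s, and equals s times A + (1/s)
  1. The point \<open>2/d\<close> below is 1/s for s = \<open>d/2\<close>.\<close>

lemma finite_det_shift_roots:
  fixes A :: "real^'n^'n"
  shows "finite {t. det (A + t *\<^sub>R mat 1) = 0}"
proof -
  define I :: "real^'n^'n" where "I = mat 1"
  define p :: "real poly" where "p = (\<Sum>q\<in>{q. q permutes (UNIV::'n set)}. [:of_int (sign q):] * (\<Prod>i\<in>UNIV. [:A $ i $ q i, I $ i $ q i:]))"
  have p: "poly p t = det (A + t *\<^sub>R I)" for t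
    unfolding p_def Determinants.det_def by (simp add: poly_sum poly_prod)
  have c: "continuous_on UNIV (\<lambda>s. det (I + s *\<^sub>R A))"
    unfolding Determinants.det_def by (intro continuous_intros)
  then have "(\<lambda>s. det (I + s *\<^sub>R A)) \<midarrow>0\<rightarrow> det (I + 0 *\<^sub>R A)"
    unfolding continuous_on_eq_continuous_at[OF open_UNIV] isCont_def by blast
  then have "\<forall>\<^sub>F s in at (0::real). det (I + s *\<^sub>R A) \<noteq> 0"
    by (intro tendsto_imp_eventually_ne) (auto simp: I_def)
  then obtain d where d: "d > 0" "\<And>s. s \<noteq> 0 \<Longrightarrow> dist s 0 < d \<Longrightarrow> det (I + s *\<^sub>R A) \<noteq> 0"
    by (auto simp: eventually_at)
  have "det (I + (d/2) *\<^sub>R A) \<noteq> 0" using d by auto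
  moreover have "I + (d/2) *\<^sub>R A = (d/2) *\<^sub>R (A + (2/d) *\<^sub>R I)"
    using d(1) by (simp add: scaleR_right_distrib)
  moreover have "det (c *\<^sub>R X) = c ^ CARD('n) * det X" for c and X :: "real^'n^'n"
    by (simp add: Determinants.det_def prod.distrib sum_distrib_left mult_ac)
  ultimately have "poly p (2/d) \<noteq> 0" by (metis mult_zero_right p)
  then have "p \<noteq> 0" by auto
  then have "finite {t. poly p t = 0}" by (rule poly_roots_finite)
  then show ?thesis by (simp add: p I_def)
qed

text \<open>Fubini along the lines in the direction of the identity matrix, each of which meets the
  singular set in finitely many points. The shift t runs through an interval of length 1, so
  averaging over the translates returns the measure of the singular set.\<close>

lemma AE_det_nonzero:
  "AE A in (lborel :: (real^'n^'n) measure). det A \<noteq> 0"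
proof -
  define Z where "Z = {A :: real^'n^'n. det A = 0}"
  have c: "continuous_on UNIV (\<lambda>A :: real^'n^'n. det A)"
    unfolding Determinants.det_def by (intro continuous_intros)
  have Z[measurable]: "Z \<in> sets borel"
    unfolding Z_def using continuous_closed_preimage_constant[OF c closed_UNIV, of 0] by auto
  have fin: "finite {t. det (A + t *\<^sub>R mat 1) = 0}" for A :: "real^'n^'n"
    by (rule finite_det_shift_roots)
  have "(\<integral>\<^sup>+A. indicator Z A \<partial>lborel) * emeasure lborel {0..1::real} 
     = (\<integral>\<^sup>+t. (\<integral>\<^sup>+A. indicator Z A \<partial>lborel) * indicator {0..1::real} t \<partial>lborel)"
    by (subst nn_integral_cmult) auto
  also have "\<dots> = (\<integral>\<^sup>+t. (\<integral>\<^sup>+A. indicator Z (t *\<^sub>R mat 1 + A) \<partial>lborel) * indicator {0..1::real} t \<partial>lborel)"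
    by (intro nn_integral_cong arg_cong2[where f="(*)"] nn_integral_lborel_translate[symmetric] refl) measurable
  also have "\<dots> = (\<integral>\<^sup>+t. (\<integral>\<^sup>+A. indicator Z (t *\<^sub>R mat 1 + A) * indicator {0..1::real} t \<partial>lborel) \<partial>lborel)"
    by (intro nn_integral_cong nn_integral_multc[symmetric]) measurable
  also have "\<dots> = (\<integral>\<^sup>+A. (\<integral>\<^sup>+t. indicator Z (t *\<^sub>R mat 1 + A) * indicator {0..1::real} t \<partial>lborel) \<partial>lborel)"
    by (intro lborel_pair.Fubini') measurable
  also have "\<dots> = (\<integral>\<^sup>+A. 0 \<partial>(lborel :: (real^'n^'n) measure))"
  proof (intro nn_integral_cong)
    fix A :: "real^'n^'n"
    have "AE t in lborel. t \<notin> {t. det (A + t *\<^sub>R mat 1) = 0}"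
      using fin[of A] by (intro AE_not_in countable_imp_null_set_lborel countable_finite)
    then have "AE t in lborel. indicator Z (t *\<^sub>R mat 1 + A) * indicator {0..1::real} t = (0::ennreal)"
      by eventually_elim (simp add: Z_def add.commute)
    then have "(\<integral>\<^sup>+t. indicator Z (t *\<^sub>R mat 1 + A) * indicator {0..1::real} t \<partial>lborel) = (\<integral>\<^sup>+t. 0 \<partial>(lborel :: real measure))"
      by (rule nn_integral_cong_AE)
    then show "(\<integral>\<^sup>+t. indicator Z (t *\<^sub>R mat 1 + A) * indicator {0..1::real} t \<partial>lborel) = 0" by simp
  qed
  finally have "emeasure lborel Z = 0" by simp
  then have "AE A in lborel. A \<notin> Z" by (intro AE_not_in) (auto simp: null_sets_def)
  then show ?thesis by (simp add: Z_def)
qed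

section \<open>Gram-Schmidt orthonormalisation as a Borel map commuting with isometries\<close>

declare sum.cong [fundef_cong]

text \<open>Since \<open>sgn 0 = 0\<close>, a degenerate input yields zero vectors, and the map is
  defined, measurable and equivariant everywhere. Independence enters only for
  orthonormality.\<close>

function gram_schmidt :: "(nat \<Rightarrow> 'a::real_inner) \<Rightarrow> nat \<Rightarrow> 'a" where
  "gram_schmidt a j = sgn (a j - (\<Sum>i<j. (gram_schmidt a i \<bullet> a j) *\<^sub>R gram_schmidt a i))"
  by auto
termination by (relation "Wellfounded.measure snd") auto

declare gram_schmidt.simps [simp del]

lemma gram_schmidt_orthogonal_transformation:
  assumes f: "orthogonal_transformation f"
  shows "gram_schmidt (\<lambda>i. f (a i)) j = f (gram_schmidt a j)"
proof (induction j rule: less_induct)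
  case (less j)
  have lin: "linear f" and inn: "\<And>x y. f x \<bullet> f y = x \<bullet> y"
    using f by (auto simp: orthogonal_transformation_def)
  have "gram_schmidt (\<lambda>i. f (a i)) j = sgn (f (a j) - (\<Sum>i<j. (gram_schmidt a i \<bullet> a j) *\<^sub>R f (gram_schmidt a i)))"
    by (subst gram_schmidt.simps) (simp add: less inn)
  also have "\<dots> = sgn (f (a j - (\<Sum>i<j. (gram_schmidt a i \<bullet> a j) *\<^sub>R gram_schmidt a i)))"
    using lin by (simp add: linear_diff linear_sum linear_cmul)
  also have "\<dots> = f (gram_schmidt a j)"
    using lin by (subst (2) gram_schmidt.simps) (simp add: sgn_div_norm linear_cmul orthogonal_transformation_norm[OF f])
  finally show ?case .
qed

lemma borel_measurable_gram_schmidt: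
  fixes a :: "'b \<Rightarrow> nat \<Rightarrow> 'a::euclidean_space"
  assumes [measurable]: "\<And>j. (\<lambda>x. a x j) \<in> borel_measurable M"
  shows "(\<lambda>x. gram_schmidt (a x) j) \<in> borel_measurable M"
proof (induction j rule: less_induct)
  case (less j)
  note [measurable] = less
  show ?case
    by (subst gram_schmidt.simps) (simp add: sgn_div_norm)
qed

text \<open>The span clause carries the induction: it keeps the subtracted sum in the span of the
  earlier vectors, so the residual \<open>r\<close> cannot vanish and \<open>sgn\<close> gives a
  unit vector.\<close>

lemma gram_schmidt_orthonormal:
  fixes a :: "nat \<Rightarrow> 'a::real_inner"
  assumes "\<And>j. j < n \<Longrightarrow> a j \<notin> span (a ` {..<j})" and "j < n"
  shows "gram_schmidt a j \<in> span (a ` {..j}) \<and>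
    (\<forall>k\<le>j. gram_schmidt a k \<bullet> gram_schmidt a j = (if k = j then 1 else 0))"
  using assms(2)
proof (induction j rule: less_induct)
  case (less j)
  define q where "q = gram_schmidt a"
  define r where "r = a j - (\<Sum>i<j. (q i \<bullet> a j) *\<^sub>R q i)"
  have qj: "q j = sgn r" unfolding q_def r_def by (subst gram_schmidt.simps) simp
  have "q i \<in> span (a ` {..i})" if "i < j" for i using less.IH[of i] less.prems that unfolding q_def by auto
  then have sp: "q i \<in> span (a ` {..<j})" if "i < j" for i
    by (meson that image_mono lessThan_subset_iff span_mono subset_iff atMost_iff lessThan_iff order.strict_trans1)
  have s: "(\<Sum>i<j. (q i \<bullet> a j) *\<^sub>R q i) \<in> span (a ` {..<j})"
    using sp by (intro span_sum span_scale) auto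
  have r0: "r \<noteq> 0" using s assms(1)[of j] less.prems unfolding r_def by auto
  have on: "q i \<bullet> q k = (if i = k then 1 else 0)" if "i < j" "k < j" for i k
    using that less.IH[of k] less.IH[of i] less.prems unfolding q_def
    by (cases "i \<le> k") (auto simp: inner_commute[of "gram_schmidt a i" "gram_schmidt a k"])
  have "q k \<bullet> r = 0" if "k < j" for k
    using that by (simp add: r_def inner_diff_right inner_sum_right on if_distrib[of "\<lambda>x. _ * x"] sum.delta cong: if_cong)
  then have o: "q k \<bullet> q j = 0" if "k < j" for k
    using that by (simp add: qj sgn_div_norm)
  have sub: "span (a ` {..<j}) \<subseteq> span (a ` {..j})" by (intro span_mono image_mono) auto
  have 1: "q j \<in> span (a ` {..j})"
    unfolding qj sgn_div_norm r_def
    using subsetD[OF sub s]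
    by (intro span_scale span_diff) (auto intro: span_base)
  have "q j \<bullet> q j = 1" using r0 by (simp add: qj sgn_div_norm dot_square_norm power2_eq_square)
  then show ?case
    using o 1 unfolding q_def by (auto simp: le_less)
qed

lemma bij_betw_idx: "bij_betw idx {..<CARD('n)} (UNIV :: 'n::finite set)"
proof -
  have "\<exists>f. bij_betw f {..<CARD('n)} (UNIV :: 'n set)"
    by (rule ex_bij_betw_nat_finite[of "UNIV :: 'n set", unfolded atLeast0LessThan]) simp
  then show ?thesis unfolding idx_def by (rule someI_ex)
qed

lemma column_matrix_mult: "column j (A ** B) = A *v column j (B :: real^'n^'m)"
  by (simp add: column_def matrix_matrix_mult_def matrix_vector_mult_def Finite_Cartesian_Product.vec_eq_iff)

text \<open>Orthonormalisation needs an order on the columns. It is borrowed from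
  \<open>idx\<close>, and a column index is turned back into its position.\<close>

definition gs_matrix :: "real^'n^'n \<Rightarrow> real^'n^'n" where
  "gs_matrix A = (\<chi> r c. gram_schmidt (\<lambda>j. column (idx j) A) (inv_into {..<CARD('n)} idx c) $ r)"

lemma column_gs_matrix:
  "column c (gs_matrix A) = gram_schmidt (\<lambda>j. column (idx j) A) (inv_into {..<CARD('n)} idx c)" for A :: "real^'n^'n"
  by (simp add: column_def gs_matrix_def Finite_Cartesian_Product.vec_eq_iff)

lemma orthogonal_matrix_gs_matrix:
  fixes A :: "real^'n^'n"
  assumes d: "det A \<noteq> 0"
  shows "orthogonal_matrix (gs_matrix A)"
proof -
  define a where "a = (\<lambda>j. column (idx j) A)"
  have inj: "inj_on (idx :: nat \<Rightarrow> 'n) {..<CARD('n)}" using bij_betw_idx bij_betw_imp_inj_on by blast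
  have injc: "inj (\<lambda>c. column c A)"
    using d Determinants.det_identical_columns by (meson injI)
  have ind: "a j \<notin> span (a ` {..<j})" if "j < CARD('n)" for j
  proof
    assume *: "a j \<in> span (a ` {..<j})"
    have "a ` {..<j} \<subseteq> columns A - {a j}"
    proof
      fix x assume "x \<in> a ` {..<j}"
      then obtain i where i: "i < j" "x = a i" by auto
      then have "idx i \<noteq> (idx j :: 'n)" using inj that by (auto simp: inj_on_def)
      then have "a i \<noteq> a j" using injc by (auto simp: a_def inj_def)
      then show "x \<in> columns A - {a j}" using i by (auto simp: columns_def a_def)
    qed
    then have "a j \<in> span (columns A - {a j})" using * span_mono by blast
    moreover have "a j \<in> columns A" by (auto simp: columns_def a_def)
    ultimately have "dependent (columns A)" by (auto simp: dependent_def)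
    then show False using d det_dependent_columns by (metis dependent_vec_eq)
  qed
  have on: "gram_schmidt a k \<bullet> gram_schmidt a j = (if k = j then 1 else 0)" if "k < CARD('n)" "j < CARD('n)" for k j
    using gram_schmidt_orthonormal[of "CARD('n)" a j] gram_schmidt_orthonormal[of "CARD('n)" a k] ind that
    by (cases "k \<le> j") (auto simp: inner_commute)
  have iv: "inv_into {..<CARD('n)} idx c < CARD('n)" for c :: 'n
    using inv_into_into[of c idx "{..<CARD('n)}"] bij_betw_idx[where 'n='n] by (auto simp: bij_betw_def)
  have ij: "inv_into {..<CARD('n)} idx c \<noteq> inv_into {..<CARD('n)} idx c'" if "c \<noteq> c'" for c c' :: 'n
    using that inv_into_injective[of "{..<CARD('n)}" idx c c'] bij_betw_idx[where 'n='n] by (auto simp: bij_betw_def)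
  show ?thesis
    unfolding orthogonal_matrix_orthonormal_columns column_gs_matrix a_def[symmetric] Linear_Algebra.orthogonal_def norm_eq_1
    using on iv ij by auto
qed

lemma orthogonal_transformation_matrix_vector_mult:
  "orthogonal_matrix (h :: real^'n^'n) \<Longrightarrow> orthogonal_transformation ((*v) h)"
  by (simp add: orthogonal_transformation_matrix)

text \<open>Left multiplication acts on each column by the isometry \<open>h\<close>, with which
  Gram-Schmidt commutes. This carries invariance of a law on matrices over to its image in the
  orthogonal group.\<close>

lemma gs_matrix_mult:
  fixes h :: "real^'n^'n"
  assumes "orthogonal_matrix h"
  shows "gs_matrix (h ** A) = h ** gs_matrix A"
proof -
  have "column c (gs_matrix (h ** A)) = column c (h ** gs_matrix A)" for c
    by (simp add: column_gs_matrix column_matrix_mult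
        gram_schmidt_orthogonal_transformation[OF orthogonal_transformation_matrix_vector_mult[OF assms]])
  then show ?thesis by (simp add: column_def Finite_Cartesian_Product.vec_eq_iff)
qed

lemma borel_measurable_gs_matrix [measurable]: "gs_matrix \<in> borel_measurable (borel :: (real^'n^'n) measure)"
proof -
  have c: "(\<lambda>A::real^'n^'n. column j A) \<in> borel_measurable borel" for j
    unfolding column_def by (intro borel_measurable_continuous_onI continuous_intros)
  have [measurable]: "(\<lambda>A::real^'n^'n. gram_schmidt (\<lambda>j. column (idx j) A) k) \<in> borel_measurable borel" for k
    by (intro borel_measurable_gram_schmidt c)
  have 1: "(\<lambda>A::real^'n^'n. gs_matrix A \<bullet> b) \<in> borel_measurable borel" if b: "b \<in> Basis" for b
  proof -
    obtain i k where "b = axis i (axis k 1)" using b unfolding Basis_vec_def Basis_real_def by blast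
    then have "(\<lambda>A::real^'n^'n. gs_matrix A \<bullet> b) = (\<lambda>A. gram_schmidt (\<lambda>j. column (idx j) A) (inv_into {..<CARD('n)} idx k) \<bullet> axis i 1)"
      by (simp add: gs_matrix_def inner_axis)
    then show ?thesis by simp
  qed
  show ?thesis using 1 by (subst borel_measurable_euclidean_space) blast
qed

text \<open>The inner product on matrices is the sum over the columns of their inner products, and
  \<open>h\<close> acts isometrically on each column.\<close>

lemma orthogonal_transformation_matrix_mult:
  fixes h :: "real^'n^'n"
  assumes "orthogonal_matrix h"
  shows "orthogonal_transformation ((**) h :: real^'n^'n \<Rightarrow> real^'n^'n)"
proof -
  have "(h ** A) \<bullet> (h ** B) = A \<bullet> B" for A B :: "real^'n^'n"
  proof -
    have cols: "A \<bullet> B = (\<Sum>c\<in>UNIV. column c A \<bullet> column c B)" for A B :: "real^'n^'n"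
      by (simp add: inner_vec_def column_def) (rule sum.swap)
    show ?thesis
      using orthogonal_transformation_matrix_vector_mult[OF assms]
      by (simp add: cols column_matrix_mult orthogonal_transformation_def)
  qed
  moreover have "linear ((**) h :: real^'n^'n \<Rightarrow> real^'n^'n)"
    by (rule linearI) (simp_all add: matrix_add_ldistrib matrix_scalar_ac scalar_matrix_assoc Finite_Cartesian_Product.vec_eq_iff distrib_left sum.distrib matrix_matrix_mult_def sum_distrib_left mult.left_commute)
  ultimately show ?thesis by (simp add: orthogonal_transformation_def)
qed

text \<open>Left multiplication by an orthogonal matrix is an isometry of matrix space, so it
  preserves the uniform law on the unit ball. Equivariance of \<open>gs_matrix\<close> passes this
  on to the image law, which is concentrated on orthogonal matrices because almost every matrix is
  invertible.\<close>

lemma haar_On_exists: "\<exists>\<mu> :: (real^'n^'n) measure. haar_On \<mu>"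
proof -
  let ?B = "ball (0 :: real^'n^'n) 1"
  define U where "U = uniform_measure lborel ?B"
  define \<mu> where "\<mu> = distr U borel gs_matrix"
  have B: "emeasure lborel ?B \<noteq> 0" "emeasure lborel ?B \<noteq> \<infinity>"
    using emeasure_lborel_ball_finite[of "0::real^'n^'n" 1] content_ball_pos[of 1 "0::real^'n^'n"]
    by (auto simp: measure_def)
  interpret U: prob_space U unfolding U_def by (rule prob_space_uniform_measure[OF B])
  have sU[measurable_cong]: "sets U = sets borel" by (simp add: U_def)
  have spU: "space U = UNIV" by (simp add: U_def)
  have mG[measurable]: "gs_matrix \<in> measurable U borel" by measurable
  have p: "prob_space \<mu>" unfolding \<mu>_def by (rule U.prob_space_distr) measurable
  have O: "{g :: real^'n^'n. orthogonal_matrix g} \<in> sets borel"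
  proof -
    have "closed {g :: real^'n^'n. transpose g ** g = mat 1}"
      unfolding Finite_Cartesian_Product.transpose_def matrix_matrix_mult_def
      by (intro closed_Collect_eq continuous_intros)
    then show ?thesis by (simp add: orthogonal_matrix)
  qed
  have ae: "AE A in U. gs_matrix A \<in> {g. orthogonal_matrix g}"
    unfolding U_def
  proof (rule AE_uniform_measureI)
    show "AE A in lborel. A \<in> ?B \<longrightarrow> gs_matrix A \<in> {g. orthogonal_matrix g}"
      using AE_det_nonzero[where 'n='n] by eventually_elim (simp add: orthogonal_matrix_gs_matrix)
  qed simp
  have e: "emeasure \<mu> {g. orthogonal_matrix g} = 1"
    unfolding \<mu>_def using O ae measurable_sets_borel[OF borel_measurable_gs_matrix O, unfolded vimage_def]
    by (subst emeasure_distr) (auto simp: spU sU vimage_def intro!: U.emeasure_eq_1_AE)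
  have "distr \<mu> borel (\<lambda>g. h ** g) = \<mu>" if h: "orthogonal_matrix h" for h :: "real^'n^'n"
  proof -
    note ot = orthogonal_transformation_matrix_mult[OF h]
    have [measurable]: "((**) h :: real^'n^'n \<Rightarrow> real^'n^'n) \<in> borel_measurable borel"
      using orthogonal_transformation_linear[OF ot]
      by (intro borel_measurable_continuous_onI linear_continuous_on linear_conv_bounded_linear[THEN iffD1])
    have U': "distr U borel ((**) h) = U"
    proof (rule measure_eqI)
      fix X assume "X \<in> sets (distr U borel ((**) h))"
      then have X[measurable]: "X \<in> sets borel" by simp
      have hX: "(**) h -` X \<in> sets borel" by (rule measurable_sets_borel[OF _ X]) measurable
      have "emeasure (distr U borel ((**) h)) X = emeasure U ((**) h -` X)"
        by (subst emeasure_distr) (auto simp: spU)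
      also have "\<dots> = emeasure lborel (?B \<inter> (**) h -` X) / emeasure lborel ?B"
        unfolding U_def by (rule emeasure_uniform_measure) (auto simp: hX)
      also have "?B \<inter> (**) h -` X = (**) h -` (?B \<inter> X)"
        by (auto simp: orthogonal_transformation_norm[OF ot])
      also have "emeasure lborel ((**) h -` (?B \<inter> X)) = emeasure (distr lborel borel ((**) h)) (?B \<inter> X)"
        by (subst emeasure_distr) auto
      also have "\<dots> = emeasure lborel (?B \<inter> X)" by (simp add: lborel_orthogonal_invariant[OF ot])
      also have "\<dots> / emeasure lborel ?B = emeasure U X"
        unfolding U_def by (rule emeasure_uniform_measure[symmetric]) auto
      finally show "emeasure (distr U borel ((**) h)) X = emeasure U X" .
    qed (simp add: sU)
    have "distr \<mu> borel ((**) h) = distr U borel ((**) h \<circ> gs_matrix)"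
      unfolding \<mu>_def by (rule distr_distr) measurable
    also have "(**) h \<circ> gs_matrix = gs_matrix \<circ> (**) h" using gs_matrix_mult[OF h] by auto
    also have "distr U borel (gs_matrix \<circ> (**) h) = distr (distr U borel ((**) h)) borel gs_matrix"
      by (rule distr_distr[symmetric]) measurable
    finally show ?thesis using U' unfolding \<mu>_def by simp
  qed
  then have "haar_On \<mu>" using p e unfolding haar_On_def by (auto simp: \<mu>_def)
  then show ?thesis by blast
qed

section \<open>Lattice bases and Gram determinants\<close>

text \<open>The independence clause of \<open>is_lattice_basis\<close>. Coefficients are indexed by
  position rather than by vector, which fits \<open>gram_det\<close> and makes distinctness of the
  vectors part of the notion.\<close>

definition seq_indep :: "nat \<Rightarrow> (nat \<Rightarrow> 'a::real_vector) \<Rightarrow> bool" where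
  "seq_indep k b \<longleftrightarrow> (\<forall>c::nat \<Rightarrow> real. (\<Sum>i<k. c i *\<^sub>R b i) = 0 \<longrightarrow> (\<forall>i<k. c i = 0))"

lemma is_lattice_basis_alt:
  "is_lattice_basis Lam k b \<longleftrightarrow> seq_indep k b \<and> Lam = range (\<lambda>z::nat \<Rightarrow> int. \<Sum>i<k. of_int (z i) *\<^sub>R b i)"
  unfolding is_lattice_basis_def seq_indep_def by auto

lemma seq_indepE: "seq_indep k b \<Longrightarrow> (\<Sum>i<k. c i *\<^sub>R b i) = 0 \<Longrightarrow> i < k \<Longrightarrow> c i = 0"
  unfolding seq_indep_def by blast

lemma seq_indepD:
  assumes "seq_indep k b"
  shows "inj_on b {..<k}" "independent (b ` {..<k})"
proof -
  show inj: "inj_on b {..<k}"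
  proof (rule inj_onI, rule ccontr)
    fix i j assume ij: "i \<in> {..<k}" "j \<in> {..<k}" "b i = b j" "i \<noteq> j"
    let ?c = "\<lambda>l. (if l = i then 1 else 0) - (if l = j then 1 else (0::real))"
    have "(\<Sum>l<k. ?c l *\<^sub>R b l) = 0"
      using ij by (simp add: scaleR_diff_left sum_subtractf if_distrib[of "\<lambda>x. x *\<^sub>R _"] cong: if_cong)
    from seq_indepE[OF assms this, of i] have "?c i = 0" using ij by simp
    then show False using ij by simp
  qed
  show "independent (b ` {..<k})"
  proof (rule independent_if_scalars_zero)
    fix f x assume s: "(\<Sum>x\<in>b ` {..<k}. f x *\<^sub>R x) = 0" and x: "x \<in> b ` {..<k}"
    have "(\<Sum>i<k. f (b i) *\<^sub>R b i) = 0" using s by (simp add: sum.reindex[OF inj])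
    then show "f x = 0" using seq_indepE[OF assms, of "\<lambda>i. f (b i)"] x by auto
  qed simp
qed

lemma seq_indep_dim: "seq_indep k b \<Longrightarrow> dim (span (b ` {..<k})) = k" for b :: "nat \<Rightarrow> 'a::euclidean_space"
  using seq_indepD[of k b] by (simp add: dim_eq_card_independent card_image)

lemma seq_indep_coeffs:
  assumes "seq_indep k b" "x \<in> span (b ` {..<k})"
  obtains c where "x = (\<Sum>i<k. c i *\<^sub>R b i)"
proof -
  obtain u where "x = (\<Sum>v\<in>b ` {..<k}. u v *\<^sub>R v)"
    using assms(2) by (auto simp: span_finite)
  then have "x = (\<Sum>i<k. u (b i) *\<^sub>R b i)" by (simp add: sum.reindex[OF seq_indepD(1)[OF assms(1)]])
  then show ?thesis using that[of "\<lambda>i. u (b i)"] by simp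
qed

lemma seq_indep_Suc:
  assumes "seq_indep k b" "b k \<notin> span (b ` {..<k})"
  shows "seq_indep (Suc k) b"
  unfolding seq_indep_def
proof (intro allI impI)
  fix c i assume s: "(\<Sum>i<Suc k. c i *\<^sub>R b i) = 0" and i: "i < Suc k"
  have ck: "c k = 0"
  proof (rule ccontr)
    assume "c k \<noteq> 0"
    moreover have "c k *\<^sub>R b k = - (\<Sum>i<k. c i *\<^sub>R b i)" using s by (simp add: add_eq_0_iff)
    moreover have "b k = (1 / c k) *\<^sub>R (c k *\<^sub>R b k)" using \<open>c k \<noteq> 0\<close> by simp
    ultimately have "b k = (1 / c k) *\<^sub>R (- (\<Sum>i<k. c i *\<^sub>R b i))" by simp
    moreover have "(1 / c k) *\<^sub>R (- (\<Sum>i<k. c i *\<^sub>R b i)) \<in> span (b ` {..<k})"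
      by (intro span_scale span_neg span_sum) (auto intro: span_base)
    ultimately show False using assms(2) by simp
  qed
  then show "c i = 0" using s i assms(1) unfolding seq_indep_def by (cases "i = k") auto
qed

lemma seq_indep_SucD:
  assumes "seq_indep (Suc k) b"
  shows "seq_indep k b" "b k \<notin> span (b ` {..<k})"
proof -
  show k: "seq_indep k b"
    unfolding seq_indep_def
  proof (intro allI impI)
    fix c i assume "(\<Sum>i<k. c i *\<^sub>R b i) = 0" "i < k"
    then have "(\<Sum>i<Suc k. (if i < k then c i else 0) *\<^sub>R b i) = 0" by simp
    from seq_indepE[OF assms this, of i] have "(if i < k then c i else 0) = 0"
      using \<open>i < k\<close> by simp
    then show "c i = 0" using \<open>i < k\<close> by simp
  qed
  show "b k \<notin> span (b ` {..<k})"
  proof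
    assume "b k \<in> span (b ` {..<k})"
    then obtain c where "b k = (\<Sum>i<k. c i *\<^sub>R b i)" using k seq_indep_coeffs by blast
    then have "(\<Sum>i<Suc k. (if i < k then c i else -1) *\<^sub>R b i) = 0" by simp
    from seq_indepE[OF assms this, of k] have "(if k < k then c k else -1) = (0::real)" by simp
    then show False by simp
  qed
qed

lemma lattice_basis_in_span:
  "range (\<lambda>z::nat \<Rightarrow> int. \<Sum>i<k. of_int (z i) *\<^sub>R b i) \<subseteq> span (b ` {..<k})"
  by (auto intro!: span_sum span_scale intro: span_base)

lemma lattice_basis_mem:
  assumes "is_lattice_basis Lam k b" "i < k"
  shows "b i \<in> Lam"
proof -
  have "b i = (\<Sum>j<k. of_int (if j = i then 1 else 0) *\<^sub>R b j)"
    using assms(2) by (simp add: if_distrib[of of_int] if_distrib[of "\<lambda>x. x *\<^sub>R _"] cong: if_cong)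
  then have "b i \<in> range (\<lambda>z::nat \<Rightarrow> int. \<Sum>j<k. of_int (z j) *\<^sub>R b j)"
    by (intro image_eqI[of _ _ "\<lambda>j. if j = i then 1 else 0"]) simp_all
  then show ?thesis using assms(1) by (simp add: is_lattice_basis_alt)
qed

lemma lattice_span:
  assumes "is_lattice_basis Lam k b"
  shows "span Lam = span (b ` {..<k})"
proof (rule subset_antisym)
  show "span Lam \<subseteq> span (b ` {..<k})"
    using assms lattice_basis_in_span[of b k] unfolding is_lattice_basis_alt by (metis span_minimal subspace_span)
  show "span (b ` {..<k}) \<subseteq> span Lam"
    using lattice_basis_mem[OF assms] by (intro span_mono) auto
qed

lemma lattice_dim: "is_lattice_basis Lam k b \<Longrightarrow> dim (span Lam) = k"
  by (metis is_lattice_basis_alt lattice_span seq_indep_dim)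

lemma lattice_diff: "is_lattice_basis Lam k b \<Longrightarrow> x \<in> Lam \<Longrightarrow> y \<in> Lam \<Longrightarrow> x - y \<in> Lam"
  unfolding is_lattice_basis_alt
  by (auto simp: sum_subtractf[symmetric] scaleR_diff_left[symmetric] of_int_diff[symmetric] simp del: of_int_diff)

lemma lattice_zero: "is_lattice_basis Lam k b \<Longrightarrow> 0 \<in> Lam"
  unfolding is_lattice_basis_alt by (auto intro!: image_eqI[of _ _ "\<lambda>_. 0"])

lemma int_multiple_mem:
  fixes M :: "'a::real_vector set"
  assumes "0 \<in> M" "\<And>x y. x \<in> M \<Longrightarrow> y \<in> M \<Longrightarrow> x - y \<in> M" "x \<in> M"
  shows "of_int z *\<^sub>R x \<in> M"
proof (induction z rule: int_induct[of _ 0])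
  case base then show ?case using assms by simp
next
  case (step1 i)
  have "of_int (i + 1) *\<^sub>R x = of_int i *\<^sub>R x - (0 - x)" by (simp add: scaleR_add_left)
  then show ?case using step1 assms by metis
next
  case (step2 i)
  have "of_int (i - 1) *\<^sub>R x = of_int i *\<^sub>R x - x" by (simp add: scaleR_diff_left)
  then show ?case using step2 assms by metis
qed

lemma subgroup_add_mem:
  fixes M :: "'a::real_vector set"
  assumes "0 \<in> M" "\<And>x y. x \<in> M \<Longrightarrow> y \<in> M \<Longrightarrow> x - y \<in> M" "x \<in> M" "y \<in> M"
  shows "x + y \<in> M"
  using assms(2)[OF assms(3) assms(2)[OF assms(1) assms(4)]] by simp

text \<open>The coefficients of the last basis vector form an ideal of the integers; a vector
  realising its generator completes a basis of the part of the subgroup where that coefficient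
  vanishes.\<close>
lemma subgroup_of_lattice_has_basis:
  fixes M :: "(real^'n) set"
  assumes "seq_indep k b" "M \<subseteq> range (\<lambda>z::nat \<Rightarrow> int. \<Sum>i<k. of_int (z i) *\<^sub>R b i)"
    "0 \<in> M" "\<And>x y. x \<in> M \<Longrightarrow> y \<in> M \<Longrightarrow> x - y \<in> M"
  shows "\<exists>r c. is_lattice_basis M r c"
  using assms
proof (induction k arbitrary: M)
  case 0
  then have "M = {0}" by auto
  then have "is_lattice_basis M 0 b" by (auto simp: is_lattice_basis_alt seq_indep_def)
  then show ?case by blast
next
  case (Suc k)
  note ind = seq_indep_SucD[OF Suc.prems(1)]
  define S where "S = range (\<lambda>z::nat \<Rightarrow> int. \<Sum>i<k. of_int (z i) *\<^sub>R b i)"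
  have S0: "0 \<in> S" unfolding S_def by (auto intro!: image_eqI[of _ _ "\<lambda>_. 0"])
  have Sd: "x - y \<in> S" if "x \<in> S" "y \<in> S" for x y
    using that unfolding S_def
    by (auto simp: sum_subtractf[symmetric] scaleR_diff_left[symmetric] of_int_diff[symmetric] simp del: of_int_diff)
  have Ssp: "S \<subseteq> span (b ` {..<k})" unfolding S_def by (rule lattice_basis_in_span)
  have dec: "\<exists>a s. s \<in> S \<and> x = s + of_int a *\<^sub>R b k" if "x \<in> M" for x
    using Suc.prems(2) that unfolding S_def by (fastforce simp: image_iff)
  define M' where "M' = M \<inter> S"
  obtain r c where c: "is_lattice_basis M' r c"
    using Suc.IH[OF ind(1), of M'] Suc.prems(3,4) S0 Sd unfolding M'_def S_def by blast
  show ?case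
  proof (cases "M \<subseteq> S")
    case True then have "M' = M" unfolding M'_def by auto
    then show ?thesis using c by blast
  next
    case False
    define P where "P = (\<lambda>a::int. \<exists>s\<in>S. s + of_int a *\<^sub>R b k \<in> M)"
    have P_diff: "P (a - a')" if Paa: "P a" "P a'" for a a'
    proof -
      obtain s s' where s: "s \<in> S" "s + of_int a *\<^sub>R b k \<in> M" "s' \<in> S" "s' + of_int a' *\<^sub>R b k \<in> M"
        using Paa unfolding P_def by blast
      then have "(s - s') + of_int (a - a') *\<^sub>R b k \<in> M"
        using Suc.prems(4)[OF s(2) s(4)] by (simp add: scaleR_diff_left algebra_simps)
      then show ?thesis unfolding P_def using Sd s by blast
    qed
    have P0: "P 0" unfolding P_def using S0 Suc.prems(3) by auto
    obtain x where x: "x \<in> M" "x \<notin> S" using False by auto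
    obtain a0 s0 where a0: "s0 \<in> S" "x = s0 + of_int a0 *\<^sub>R b k" using dec x by blast
    have "a0 \<noteq> 0" using a0 x by auto
    moreover have Pa0: "P a0" using a0 x unfolding P_def by blast
    ultimately have "\<exists>m::nat. m > 0 \<and> P (int m)"
      using P_diff[OF P0 Pa0] by (cases "a0 > 0") (auto intro!: exI[of _ "nat \<bar>a0\<bar>"])
    then obtain m where m: "m > 0" "P (int m)" and least: "\<And>j. j < m \<Longrightarrow> \<not> (j > 0 \<and> P (int j))"
      using exists_least_iff[of "\<lambda>m::nat. m > 0 \<and> P (int m)"] by auto
    have P_mult: "P (int m * j)" for j
    proof (induction j rule: int_induct[of _ 0])
      case base show ?case using P0 by simp
    next
      case (step1 i) 
      have "P (int m * i - (0 - int m))" using step1 m P0 P_diff by blast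
      then show ?case by (simp add: algebra_simps)
    next
      case (step2 i)
      have "P (int m * i - int m)" using step2 m P_diff by blast
      then show ?case by (simp add: algebra_simps)
    qed
    have P_dvd: "\<exists>j. a = j * int m" if "P a" for a
    proof -
      have "P (a mod int m)" using P_diff[OF that P_mult[of "a div int m"]] by (simp add: minus_mult_div_eq_mod)
      then have "P (int (nat (a mod int m)))" using m(1) by simp
      then have "nat (a mod int m) = 0" 
        using least[of "nat (a mod int m)"] m(1) by (metis gr0I nat_less_iff of_nat_0_less_iff pos_mod_bound pos_mod_sign)
      then have "a mod int m = 0" using m(1) by (metis nat_0_iff of_nat_0_less_iff order_antisym pos_mod_sign)
      then show ?thesis by (metis dvd_def mod_0_imp_dvd mult.commute)
    qed
    obtain s where s: "s \<in> S" "s + of_int (int m) *\<^sub>R b k \<in> M" using m unfolding P_def by blast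
    define w where "w = s + of_int (int m) *\<^sub>R b k"
    define c' where "c' = c(r := w)"
    have csp: "c ` {..<r} \<subseteq> span (b ` {..<k})"
      using lattice_basis_mem[OF c] Ssp unfolding M'_def by auto
    have wsp: "w \<notin> span (b ` {..<k})"
    proof
      assume "w \<in> span (b ` {..<k})"
      then have "w - s \<in> span (b ` {..<k})" using s Ssp by (auto intro: span_diff)
      then have "(1 / real m) *\<^sub>R (w - s) \<in> span (b ` {..<k})" by (rule span_scale)
      then show False using ind(2) m(1) by (simp add: w_def)
    qed
    have c'eq: "c' i = c i" if "i < r" for i using that by (simp add: c'_def)
    have c'im: "c' ` {..<r} = c ` {..<r}" using c'eq by (intro image_cong) auto
    have "seq_indep r c" using c by (simp add: is_lattice_basis_alt)
    then have "seq_indep r c'" unfolding seq_indep_def using c'eq by simp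
    moreover have "c' r \<notin> span (c' ` {..<r})"
      unfolding c'im using wsp csp span_minimal[OF csp subspace_span] by (auto simp: c'_def)
    ultimately have "seq_indep (Suc r) c'" by (rule seq_indep_Suc)
    moreover have "M = range (\<lambda>z::nat \<Rightarrow> int. \<Sum>i<Suc r. of_int (z i) *\<^sub>R c' i)"
    proof (rule subset_antisym; rule subsetI)
      fix y assume y: "y \<in> M"
      then obtain a t where t: "t \<in> S" "y = t + of_int a *\<^sub>R b k" using dec by blast
      then have "P a" using y unfolding P_def by blast
      then obtain j where j: "a = j * int m" using P_dvd by blast
      have jw: "of_int j *\<^sub>R w \<in> M" using int_multiple_mem[OF Suc.prems(3,4), of w j] s by (simp add: w_def)
      have js: "of_int j *\<^sub>R s \<in> S" using int_multiple_mem[OF S0 Sd, of s j] s by simp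
      \<comment> \<open>With \<open>a = j * int m\<close>, subtracting j copies of \<open>w\<close>
        cancels the component along \<open>b k\<close>; what remains lies in both \<open>M\<close>
        and \<open>S\<close>, where \<open>c\<close> is a basis.\<close>
      have "y - of_int j *\<^sub>R w = t - of_int j *\<^sub>R s"
        by (simp add: t j w_def algebra_simps)
      then have "y - of_int j *\<^sub>R w \<in> M'"
        unfolding M'_def using Suc.prems(4)[OF y jw] Sd[OF t(1) js] by simp
      then obtain z :: "nat \<Rightarrow> int" where z: "y - of_int j *\<^sub>R w = (\<Sum>i<r. of_int (z i) *\<^sub>R c i)"
        using c by (auto simp: is_lattice_basis_alt)
      have "y = (\<Sum>i<Suc r. of_int ((z(r := j)) i) *\<^sub>R c' i)"
        using z by (simp add: c'_def algebra_simps)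
      then show "y \<in> range (\<lambda>z::nat \<Rightarrow> int. \<Sum>i<Suc r. of_int (z i) *\<^sub>R c' i)" by blast
    next
      fix y assume "y \<in> range (\<lambda>z::nat \<Rightarrow> int. \<Sum>i<Suc r. of_int (z i) *\<^sub>R c' i)"
      then obtain z :: "nat \<Rightarrow> int" where z: "y = (\<Sum>i<r. of_int (z i) *\<^sub>R c i) + of_int (z r) *\<^sub>R w"
        by (auto simp: c'_def)
      have "(\<Sum>i<r. of_int (z i) *\<^sub>R c i) \<in> M" using c unfolding is_lattice_basis_alt M'_def by blast
      moreover have "of_int (z r) *\<^sub>R w \<in> M" using int_multiple_mem[OF Suc.prems(3,4), of w "z r"] s by (simp add: w_def)
      ultimately show "y \<in> M" unfolding z using subgroup_add_mem[of M] Suc.prems(3,4) by blast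
    qed
    ultimately have "is_lattice_basis M (Suc r) c'" by (simp only: is_lattice_basis_alt)
    then show ?thesis by blast
  qed
qed

section \<open>Orthonormal sequences, and Gram determinants relative to them\<close>

definition orthonormal_seq :: "nat \<Rightarrow> (nat \<Rightarrow> 'a::real_inner) \<Rightarrow> bool" where
  "orthonormal_seq k u \<longleftrightarrow> (\<forall>a<k. \<forall>b<k. u a \<bullet> u b = (if a = b then 1 else 0))"

lemma orthonormal_seqD: "orthonormal_seq k u \<Longrightarrow> a < k \<Longrightarrow> b < k \<Longrightarrow> u a \<bullet> u b = (if a = b then 1 else 0)"
  by (auto simp: orthonormal_seq_def)

lemma orthonormal_seq_inner_sum:
  assumes "orthonormal_seq k u" "a < k"
  shows "u a \<bullet> (\<Sum>i<k. c i *\<^sub>R u i) = c a"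
proof -
  have "u a \<bullet> (\<Sum>i<k. c i *\<^sub>R u i) = (\<Sum>i<k. if i = a then c i else 0)"
    unfolding inner_sum_right using orthonormal_seqD[OF assms(1)] assms(2) by (intro sum.cong) auto
  then show ?thesis using assms(2) by simp
qed

lemma orthonormal_seq_indep: "orthonormal_seq k u \<Longrightarrow> seq_indep k u"
  unfolding seq_indep_def by (metis inner_zero_right orthonormal_seq_inner_sum)

lemma orthonormal_seq_expand:
  assumes "orthonormal_seq k u" "x \<in> span (u ` {..<k})"
  shows "x = (\<Sum>a<k. (u a \<bullet> x) *\<^sub>R u a)"
proof -
  obtain c where c: "x = (\<Sum>i<k. c i *\<^sub>R u i)"
    using seq_indep_coeffs[OF orthonormal_seq_indep[OF assms(1)] assms(2)] .
  show ?thesis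
    by (subst c, rule sum.cong) (simp_all add: c orthonormal_seq_inner_sum[OF assms(1)])
qed

text \<open>An orthonormal basis of the complement of W in V is appended to \<open>w\<close>.
  Leaving the prefix untouched is what later allows a single sequence to serve all spaces of a
  flag.\<close>

lemma orthonormal_seq_extend:
  fixes V W :: "'a::euclidean_space set"
  assumes "subspace W" "subspace V" "W \<subseteq> V"
    and w: "orthonormal_seq (dim W) w" "span (w ` {..<dim W}) = W"
  obtains u where "\<And>a. a < dim W \<Longrightarrow> u a = w a" "orthonormal_seq (dim V) u" "span (u ` {..<dim V}) = V"
proof -
  define W' where "W' = {y \<in> V. \<forall>x \<in> W. orthogonal x y}"
  have sW': "subspace W'"
    using assms(2) unfolding W'_def subspace_def Linear_Algebra.orthogonal_def by (auto simp: inner_add_right)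
  obtain B where B: "B \<subseteq> W'" "pairwise orthogonal B" "\<And>x. x \<in> B \<Longrightarrow> norm x = 1" "independent B" "card B = dim W'" "span B = W'"
    by (rule orthonormal_basis_subspace[OF sW']) blast
  have d: "dim W' + dim W = dim V"
    unfolding W'_def using assms(1-3) by (rule dim_subspace_orthogonal_to_vectors)
  have "finite B" using B(4) by (rule independent_imp_finite)
  then obtain h where h: "bij_betw h {..<dim W'} B"
    using ex_bij_betw_nat_finite[of B] B(5) by (auto simp: atLeast0LessThan)
  define u where "u = (\<lambda>a. if a < dim W then w a else h (a - dim W))"
  have hB: "h a \<in> B" if "a < dim W'" for a using h that by (auto simp: bij_betw_def)
  have hh: "h a \<bullet> h b = (if a = b then 1 else 0)" if "a < dim W'" "b < dim W'" for a b
  proof (cases "a = b")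
    case True then show ?thesis using B(3)[OF hB[OF that(1)]] by (simp add: dot_square_norm)
  next
    case False
    then have "h a \<noteq> h b" using h that by (auto simp: bij_betw_def inj_on_def)
    then show ?thesis using B(2) hB that False by (auto simp: pairwise_def Linear_Algebra.orthogonal_def)
  qed
  have wW: "w a \<in> W" if "a < dim W" for a
  proof -
    have "w a \<in> span (w ` {..<dim W})" using that by (intro span_base) auto
    then show ?thesis by (simp only: w(2))
  qed
  have wh: "w a \<bullet> h b = 0" if "a < dim W" "b < dim W'" for a b
    using wW[OF that(1)] hB[OF that(2)] B(1) by (auto simp: W'_def Linear_Algebra.orthogonal_def)
  have on: "orthonormal_seq (dim V) u"
    unfolding orthonormal_seq_def u_def
    using orthonormal_seqD[OF w(1)] hh wh d by (auto simp: inner_commute[of "h _" "w _"])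
  have hV: "h a \<in> V" if "a < dim W'" for a
    using hB[OF that] B(1) by (auto simp: W'_def)
  have "u a \<in> V" if "a < dim V" for a
    using wW hV[of "a - dim W"] that d assms(3) unfolding u_def by auto
  then have "span (u ` {..<dim V}) \<subseteq> V" using assms(2) by (intro span_minimal) auto
  moreover have "dim (span (u ` {..<dim V})) = dim V"
    by (rule seq_indep_dim[OF orthonormal_seq_indep[OF on]])
  ultimately have "span (u ` {..<dim V}) = V"
    using assms(2) by (intro subspace_dim_equal) auto
  then show ?thesis using that[of u] on by (simp add: u_def)
qed

lemma orthonormal_seq_exists:
  fixes V :: "'a::euclidean_space set"
  assumes "subspace V"
  obtains u where "orthonormal_seq (dim V) u" "span (u ` {..<dim V}) = V"
  \<comment> \<open>The zero space has dimension 0, so the prefix is empty and the constant sequence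
    is a mere placeholder.\<close>
  using orthonormal_seq_extend[of "{0}" V "\<lambda>_. 0"] assms
  by (auto simp: orthonormal_seq_def subspace_0)

lemma gram_det_orthonormal_seq: "orthonormal_seq k u \<Longrightarrow> gram_det k u = 1"
  unfolding gram_det_pdet by (subst pdet_cong[of k _ "\<lambda>i j. if i = j then 1 else 0"])
    (auto simp: orthonormal_seqD pdet_one)

text \<open>With U the transition matrix from \<open>u\<close> to \<open>b\<close>, both Gram
  determinants acquire the factor (det U)^2. So the effect of \<open>g\<close> on the determinant of
  a lattice depends only on the subspace spanned. Positivity comes from the transition matrix in the
  other direction.\<close>

lemma gram_det_image:
  fixes b :: "nat \<Rightarrow> real^'n"
  assumes "seq_indep k b" "orthonormal_seq k u" "span (u ` {..<k}) = span (b ` {..<k})"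
  shows "linear g \<Longrightarrow> gram_det k (\<lambda>i. g (b i)) = gram_det k b * gram_det k (\<lambda>i. g (u i))"
    and "gram_det k b > 0"
proof -
  define U where "U = (\<lambda>i j. u j \<bullet> b i)"
  have U: "b i = (\<Sum>j<k. U i j *\<^sub>R u j)" if "i < k" for i
  proof -
    have "b i \<in> span (b ` {..<k})" using that by (intro span_base) auto
    then show ?thesis unfolding U_def by (intro orthonormal_seq_expand[OF assms(2)]) (simp only: assms(3))
  qed
  then have b: "gram_det k b = (pdet k U)\<^sup>2"
    using gram_det_lincomb[of k b U u] gram_det_orthonormal_seq[OF assms(2)] by simp
  show "gram_det k (\<lambda>i. g (b i)) = gram_det k b * gram_det k (\<lambda>i. g (u i))" if g: "linear g"
    unfolding b using U g by (intro gram_det_lincomb) (simp add: linear_sum linear_cmul)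
  have "\<exists>c. u i = (\<Sum>j<k. c j *\<^sub>R b j)" if "i < k" for i
    using seq_indep_coeffs[OF assms(1), of "u i"] assms(3) that by (metis imageI lessThan_iff span_base)
  then obtain V where "\<And>i. i < k \<Longrightarrow> u i = (\<Sum>j<k. V i j *\<^sub>R b j)" by metis
  then have "1 = (pdet k V)\<^sup>2 * gram_det k b"
    using gram_det_lincomb[of k u V b] gram_det_orthonormal_seq[OF assms(2)] by simp
  then show "gram_det k b > 0" unfolding b by (metis mult_zero_right zero_less_power2 zero_neq_one zero_power2)
qed

lemma gram_det_pos:
  fixes b :: "nat \<Rightarrow> real^'n"
  assumes "seq_indep k b"
  shows "gram_det k b > 0"
proof -
  obtain u where u: "orthonormal_seq (dim (span (b ` {..<k}))) u"
    "span (u ` {..<dim (span (b ` {..<k}))}) = span (b ` {..<k})"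
    using orthonormal_seq_exists[OF subspace_span] .
  show ?thesis
    by (rule gram_det_image(2)[OF assms, of u]) (use u in \<open>simp_all only: seq_indep_dim[OF assms]\<close>)
qed

lemma sublattice_transition:
  assumes "is_lattice_basis Lam k b" "is_lattice_basis Lam' k' b'" "Lam \<subseteq> Lam'"
  obtains Z :: "nat \<Rightarrow> nat \<Rightarrow> int" where "\<And>i. i < k \<Longrightarrow> b i = (\<Sum>j<k'. of_int (Z i j) *\<^sub>R b' j)"
proof -
  have "\<exists>z::nat \<Rightarrow> int. b i = (\<Sum>j<k'. of_int (z j) *\<^sub>R b' j)" if "i < k" for i
    using lattice_basis_mem[OF assms(1) that] assms(2,3) unfolding is_lattice_basis_alt by auto
  then obtain Z :: "nat \<Rightarrow> nat \<Rightarrow> int" where "\<forall>i<k. b i = (\<Sum>j<k'. of_int (Z i j) *\<^sub>R b' j)" by metis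
  then show ?thesis using that by blast
qed

text \<open>The transition matrix is integral and its determinant \<open>z\<close> is nonzero, so
  z^2 is at least 1. Equality forces z = 1 or z = -1, and then the inverse transition matrix is
  integral too.\<close>

lemma sublattice_gram_det:
  assumes "is_lattice_basis Lam k b" "is_lattice_basis Lam' k b'" "Lam \<subseteq> Lam'"
  shows "gram_det k b' \<le> gram_det k b"
    and "gram_det k b' = gram_det k b \<Longrightarrow> Lam = Lam'"
proof -
  obtain Z :: "nat \<Rightarrow> nat \<Rightarrow> int" where Z: "\<And>i. i < k \<Longrightarrow> b i = (\<Sum>j<k. of_int (Z i j) *\<^sub>R b' j)"
    using sublattice_transition[OF assms] by blast
  define z where "z = pdet k Z"
  have g: "gram_det k b = (of_int z)\<^sup>2 * gram_det k b'"
    using gram_det_lincomb[of k b "\<lambda>i j. of_int (Z i j)" b', OF Z] by (simp add: pdet_of_int z_def)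
  have pos: "gram_det k b > 0" "gram_det k b' > 0"
    using assms gram_det_pos unfolding is_lattice_basis_alt by blast+
  then have "z \<noteq> 0" using g by auto
  then have "1 \<le> z\<^sup>2" by (simp add: int_one_le_iff_zero_less)
  then have "(1::real) \<le> (of_int z)\<^sup>2" by (metis of_int_1_le_iff of_int_power)
  then show "gram_det k b' \<le> gram_det k b" using g pos mult_right_mono[of 1 "(of_int z)\<^sup>2" "gram_det k b'"] by simp
  show "Lam = Lam'" if "gram_det k b' = gram_det k b"
  proof (rule subset_antisym[OF assms(3)])
    have "(of_int z)\<^sup>2 = (1::real)" using that g pos by simp
    then have z1: "z * z = 1" by (metis of_int_1 of_int_eq_iff of_int_power power2_eq_square)
    obtain V where V: "\<And>i j. i < k \<Longrightarrow> j < k \<Longrightarrow> (\<Sum>l<k. V i l * Z l j) = (if i = j then z else 0)"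
      using pdet_adjugate[of k Z] unfolding z_def by blast
    have sub: "0 \<in> Lam" "\<And>x y. x \<in> Lam \<Longrightarrow> y \<in> Lam \<Longrightarrow> x - y \<in> Lam"
      using lattice_zero[OF assms(1)] lattice_diff[OF assms(1)] by blast+
    have sum_mem: "(\<Sum>i<m. of_int (c i) *\<^sub>R f i) \<in> Lam" if "\<And>i. i < m \<Longrightarrow> f i \<in> Lam" for c :: "nat \<Rightarrow> int" and f and m :: nat
      using that by (induction m) (auto intro!: sub(1) subgroup_add_mem[OF sub] int_multiple_mem[OF sub])
    have "b' i \<in> Lam" if i: "i < k" for i
    proof -
      \<comment> \<open>The adjugate satisfies V Z = z 1, so z V is the inverse of Z because z * z =
        1; its rows express \<open>b' i\<close> in the basis \<open>b\<close>.\<close>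
      have "(\<Sum>l<k. of_int (z * V i l) *\<^sub>R b l) = (\<Sum>l<k. \<Sum>j<k. of_int (z * V i l * Z l j) *\<^sub>R b' j)"
        by (intro sum.cong refl) (simp add: Z scaleR_sum_right)
      also have "\<dots> = (\<Sum>j<k. \<Sum>l<k. of_int (z * V i l * Z l j) *\<^sub>R b' j)" by (rule sum.swap)
      also have "\<dots> = (\<Sum>j<k. of_int (z * (\<Sum>l<k. V i l * Z l j)) *\<^sub>R b' j)"
        by (simp add: sum_distrib_left scaleR_sum_left mult.assoc)
      also have "\<dots> = (\<Sum>j<k. if j = i then b' j else 0)"
        using i V z1 by (intro sum.cong refl) (auto simp flip: of_int_mult)
      also have "\<dots> = b' i" using i by simp
      finally show ?thesis using sum_mem[of k b "\<lambda>l. z * V i l"] lattice_basis_mem[OF assms(1)] by simp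
    qed
    then show "Lam' \<subseteq> Lam" using assms(2) sum_mem[of k b'] unfolding is_lattice_basis_alt by auto
  qed
qed

text \<open>Two bases of the same lattice bound each other's Gram determinant, so the basis chosen
  in \<open>lat_det\<close> is immaterial.\<close>

lemma lat_det_eq:
  assumes "is_lattice_basis Lam k b"
  shows "lat_det Lam k = gram_det k b"
proof -
  have "is_lattice_basis Lam k (SOME b. is_lattice_basis Lam k b)"
    using assms someI[of "is_lattice_basis Lam k" b] by simp
  then show ?thesis unfolding lat_det_def
    using sublattice_gram_det(1) assms by (meson order_antisym order_refl)
qed

lemma lat_det_pos: "is_lattice_basis Lam k b \<Longrightarrow> lat_det Lam k > 0"
  using lat_det_eq[of Lam k b] gram_det_pos[of k b] by (simp add: is_lattice_basis_alt)

lemma lattice_basis_image: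
  assumes "is_lattice_basis Lam k b" "linear g" "inj g"
  shows "is_lattice_basis (g ` Lam) k (\<lambda>i. g (b i))"
proof -
  have s: "(\<Sum>i<k. c i *\<^sub>R g (b i)) = g (\<Sum>i<k. c i *\<^sub>R b i)" for c
    using assms(2) by (simp add: linear_sum linear_cmul)
  have "g x = 0 \<Longrightarrow> x = 0" for x using assms(2,3) by (metis injD linear_0)
  then have "seq_indep k (\<lambda>i. g (b i))"
    using assms(1) unfolding is_lattice_basis_alt seq_indep_def s by blast
  then show ?thesis
    using assms(1) unfolding is_lattice_basis_alt s by (auto simp: image_image)
qed

lemma lat_det_image:
  assumes "is_lattice_basis Lam k b" "linear g" "inj g"
    "orthonormal_seq k u" "span (u ` {..<k}) = span Lam"
  shows "lat_det (g ` Lam) k = lat_det Lam k * gram_det k (\<lambda>i. g (u i))"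
  using lat_det_eq[OF lattice_basis_image[OF assms(1-3)]] lat_det_eq[OF assms(1)]
    gram_det_image(1)[OF _ assms(4) _ assms(2)] assms(1,5) lattice_span[OF assms(1)]
  unfolding is_lattice_basis_alt by simp

section \<open>Chains of sublattices, their ratios and their saturation\<close>

lemma lat_chainD:
  assumes "lat_chain L lam Ls" "i < length lam"
  shows "Ls ! i \<subseteq> L" "\<exists>b. is_lattice_basis (Ls ! i) (lam ! i) b"
  using assms unfolding lat_chain_def by auto

lemma chain_ratio_nonneg:
  assumes "lat_chain L lam Ls"
  shows "chain_ratio L lam Ls \<ge> 0"
  unfolding chain_ratio_def
  by (intro divide_nonneg_nonneg prod_nonneg) (use lat_chainD(2)[OF assms] lat_det_pos in \<open>force intro: less_imp_le\<close>)+

lemma gamma_lam_le: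
  assumes "lat_chain L lam Ls"
  shows "gamma_lam L lam \<le> chain_ratio L lam Ls"
  unfolding gamma_lam_def
  by (intro cInf_lower bdd_belowI[of _ 0]) (use assms chain_ratio_nonneg in auto)

lemma lat_chain_image:
  assumes "lat_chain L lam Ls" "linear g" "inj g"
  shows "lat_chain (g ` L) lam (map ((`) g) Ls)"
proof -
  have "\<exists>b. is_lattice_basis (g ` (Ls ! i)) (lam ! i) b" if "i < length lam" for i
    using lat_chainD(2)[OF assms(1) that] lattice_basis_image[OF _ assms(2,3)] by blast
  then show ?thesis using assms(1) unfolding lat_chain_def by (auto simp: image_mono)
qed

text \<open>Intersecting L with a span gives a subgroup of L, hence a lattice; its span, and so its
  rank, is that of the original member. This is the competitor against a chain that is not
  saturated.\<close>

lemma lat_chain_saturate: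
  assumes L: "is_lattice_basis L n b" and c: "lat_chain L lam Ls"
  shows "lat_chain L lam (map (\<lambda>Lam. L \<inter> span Lam) Ls)"
proof -
  have len: "length Ls = length lam" using c by (simp add: lat_chain_def)
  have "\<exists>b. is_lattice_basis (L \<inter> span (Ls!i)) (lam!i) b" if i: "i < length lam" for i
  proof -
    have "\<exists>r c. is_lattice_basis (L \<inter> span (Ls!i)) r c"
    proof (rule subgroup_of_lattice_has_basis)
      show "seq_indep n b" and "L \<inter> span (Ls!i) \<subseteq> range (\<lambda>z::nat \<Rightarrow> int. \<Sum>i<n. of_int (z i) *\<^sub>R b i)"
        using L by (auto simp: is_lattice_basis_alt)
    qed (use lattice_zero[OF L] lattice_diff[OF L] in \<open>auto simp: span_zero intro: span_diff\<close>)
    then obtain r c where rc: "is_lattice_basis (L \<inter> span (Ls!i)) r c" by blast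
    obtain b' where b': "is_lattice_basis (Ls!i) (lam!i) b'" using lat_chainD(2)[OF c i] by blast
    have "span (L \<inter> span (Ls!i)) = span (Ls!i)"
      using lat_chainD(1)[OF c i] by (intro subset_antisym span_minimal span_mono) (auto intro: span_base)
    then have "r = lam!i" using lattice_dim[OF rc] lattice_dim[OF b'] by simp
    then show ?thesis using rc by blast
  qed
  then show ?thesis
    using c len unfolding lat_chain_def by (auto dest: subsetD[OF span_mono])
qed

text \<open>Passing to the saturation lowers no determinant factor below 0, raises none, and
  strictly lowers each factor at which a member grows. This would beat the minimum. Consequently a
  minimal flag is determined by its spans.\<close>

lemma min_flag_saturated:
  fixes L :: "(real^'n) set"
  assumes L: "is_lattice_basis L CARD('n) b" and m: "Ls \<in> min_flags L lam" and i: "i < length lam"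
  shows "Ls ! i = L \<inter> span (Ls ! i)"
proof (rule ccontr)
  assume neq: "Ls ! i \<noteq> L \<inter> span (Ls ! i)"
  have c: "lat_chain L lam Ls" and g: "chain_ratio L lam Ls = gamma_lam L lam"
    using m by (auto simp: min_flags_def)
  have len: "length Ls = length lam" using c by (simp add: lat_chain_def)
  define Ms where "Ms = map (\<lambda>Lam. L \<inter> span Lam) Ls"
  have M: "lat_chain L lam Ms" unfolding Ms_def using L c by (rule lat_chain_saturate)
  have Mi: "Ms ! j = L \<inter> span (Ls ! j)" if "j < length lam" for j using that len by (simp add: Ms_def)
  have le: "lat_det (Ms!j) (lam!j) \<le> lat_det (Ls!j) (lam!j) \<and> 0 < lat_det (Ms!j) (lam!j)
      \<and> (lat_det (Ms!j) (lam!j) = lat_det (Ls!j) (lam!j) \<longrightarrow> Ls!j = Ms!j)" if j: "j < length lam" for j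
  proof -
    obtain b1 where b1: "is_lattice_basis (Ls!j) (lam!j) b1" using lat_chainD(2)[OF c j] by blast
    obtain b2 where b2: "is_lattice_basis (Ms!j) (lam!j) b2" using lat_chainD(2)[OF M j] by blast
    have "Ls!j \<subseteq> Ms!j" using lat_chainD(1)[OF c j] by (auto simp: Mi[OF j] intro: span_base)
    then show ?thesis using sublattice_gram_det[OF b1 b2] lat_det_eq[OF b1] lat_det_eq[OF b2] lat_det_pos[OF b2] by auto
  qed
  have "(\<Prod>j<length lam. lat_det (Ms!j) (lam!j)) < (\<Prod>j<length lam. lat_det (Ls!j) (lam!j))"
    using le i neq Mi[OF i] by (intro prod_mono_strict[of i]) (force intro: less_le_trans)+
  then have "chain_ratio L lam Ms < chain_ratio L lam Ls"
    unfolding chain_ratio_def using lat_det_pos[OF L] by (intro divide_strict_right_mono) auto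
  then show False using gamma_lam_le[OF M] g by simp
qed

section \<open>Invariance of the moments of a design\<close>

lemma poly_le_monomial:
  assumes "\<And>i j. m \<le> j \<Longrightarrow> e (i, j) = 0" "(\<Sum>p\<in>UNIV \<times> {..<m}. e p) \<le> t"
  shows "poly_le t m (\<lambda>X. c * (\<Prod>p\<in>UNIV \<times> {..<m}. X (fst p) (snd p) ^ e p))"
  unfolding poly_le_def by (rule exI[of _ "{e}"], rule exI[of _ "\<lambda>_. c"]) (use assms in auto)

lemma poly_le_const: "poly_le t m (\<lambda>X. c)"
  using poly_le_monomial[of m "\<lambda>_. 0" t c] by simp

lemma poly_le_entry:
  fixes i :: "'n::finite"
  assumes "j < m"
  shows "poly_le 1 m (\<lambda>X. X i j)"
proof -
  have "(\<Prod>p\<in>UNIV \<times> {..<m}. X (fst p) (snd p) ^ (if p = (i, j) then 1 else 0)) = X i j" for X :: "'n \<Rightarrow> nat \<Rightarrow> real"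
    using assms by (simp add: if_distrib[of "\<lambda>e. _ ^ e"] prod.delta cong: if_cong)
  then show ?thesis
    using poly_le_monomial[of m "\<lambda>p. if p = (i, j) then 1 else 0" 1 1] assms by (auto simp: sum.delta)
qed

lemma poly_le_mono: "poly_le s m P \<Longrightarrow> s \<le> t \<Longrightarrow> poly_le t m P"
  unfolding poly_le_def by (meson order_trans)

lemma poly_le_add:
  assumes "poly_le t m P" "poly_le t m Q"
  shows "poly_le t m (\<lambda>X. P X + Q X)"
proof -
  obtain E a where E: "finite E"
    "\<forall>e\<in>E. (\<forall>i j. m \<le> j \<longrightarrow> e (i, j) = (0::nat)) \<and> (\<Sum>p\<in>UNIV \<times> {..<m}. e p) \<le> t"
    "\<And>X. P X = (\<Sum>e\<in>E. a e * (\<Prod>p\<in>UNIV \<times> {..<m}. X (fst p) (snd p) ^ e p))"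
    using assms(1) unfolding poly_le_def by blast
  obtain F b where F: "finite F"
    "\<forall>e\<in>F. (\<forall>i j. m \<le> j \<longrightarrow> e (i, j) = (0::nat)) \<and> (\<Sum>p\<in>UNIV \<times> {..<m}. e p) \<le> t"
    "\<And>X. Q X = (\<Sum>e\<in>F. b e * (\<Prod>p\<in>UNIV \<times> {..<m}. X (fst p) (snd p) ^ e p))"
    using assms(2) unfolding poly_le_def by blast
  have "P X + Q X = (\<Sum>e\<in>E \<union> F. ((if e \<in> E then a e else 0) + (if e \<in> F then b e else 0)) * (\<Prod>p\<in>UNIV \<times> {..<m}. X (fst p) (snd p) ^ e p))" for X
  proof -
    have "P X = (\<Sum>e\<in>E \<union> F. (if e \<in> E then a e else 0) * (\<Prod>p\<in>UNIV \<times> {..<m}. X (fst p) (snd p) ^ e p))"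
      unfolding E(3) by (rule sum.mono_neutral_cong_left) (use E F in auto)
    moreover have "Q X = (\<Sum>e\<in>E \<union> F. (if e \<in> F then b e else 0) * (\<Prod>p\<in>UNIV \<times> {..<m}. X (fst p) (snd p) ^ e p))"
      unfolding F(3) by (rule sum.mono_neutral_cong_left) (use E F in auto)
    ultimately show ?thesis by (simp add: sum.distrib distrib_right)
  qed
  then show ?thesis
    unfolding poly_le_def using E F
    by (intro exI[of _ "E \<union> F"] exI[of _ "\<lambda>e. (if e \<in> E then a e else 0) + (if e \<in> F then b e else 0)"]) blast
qed

lemma poly_le_sum:
  assumes "\<And>i. i \<in> I \<Longrightarrow> poly_le t m (P i)"
  shows "poly_le t m (\<lambda>X. \<Sum>i\<in>I. P i X)"
  using assms by (induction I rule: infinite_finite_induct) (simp_all add: poly_le_const poly_le_add)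

text \<open>Distinct pairs of exponents may have equal sums, so no exponent set is written down for
  the product: it is expanded into monomials, and collecting them is left to closure under
  sums.\<close>

lemma poly_le_mult:
  assumes "poly_le s m P" "poly_le t m Q"
  shows "poly_le (s + t) m (\<lambda>X. P X * Q X)"
proof -
  obtain E a where E: "finite E"
    "\<forall>e\<in>E. (\<forall>i j. m \<le> j \<longrightarrow> e (i, j) = (0::nat)) \<and> (\<Sum>p\<in>UNIV \<times> {..<m}. e p) \<le> s"
    "\<And>X. P X = (\<Sum>e\<in>E. a e * (\<Prod>p\<in>UNIV \<times> {..<m}. X (fst p) (snd p) ^ e p))"
    using assms(1) unfolding poly_le_def by blast
  obtain F b where F: "finite F"
    "\<forall>e\<in>F. (\<forall>i j. m \<le> j \<longrightarrow> e (i, j) = (0::nat)) \<and> (\<Sum>p\<in>UNIV \<times> {..<m}. e p) \<le> t"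
    "\<And>X. Q X = (\<Sum>e\<in>F. b e * (\<Prod>p\<in>UNIV \<times> {..<m}. X (fst p) (snd p) ^ e p))"
    using assms(2) unfolding poly_le_def by blast
  have "P X * Q X = (\<Sum>e\<in>E. \<Sum>f\<in>F. (a e * b f) * (\<Prod>p\<in>UNIV \<times> {..<m}. X (fst p) (snd p) ^ (e p + f p)))" for X
    unfolding E(3) F(3) sum_product by (intro sum.cong refl) (simp add: power_add prod.distrib)
  moreover have "poly_le (s + t) m (\<lambda>X. \<Sum>e\<in>E. \<Sum>f\<in>F. (a e * b f) * (\<Prod>p\<in>UNIV \<times> {..<m}. X (fst p) (snd p) ^ (e p + f p)))"
    using E(2) F(2) by (intro poly_le_sum poly_le_monomial) (auto simp: sum.distrib intro: add_mono)
  ultimately show ?thesis by simp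
qed

lemma poly_le_inner_col:
  assumes "j < m"
  shows "poly_le 1 m (\<lambda>X. u \<bullet> col X j)"
proof -
  have "poly_le (0 + 1) m (\<lambda>X. \<Sum>i\<in>UNIV. u $ i * X i j)"
    by (intro poly_le_sum poly_le_mult poly_le_const poly_le_entry assms)
  then show ?thesis by (simp add: inner_vec_def Defs.col_def)
qed

text \<open>The bilinear form of \<open>Pi_flag\<close> read off from an orthonormal representative,
  whose first \<open>lam ! i\<close> columns span the i-th space. Repeated parts of
  \<open>lam\<close> are counted with multiplicity, although the shape of the flag has them
  removed.\<close>

definition flag_form :: "nat list \<Rightarrow> real^'n \<Rightarrow> real^'n \<Rightarrow> ('n \<Rightarrow> nat \<Rightarrow> real) \<Rightarrow> real" where
  "flag_form lam u v X = (\<Sum>i<length lam. \<Sum>j<lam ! i. (u \<bullet> col X j) * (v \<bullet> col X j))"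

lemma poly_le_flag_form:
  assumes "\<And>x. x \<in> set lam \<Longrightarrow> x \<le> m"
  shows "poly_le 2 m (flag_form lam u v)"
proof -
  have "poly_le (1 + 1) m (\<lambda>X. \<Sum>i<length lam. \<Sum>j<lam ! i. (u \<bullet> col X j) * (v \<bullet> col X j))"
    using assms by (intro poly_le_sum poly_le_mult poly_le_inner_col) (auto dest: nth_mem less_le_trans)
  then show ?thesis by (simp add: flag_form_def[abs_def] numeral_2_eq_2)
qed

lemma blk_less:
  assumes "D \<in> set d" "j < D" "D \<le> l"
  shows "blk d j < blk d l"
proof -
  obtain r where r: "r < length d" "d ! r = D" using assms(1) by (auto simp: in_set_conv_nth)
  let ?S = "\<lambda>j. {r. r < length d \<and> d ! r \<le> j}"
  have "r \<in> ?S l" "r \<notin> ?S j" "?S j \<subseteq> ?S l" using r assms(2,3) by auto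
  then have "?S j \<subset> ?S l" by blast
  then show ?thesis unfolding blk_def by (intro psubset_card_mono) auto
qed

text \<open>As a part of \<open>d\<close>, the number D is a boundary between blocks, so k mixes the
  first D columns only among themselves, by an orthogonal D x D matrix. The sum needs its rows to be
  orthonormal, while \<open>block_orth\<close> speaks of columns.\<close>

lemma block_sum_invariant:
  assumes k: "block_orth d k" and D: "D \<in> set d" "D \<le> hd d"
  shows "(\<Sum>j<D. (u \<bullet> col (rmul X k (hd d)) j) * (v \<bullet> col (rmul X k (hd d)) j))
    = (\<Sum>j<D. (u \<bullet> col X j) * (v \<bullet> col X j))"
proof -
  let ?m = "hd d"
  have k0: "k a b = 0" if "a < ?m" "b < ?m" "(a < D) \<noteq> (b < D)" for a b
    using k blk_less[OF D(1)] that unfolding block_orth_def by (metis not_le_imp_less order_less_irrefl)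
  have c: "w \<bullet> col (rmul X k ?m) j = (\<Sum>l<D. k l j * (w \<bullet> col X l))" if j: "j < D" for w j
  proof -
    have "col (rmul X k ?m) j = (\<Sum>l<?m. k l j *\<^sub>R col X l)"
      using j D(2) by (simp add: Defs.col_def rmul_def Finite_Cartesian_Product.vec_eq_iff mult.commute)
    then have "w \<bullet> col (rmul X k ?m) j = (\<Sum>l<?m. k l j * (w \<bullet> col X l))"
      by (simp add: inner_sum_right)
    also have "\<dots> = (\<Sum>l<D. k l j * (w \<bullet> col X l))"
      using j D(2) k0[of _ j] by (intro sum.mono_neutral_right) auto
    finally show ?thesis .
  qed
  have rows: "(\<Sum>j<D. k l j * k l' j) = (if l = l' then 1 else 0)" if l: "l < D" "l' < D" for l l'
  proof -
    have "(\<Sum>j<?m. k l j * k l' j) = (if l = l' then 1 else 0)"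
      by (rule pdet_orthonormal_rows[of ?m k]) (use l D(2) k in \<open>simp_all add: block_orth_def\<close>)
    moreover have "(\<Sum>j<?m. k l j * k l' j) = (\<Sum>j<D. k l j * k l' j)"
      using l D(2) k0[of l] by (intro sum.mono_neutral_right) auto
    ultimately show ?thesis by simp
  qed
  have "(\<Sum>j<D. (u \<bullet> col (rmul X k ?m) j) * (v \<bullet> col (rmul X k ?m) j))
      = (\<Sum>j<D. \<Sum>l<D. \<Sum>l'<D. (k l j * k l' j) * ((u \<bullet> col X l) * (v \<bullet> col X l')))"
    by (intro sum.cong refl) (simp add: c sum_product mult_ac)
  also have "\<dots> = (\<Sum>l<D. \<Sum>l'<D. \<Sum>j<D. (k l j * k l' j) * ((u \<bullet> col X l) * (v \<bullet> col X l')))"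
    by (rule trans[OF sum.swap], rule sum.cong[OF refl], rule sum.swap)
  also have "\<dots> = (\<Sum>l<D. \<Sum>l'<D. if l = l' then (u \<bullet> col X l) * (v \<bullet> col X l') else 0)"
    by (intro sum.cong refl) (simp add: sum_distrib_right[symmetric] rows)
  also have "\<dots> = (\<Sum>l<D. (u \<bullet> col X l) * (v \<bullet> col X l))"
    by (intro sum.cong refl) simp
  finally show ?thesis .
qed

lemma flag_form_rmul:
  assumes "block_orth d k" "set lam = set d" "\<And>x. x \<in> set lam \<Longrightarrow> x \<le> hd d"
  shows "flag_form lam u v (rmul X k (hd d)) = flag_form lam u v X"
  unfolding flag_form_def
proof (rule sum.cong[OF refl])
  fix i assume "i \<in> {..<length lam}"
  then have "lam ! i \<in> set d" "lam ! i \<le> hd d" using assms(2) assms(3)[of "lam ! i"] nth_mem[of i lam] by auto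
  then show "(\<Sum>j<lam ! i. (u \<bullet> col (rmul X k (hd d)) j) * (v \<bullet> col (rmul X k (hd d)) j))
    = (\<Sum>j<lam ! i. (u \<bullet> col X j) * (v \<bullet> col X j))"
    by (rule block_sum_invariant[OF assms(1)])
qed

lemma col_matrix: "col (\<lambda>i j. g $ i $ idx j) j = column (idx j) g"
  by (simp add: Defs.col_def column_def)

lemma inner_matrix_vector_transpose:
  fixes h :: "real^'n^'n"
  shows "(h *v x) \<bullet> y = x \<bullet> (transpose h *v y)"
  by (metis dot_lmul_matrix inner_commute transpose_matrix_vector transpose_transpose)

text \<open>Both sides are \<open>card D\<close> times an integral over the orthogonal group. The
  two integrands differ by a left translation, which the Haar measure ignores.\<close>

lemma design_moment_invariant:
  fixes h :: "real^'n^'n"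
  assumes des: "vexillar_design 4 d D"
    and lam: "set lam = set d" "\<And>x. x \<in> set lam \<Longrightarrow> x \<le> hd d"
    and h: "orthogonal_matrix h"
  shows "(\<Sum>Delta\<in>D. flag_form lam (h *v u) (h *v v) (rep d Delta) * flag_form lam (h *v u') (h *v v') (rep d Delta))
       = (\<Sum>Delta\<in>D. flag_form lam u v (rep d Delta) * flag_form lam u' v' (rep d Delta))" (is ?t2)
    and "(\<Sum>Delta\<in>D. flag_form lam (h *v u) (h *v v) (rep d Delta))
       = (\<Sum>Delta\<in>D. flag_form lam u v (rep d Delta))" (is ?t1)
proof -
  obtain \<mu> :: "(real^'n^'n) measure" where \<mu>: "haar_On \<mu>" using haar_On_exists by blast
  have sets[measurable_cong]: "sets \<mu> = sets borel" using \<mu> by (simp add: haar_On_def)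
  define ht where "ht = transpose h"
  have ht: "orthogonal_matrix ht" using h by (simp add: ht_def orthogonal_matrix_transpose)
  have distr: "distr \<mu> borel (\<lambda>g. ht ** g) = \<mu>" using \<mu> ht by (simp add: haar_On_def)
  have mh: "(\<lambda>g. ht ** g) \<in> measurable \<mu> borel"
  proof -
    have "(\<lambda>g::real^'n^'n. ht ** g) \<in> borel_measurable borel"
      unfolding matrix_matrix_mult_def by (intro borel_measurable_continuous_onI continuous_intros)
    then show ?thesis by measurable
  qed
  define emb where "emb = (\<lambda>(g::real^'n^'n) i j. g $ i $ idx j)"
  \<comment> \<open>The inner product of h x with a column of g is that of x with the same column of
    h^T g, so moving the arguments by \<open>h\<close> amounts to translating g by
    \<open>ht\<close>.\<close>
  have shift: "flag_form lam (h *v x) (h *v y) (emb g) = flag_form lam x y (emb (ht ** g))" for x y g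
    unfolding flag_form_def emb_def col_matrix column_matrix_mult inner_matrix_vector_transpose ht_def ..
  have cont: "continuous_on UNIV (\<lambda>g. flag_form lam x y (emb g))" for x y
    unfolding flag_form_def emb_def col_matrix column_def by (intro continuous_intros)
  have avg: "(\<integral>g. P (emb g) \<partial>\<mu>) = (\<Sum>Delta\<in>D. P (rep d Delta)) / real (card D)"
    if "poly_le 4 (hd d) P" "block_invariant d P" for P
    using des \<mu> that unfolding vexillar_design_def emb_def by blast
  have card: "card D > 0" using des by (auto simp: vexillar_design_def card_gt_0_iff)
  have key: "(\<Sum>Delta\<in>D. P (rep d Delta)) = (\<Sum>Delta\<in>D. Q (rep d Delta))"
    if P: "poly_le 4 (hd d) P" "block_invariant d P" and Q: "poly_le 4 (hd d) Q" "block_invariant d Q"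
      and PQ: "\<And>g. P (emb g) = Q (emb (ht ** g))" and c: "continuous_on UNIV (\<lambda>g. Q (emb g))" for P Q
  proof -
    have m: "(\<lambda>g. Q (emb g)) \<in> borel_measurable borel" by (rule borel_measurable_continuous_onI[OF c])
    have "(\<integral>g. Q (emb g) \<partial>\<mu>) = (\<integral>g. Q (emb g) \<partial>distr \<mu> borel (\<lambda>g. ht ** g))" by (simp add: distr)
    also have "\<dots> = (\<integral>g. P (emb g) \<partial>\<mu>)" by (simp add: integral_distr[OF mh m] PQ)
    finally show ?thesis using avg[OF P] avg[OF Q] card by simp
  qed
  have p2: "poly_le 2 (hd d) (flag_form lam x y)" for x y :: "real^'n" by (rule poly_le_flag_form[OF lam(2)])
  have inv: "block_invariant d (flag_form lam x y)" for x y :: "real^'n"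
    by (simp add: block_invariant_def flag_form_rmul[OF _ lam])
  have p4: "poly_le 4 (hd d) (\<lambda>X. flag_form lam x y X * flag_form lam x' y' X)" for x y x' y' :: "real^'n"
    using poly_le_mult[OF p2 p2] by simp
  have inv4: "block_invariant d (\<lambda>X. flag_form lam x y X * flag_form lam x' y' X)" for x y x' y' :: "real^'n"
    using inv unfolding block_invariant_def by simp
  show ?t2 by (rule key[OF p4 inv4 p4 inv4]) (auto simp: shift intro!: continuous_on_mult cont)
  show ?t1 by (rule key[OF poly_le_mono[OF p2] inv poly_le_mono[OF p2] inv]) (auto simp: shift intro!: cont)
qed

section \<open>What orthogonal invariance says about second and fourth moments\<close>

lemma orthogonal_transformationI:
  fixes f :: "real^'n \<Rightarrow> real^'n"
  assumes "linear f" "\<And>x. (\<Sum>k\<in>UNIV. (f x $ k)\<^sup>2) = (\<Sum>k\<in>UNIV. (x $ k)\<^sup>2)"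
  shows "orthogonal_transformation f"
  unfolding orthogonal_transformation using assms by (simp add: norm_vec_def L2_set_def)

lemma orthogonal_transformation_flip:
  "orthogonal_transformation (\<lambda>x::real^'n. \<chi> k. if k = a then - x $ k else x $ k)"
  by (rule orthogonal_transformationI) (auto intro!: linearI sum.cong simp: Finite_Cartesian_Product.vec_eq_iff)

lemma orthogonal_transformation_transpose:
  "orthogonal_transformation (\<lambda>x::real^'n. \<chi> k. x $ Transposition.transpose a b k)"
proof (rule orthogonal_transformationI)
  fix x :: "real^'n"
  have "bij (Transposition.transpose a b)" by simp
  then show "(\<Sum>k\<in>UNIV. ((\<chi> k. x $ Transposition.transpose a b k) $ k)\<^sup>2) = (\<Sum>k\<in>UNIV. (x $ k)\<^sup>2)"
    using sum.reindex_bij_betw[of "Transposition.transpose a b" UNIV UNIV "\<lambda>k. (x $ k)\<^sup>2"] by simp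
qed (auto intro!: linearI simp: Finite_Cartesian_Product.vec_eq_iff)

text \<open>In the plane of the two coordinates this is the matrix with rows (1, 1) and (1, -1)
  divided by \<open>sqrt 2\<close>: up to a reflection, the rotation by 45 degrees.\<close>

lemma orthogonal_transformation_rot:
  assumes "i \<noteq> j"
  shows "orthogonal_transformation (\<lambda>x::real^'n. \<chi> k. if k = i then (x $ i + x $ j) / sqrt 2
    else if k = j then (x $ i - x $ j) / sqrt 2 else x $ k)"
proof (rule orthogonal_transformationI)
  fix x :: "real^'n"
  let ?y = "\<chi> k. if k = i then (x $ i + x $ j) / sqrt 2 else if k = j then (x $ i - x $ j) / sqrt 2 else x $ k"
  have split: "(\<Sum>k\<in>UNIV. (y $ k)\<^sup>2) = (y $ i)\<^sup>2 + ((y $ j)\<^sup>2 + (\<Sum>k\<in>UNIV - {i} - {j}. (y $ k)\<^sup>2))" for y :: "real^'n"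
    using assms by (simp add: sum.remove[of UNIV i] sum.remove[of "UNIV - {i}" j])
  have "(\<Sum>k\<in>UNIV - {i} - {j}. (?y $ k)\<^sup>2) = (\<Sum>k\<in>UNIV - {i} - {j}. (x $ k)\<^sup>2)"
    by (intro sum.cong) auto
  moreover have "(?y $ i)\<^sup>2 + (?y $ j)\<^sup>2 = (x $ i)\<^sup>2 + (x $ j)\<^sup>2"
    using assms by (simp add: power_divide power2_sum power2_diff add_divide_distrib diff_divide_distrib)
  ultimately show "(\<Sum>k\<in>UNIV. (?y $ k)\<^sup>2) = (\<Sum>k\<in>UNIV. (x $ k)\<^sup>2)"
    unfolding split by linarith
qed (auto intro!: linearI simp: Finite_Cartesian_Product.vec_eq_iff add_divide_distrib diff_divide_distrib algebra_simps)

text \<open>Ordered pairs of distinct indices are joined by changing one entry at a time, the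
  symmetry letting either entry be changed. The case \<open>i' = k\<close> is separate because the
  intermediate pair would be diagonal.\<close>

lemma symmetric_function_const:
  assumes sym: "\<And>i k. P i k = P k i"
    and const: "\<And>i k k'. k \<noteq> i \<Longrightarrow> k' \<noteq> i \<Longrightarrow> P i k = P i k'"
    and "i \<noteq> k" "i' \<noteq> k'"
  shows "P i k = P i' k'"
proof (cases "i' = k")
  case True
  then show ?thesis using sym[of i k] const[of i k k'] assms(3,4) by simp
next
  case False
  have "P i k = P k i" by (rule sym)
  also have "\<dots> = P k i'" using const[of i k i'] assms(3) False by simp
  also have "\<dots> = P i' k" by (rule sym)
  also have "\<dots> = P i' k'" using const[of k i' k'] assms(4) False by simp
  finally show ?thesis .
qed

text \<open>Sign changes kill every moment in which an index occurs an odd number of times,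
  transpositions identify the remaining ones up to three constants, and a rotation by
  45 degrees relates these three.\<close>
lemma invariant_fourth_moments:
  fixes A :: "'a \<Rightarrow> real^'n^'n"
  assumes sym: "\<And>f. f \<in> F \<Longrightarrow> transpose (A f) = A f"
    and n: "CARD('n) \<ge> 2"
    and inv: "\<And>h u v u' v'. orthogonal_transformation h \<Longrightarrow>
      (\<Sum>f\<in>F. (h u \<bullet> (A f *v h v)) * (h u' \<bullet> (A f *v h v'))) = (\<Sum>f\<in>F. (u \<bullet> (A f *v v)) * (u' \<bullet> (A f *v v')))"
  obtains B C where "\<And>i j k l. (\<Sum>f\<in>F. A f $ i $ j * A f $ k $ l)
    = (if i = j \<and> k = l then B else 0) + (if i = k \<and> j = l then C else 0) + (if i = l \<and> j = k then C else 0)"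
proof -
  define T where "T = (\<lambda>u v u' v'. \<Sum>f\<in>F. (u \<bullet> (A f *v v)) * (u' \<bullet> (A f *v v')))"
  define e where "e = (\<lambda>i::'n. axis i (1::real))"
  define M where "M = (\<lambda>i j k l. \<Sum>f\<in>F. A f $ i $ j * A f $ k $ l)"
  have ee: "e i \<bullet> (X *v e j) = X $ i $ j" for i j and X :: "real^'n^'n"
    by (simp add: e_def inner_axis' matrix_vector_mult_basis column_def)
  have MT: "M i j k l = T (e i) (e j) (e k) (e l)" for i j k l
    by (simp add: M_def T_def ee)
  have symA: "A f $ i $ j = A f $ j $ i" if "f \<in> F" for f i j
  proof -
    have "A f $ i $ j = transpose (A f) $ j $ i" by (simp add: Finite_Cartesian_Product.transpose_def)
    then show ?thesis by (simp only: sym[OF that])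
  qed
  have sym1: "M i j k l = M j i k l" for i j k l
    unfolding M_def by (rule sum.cong[OF refl]) (metis symA)
  have sym2: "M i j k l = M i j l k" for i j k l
    unfolding M_def by (rule sum.cong[OF refl]) (metis symA)
  have sym3: "M i j k l = M k l i j" for i j k l
    unfolding M_def by (rule sum.cong[OF refl]) (rule mult.commute)
  have invT: "T (h u) (h v) (h u') (h v') = T u v u' v'" if "orthogonal_transformation h" for h u v u' v'
    unfolding T_def using inv[OF that] .
  have flip: "M i j k l = (if i = a then -1 else 1) * (if j = a then -1 else 1) * (if k = a then -1 else 1) * (if l = a then -1 else 1) * M i j k l" for i j k l a
  proof -
    let ?h = "\<lambda>x::real^'n. \<chi> k. if k = a then - x $ k else x $ k"
    define s where "s = (\<lambda>i. if i = a then -1 else (1::real))"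
    have he: "?h (e i) = s i *\<^sub>R e i" for i unfolding s_def by (auto simp: e_def Finite_Cartesian_Product.vec_eq_iff axis_def)
    have "M i j k l = T (?h (e i)) (?h (e j)) (?h (e k)) (?h (e l))"
      unfolding MT by (rule invT[OF orthogonal_transformation_flip, symmetric])
    also have "\<dots> = s i * s j * s k * s l * M i j k l"
      unfolding he MT T_def by (simp add: matrix_vector_mult_scaleR sum_distrib_left mult_ac)
    finally show ?thesis unfolding s_def .
  qed
  have swap: "M (Transposition.transpose a b i) (Transposition.transpose a b j) (Transposition.transpose a b k) (Transposition.transpose a b l) = M i j k l" for a b i j k l
  proof -
    let ?h = "\<lambda>x::real^'n. \<chi> k. x $ Transposition.transpose a b k"
    have he: "?h (e i) = e (Transposition.transpose a b i)" for i
      by (auto simp: e_def Finite_Cartesian_Product.vec_eq_iff axis_def Transposition.transpose_def)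
    show ?thesis unfolding MT he[symmetric] by (rule invT[OF orthogonal_transformation_transpose])
  qed
  have const1: "M i i k k = M i i k' k'" "M i k i k = M i k' i k'" if "k \<noteq> i" "k' \<noteq> i" for i k k'
    using swap[of k k' i i k k] swap[of k k' i k i k] that by auto
  \<comment> \<open>The 45 degree map turns the entry (i, k) of a symmetric matrix into half the
    difference of the diagonal entries at i and k. Squaring and summing over F gives the
    relation.\<close>
  have rot: "M i i i i + M k k k k - 2 * M i i k k = 4 * M i k i k" if "i \<noteq> k" for i k
  proof -
    let ?h = "\<lambda>x::real^'n. \<chi> m. if m = i then (x $ i + x $ k) / sqrt 2 else if m = k then (x $ i - x $ k) / sqrt 2 else x $ m"
    have hi: "?h (e i) = (1 / sqrt 2) *\<^sub>R (e i + e k)" and hk: "?h (e k) = (1 / sqrt 2) *\<^sub>R (e i - e k)"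
      using that by (auto simp: e_def Finite_Cartesian_Product.vec_eq_iff axis_def)
    have v: "((1 / sqrt 2) *\<^sub>R (e i + e k)) \<bullet> (A f *v ((1 / sqrt 2) *\<^sub>R (e i - e k))) = (A f $ i $ i - A f $ k $ k) / 2" if "f \<in> F" for f
    proof -
      have "(r *\<^sub>R (e i + e k)) \<bullet> (A f *v (r *\<^sub>R (e i - e k))) = (r * r) * (A f $ i $ i - A f $ k $ k)" for r
        using symA[OF that, of i k]
        by (simp add: matrix_vector_mult_scaleR matrix_vector_mult_diff_distrib inner_add_left inner_diff_right ee algebra_simps)
      from this[of "1 / sqrt 2"] show ?thesis by simp
    qed
    have "M i k i k = T (?h (e i)) (?h (e k)) (?h (e i)) (?h (e k))"
      unfolding MT by (rule invT[OF orthogonal_transformation_rot[OF that], symmetric])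
    also have "\<dots> = (\<Sum>f\<in>F. (A f $ i $ i * A f $ i $ i + A f $ k $ k * A f $ k $ k - 2 * (A f $ i $ i * A f $ k $ k)) / 4)"
      unfolding hi hk T_def
    proof (rule sum.cong[OF refl])
      fix f assume "f \<in> F"
      have "(a - b) / 2 * ((a - b) / 2) = (a * a + b * b - 2 * (a * b)) / 4" for a b :: real
        by (simp add: field_simps)
      then show "(1 / sqrt 2) *\<^sub>R (e i + e k) \<bullet> (A f *v (1 / sqrt 2) *\<^sub>R (e i - e k)) *
          ((1 / sqrt 2) *\<^sub>R (e i + e k) \<bullet> (A f *v (1 / sqrt 2) *\<^sub>R (e i - e k)))
        = (A f $ i $ i * A f $ i $ i + A f $ k $ k * A f $ k $ k - 2 * (A f $ i $ i * A f $ k $ k)) / 4"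
        unfolding v[OF \<open>f \<in> F\<close>] .
    qed
    also have "\<dots> = (M i i i i + M k k k k - 2 * M i i k k) / 4"
      by (simp add: M_def sum.distrib sum_subtractf sum_distrib_left sum_divide_distrib add_divide_distrib diff_divide_distrib)
    finally show ?thesis by simp
  qed
  obtain i0 k0 :: 'n where ik0: "i0 \<noteq> k0"
    using n by (metis card_2_iff' ex_card)
  define B where "B = M i0 i0 k0 k0"
  define C where "C = M i0 k0 i0 k0"
  have MB: "M i i k k = B" if "i \<noteq> k" for i k
    unfolding B_def
    by (rule symmetric_function_const[where P="\<lambda>i k. M i i k k", OF sym3 const1(1) that ik0])
  have MC: "M i k i k = C" if "i \<noteq> k" for i k
    unfolding C_def
  proof (rule symmetric_function_const[where P="\<lambda>i k. M i k i k", OF _ const1(2) that ik0])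
    show "M i k i k = M k i k i" for i k using sym1[of i k i k] sym2[of k i i k] by simp
  qed
  \<comment> \<open>Transpositions make \<open>M i i i i\<close> independent of i, so
    \<open>rot\<close> reads 2 * M i i i i - 2 * B = 4 * C.\<close>
  have MA: "M i i i i = B + 2 * C" for i
  proof -
    have eq: "M a a a a = M b b b b" for a b using swap[of a b a a a a] by simp
    obtain k where "k \<noteq> i" using ik0 by metis
    then show ?thesis using rot[of i k] MB[of i k] MC[of i k] eq[of i k] by simp
  qed
  have "M i j k l = (if i = j \<and> k = l then B else 0) + (if i = k \<and> j = l then C else 0) + (if i = l \<and> j = k then C else 0)" for i j k l
  proof -
    consider "i = j" "k = l" "i = k" | "i = j" "k = l" "i \<noteq> k" | "i \<noteq> j" "i = k" "j = l" | "i \<noteq> j" "i = l" "j = k"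
      | "\<not> (i = j \<and> k = l)" "\<not> (i = k \<and> j = l)" "\<not> (i = l \<and> j = k)" by blast
    then show ?thesis
    proof cases
      case 1 then show ?thesis using MA by auto
    next
      case 2 then show ?thesis using MB by auto
    next
      case 3 then show ?thesis using MC by auto
    next
      case 4 then show ?thesis using MC[of i j] sym2[of i j i j] by auto
    next
      case 5
      \<comment> \<open>When the four indices do not match in pairs, some index value occurs exactly
        once, and the sign change at that value negates the moment.\<close>
      have s1: "M i j k l = 0" if "j \<noteq> i" "k \<noteq> i" "l \<noteq> i" using flip[of i j k l i] that by simp
      have s2: "M i j k l = 0" if "i \<noteq> j" "k \<noteq> j" "l \<noteq> j" using flip[of i j k l j] that by simp
      have s3: "M i j k l = 0" if "i \<noteq> k" "j \<noteq> k" "l \<noteq> k" using flip[of i j k l k] that by simp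
      have s4: "M i j k l = 0" if "i \<noteq> l" "j \<noteq> l" "k \<noteq> l" using flip[of i j k l l] that by simp
      have M0: "M i j k l = 0"
      proof (cases "i = j")
        case True
        then have "k \<noteq> l" using 5 by simp
        then show ?thesis using s3 s4 True by (cases "k = i") simp_all
      next
        case False
        show ?thesis
        proof (cases "i = k \<or> i = l")
          case True
          have "k \<noteq> j" "l \<noteq> j" using True 5 False by auto
          then show ?thesis using s2 False by simp
        next
          case F: False
          show ?thesis by (rule s1) (use F False in auto)
        qed
      qed
      show ?thesis by (simp only: M0 5 if_False add_0_right)
    qed
  qed
  then show ?thesis using that[of B C] unfolding M_def by blast
qed

text \<open>A sign change kills the off-diagonal entries of the sum and a transposition identifies
  the diagonal ones.\<close>

lemma invariant_second_moments:
  fixes A :: "'a \<Rightarrow> real^'n^'n"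
  assumes inv: "\<And>h u v. orthogonal_transformation h \<Longrightarrow>
      (\<Sum>f\<in>F. h u \<bullet> (A f *v h v)) = (\<Sum>f\<in>F. u \<bullet> (A f *v v))"
  obtains c where "(\<Sum>f\<in>F. A f) = c *\<^sub>R mat 1"
proof -
  define S where "S = (\<Sum>f\<in>F. A f)"
  define e where "e = (\<lambda>i::'n. axis i (1::real))"
  have ee: "e i \<bullet> (X *v e j) = X $ i $ j" for i j and X :: "real^'n^'n"
    by (simp add: e_def inner_axis' matrix_vector_mult_basis column_def)
  have S: "S $ i $ j = (\<Sum>f\<in>F. e i \<bullet> (A f *v e j))" for i j
    by (simp add: S_def ee)
  have 0: "S $ i $ j = 0" if "i \<noteq> j" for i j
  proof -
    let ?h = "\<lambda>x::real^'n. \<chi> k. if k = i then - x $ k else x $ k"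
    have he: "?h (e i) = - e i" "?h (e j) = e j" using that by (auto simp: e_def Finite_Cartesian_Product.vec_eq_iff axis_def)
    have "(\<Sum>f\<in>F. ?h (e i) \<bullet> (A f *v ?h (e j))) = S $ i $ j"
      unfolding S by (rule inv[OF orthogonal_transformation_flip])
    then show ?thesis unfolding he S by (simp add: sum_negf)
  qed
  have c: "S $ i $ i = S $ j $ j" for i j
  proof -
    let ?h = "\<lambda>x::real^'n. \<chi> k. x $ Transposition.transpose i j k"
    have he: "?h (e i) = e j"
      by (auto simp: e_def Finite_Cartesian_Product.vec_eq_iff axis_def Transposition.transpose_def)
    have "(\<Sum>f\<in>F. ?h (e i) \<bullet> (A f *v ?h (e i))) = S $ i $ i"
      unfolding S by (rule inv[OF orthogonal_transformation_transpose])
    then show ?thesis unfolding he S by simp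
  qed
  \<comment> \<open>Any index would do, as the diagonal entries agree.\<close>
  have "S = (S $ undefined $ undefined) *\<^sub>R mat 1"
    using 0 c by (auto simp: Finite_Cartesian_Product.vec_eq_iff Finite_Cartesian_Product.mat_def)
  then show ?thesis using that unfolding S_def by blast
qed

section \<open>Projections attached to flags\<close>

lemma is_flag_dim_le:
  assumes "is_flag d Delta" "r < length d"
  shows "d ! r \<le> hd d"
proof -
  have "d ! r \<le> d ! 0" using assms(2)
  proof (induction r)
    case (Suc r)
    then have "Delta ! Suc r \<subseteq> Delta ! r" "dim (Delta ! Suc r) = d ! Suc r" "dim (Delta ! r) = d ! r"
      using assms(1) by (auto simp: is_flag_def)
    then have "d ! Suc r \<le> d ! r" using dim_subset by metis
    then show ?case using Suc by simp
  qed simp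
  then show ?thesis using assms(2) by (cases d) auto
qed

text \<open>The head of the list is the largest space. A sequence adapted to the remaining flag is
  extended to it and, surviving as a prefix, stays adapted to the smaller spaces.\<close>

lemma flag_orthonormal_seq:
  assumes "is_flag d Delta" "d \<noteq> []"
  shows "\<exists>u. orthonormal_seq (hd d) u \<and> (\<forall>r<length d. span (u ` {..<d ! r}) = Delta ! r)"
  using assms
proof (induction d arbitrary: Delta)
  case Nil
  then show ?case by simp
next
  case (Cons x d')
  obtain V Delta' where D: "Delta = V # Delta'"
    using Cons.prems(1) by (cases Delta) (auto simp: is_flag_def)
  have nth: "subspace ((V # Delta') ! r)" "dim ((V # Delta') ! r) = (x # d') ! r" if "r < Suc (length d')" for r
    using Cons.prems(1) that unfolding D is_flag_def by auto
  have nest: "(V # Delta') ! Suc r \<subseteq> (V # Delta') ! r" if "Suc r < Suc (length d')" for r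
    using Cons.prems(1) that unfolding D is_flag_def by auto
  have V: "subspace V" "dim V = x" using nth[of 0] by auto
  have F: "is_flag d' Delta'"
    unfolding is_flag_def
  proof (intro conjI allI impI)
    show "length Delta' = length d'" using Cons.prems(1) by (auto simp: D is_flag_def)
    show "subspace (Delta' ! r)" "dim (Delta' ! r) = d' ! r" if "r < length d'" for r
      using nth[of "Suc r"] that by auto
    show "Delta' ! Suc r \<subseteq> Delta' ! r" if "Suc r < length d'" for r
      using nest[of "Suc r"] that by auto
  qed
  show ?case
  proof (cases "d' = []")
    case True
    obtain u where "orthonormal_seq (dim V) u" "span (u ` {..<dim V}) = V"
      using orthonormal_seq_exists[OF V(1)] .
    then show ?thesis using V(2) by (auto simp: True D)
  next
    case False
    obtain w where w: "orthonormal_seq (hd d') w" "\<And>r. r < length d' \<Longrightarrow> span (w ` {..<d' ! r}) = Delta' ! r"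
      using Cons.IH[OF F False] by blast
    define W where "W = Delta' ! 0"
    have W: "subspace W" "dim W = hd d'" "W \<subseteq> V"
      using nth[of 1] nest[of 0] False by (auto simp: W_def hd_conv_nth)
    have wW: "span (w ` {..<dim W}) = W" using w(2)[of 0] False W(2) by (simp add: W_def hd_conv_nth)
    have wo: "orthonormal_seq (dim W) w" using w(1) W(2) by simp
    obtain u where u: "\<And>a. a < dim W \<Longrightarrow> u a = w a" "orthonormal_seq (dim V) u" "span (u ` {..<dim V}) = V"
      using orthonormal_seq_extend[OF W(1) V(1) W(3) wo wW] by blast
    have "span (u ` {..<(x # d') ! r}) = (V # Delta') ! r" if r: "r < length (x # d')" for r
    proof (cases r)
      case 0 then show ?thesis using u(3) V(2) by simp
    next
      case (Suc r')
      then have "d' ! r' \<le> dim W" using is_flag_dim_le[OF F, of r'] r W(2) by simp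
      then have "u ` {..<d' ! r'} = w ` {..<d' ! r'}" using u(1) by (intro image_cong) auto
      then show ?thesis using w(2)[of r'] r Suc by simp
    qed
    then show ?thesis using u(2) V(2) by (auto simp: D)
  qed
qed

lemma rep_orthonormal_seq:
  fixes Delta :: "(real^'n) set list"
  assumes "is_flag d Delta" "d \<noteq> []"
  shows "orthonormal_seq (hd d) (col (rep d Delta))"
    and "r < length d \<Longrightarrow> span (col (rep d Delta) ` {..<d ! r}) = Delta ! r"
proof -
  obtain u where u: "orthonormal_seq (hd d) u" "\<And>r. r < length d \<Longrightarrow> span (u ` {..<d ! r}) = Delta ! r"
    using flag_orthonormal_seq[OF assms] by blast
  have set: "{f j | j. j < k} = f ` {..<k}" for f :: "nat \<Rightarrow> real^'n" and k by auto
  have inner: "(\<Sum>i\<in>UNIV. X i a * X i b) = col X a \<bullet> col X b" for X :: "'n \<Rightarrow> nat \<Rightarrow> real" and a b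
    by (simp add: inner_vec_def Defs.col_def)
  have alt: "represents d Delta X \<longleftrightarrow> orthonormal_seq (hd d) (col X) \<and> (\<forall>r<length d. span (col X ` {..<d ! r}) = Delta ! r)" for X
    unfolding represents_def orthonormal_seq_def inner set ..
  have "col (\<lambda>i j. u j $ i) = u" by (simp add: Defs.col_def fun_eq_iff Finite_Cartesian_Product.vec_eq_iff)
  then have "represents d Delta (\<lambda>i j. u j $ i)" using u by (simp add: alt)
  then have "represents d Delta (rep d Delta)" unfolding rep_def using someI[of "represents d Delta"] by blast
  then show "orthonormal_seq (hd d) (col (rep d Delta))"
    and "r < length d \<Longrightarrow> span (col (rep d Delta) ` {..<d ! r}) = Delta ! r"
    unfolding alt by auto
qed

lemma orth_proj_orthonormal_seq:
  fixes V :: "(real^'n) set"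
  assumes "orthonormal_seq k u" "span (u ` {..<k}) = V"
  shows "orth_proj V x = (\<Sum>j<k. (u j \<bullet> x) *\<^sub>R u j)"
  unfolding orth_proj_def
proof (rule the_equality)
  let ?y = "\<Sum>j<k. (u j \<bullet> x) *\<^sub>R u j"
  have uV: "u j \<in> V" if "j < k" for j
    unfolding assms(2)[symmetric] using that by (intro span_base) auto
  have V: "subspace V" unfolding assms(2)[symmetric] by simp
  have yV: "?y \<in> V" using V uV by (intro subspace_sum subspace_scale) auto
  have orth: "(x - ?y) \<bullet> z = 0" if "z \<in> V" for z
  proof -
    have z: "z = (\<Sum>j<k. (u j \<bullet> z) *\<^sub>R u j)"
      using that assms by (intro orthonormal_seq_expand) auto
    have "(x - ?y) \<bullet> u j = 0" if "j < k" for j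
      using orthonormal_seq_inner_sum[OF assms(1) that, of "\<lambda>j. u j \<bullet> x"]
      by (subst inner_commute) (simp add: inner_diff_right)
    then show ?thesis by (subst z) (simp add: inner_sum_right)
  qed
  show "?y \<in> V \<and> (\<forall>z\<in>V. (x - ?y) \<bullet> z = 0)" using yV orth by blast
  fix y assume y: "y \<in> V \<and> (\<forall>z\<in>V. (x - y) \<bullet> z = 0)"
  \<comment> \<open>Uniqueness: the difference of two candidates lies in V and is orthogonal to V,
    hence to itself.\<close>
  have "y - ?y \<in> V" using V y yV by (intro subspace_diff) auto
  then have "(x - ?y) \<bullet> (y - ?y) - (x - y) \<bullet> (y - ?y) = 0" using orth y by simp
  then have "(y - ?y) \<bullet> (y - ?y) = 0" by (simp only: inner_diff_left[symmetric]) simp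
  then show "y = ?y" by simp
qed

lemma matrix_vector_mult_sum: "(\<Sum>i\<in>I. A i) *v v = (\<Sum>i\<in>I. A i *v (v :: real^'n))"
  by (induction I rule: infinite_finite_induct) (simp_all add: matrix_vector_mult_add_rdistrib)

lemma inner_Pi_flag:
  fixes w :: "nat \<Rightarrow> real^'n"
  assumes "length Ls = length lam"
    and w: "\<And>i. i < length lam \<Longrightarrow> orthonormal_seq (lam ! i) w \<and> span (w ` {..<lam ! i}) = span (Ls ! i)"
  shows "u \<bullet> (Pi_flag Ls *v v) = (\<Sum>i<length lam. \<Sum>j<lam ! i. (u \<bullet> w j) * (v \<bullet> w j))"
proof -
  have "matrix (orth_proj (span (Ls ! i))) *v v = (\<Sum>j<lam ! i. (w j \<bullet> v) *\<^sub>R w j)" if "i < length lam" for i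
  proof -
    have eq: "orth_proj (span (Ls ! i)) = (\<lambda>x. \<Sum>j<lam ! i. (w j \<bullet> x) *\<^sub>R w j)"
      using orth_proj_orthonormal_seq w[OF that] by blast
    have "linear (\<lambda>x. \<Sum>j<lam ! i. (w j \<bullet> x) *\<^sub>R w j)"
      by (intro linear_compose_sum ballI linearI) (simp_all add: inner_add_right scaleR_add_left)
    then show ?thesis unfolding eq by (simp add: matrix_works)
  qed
  then have "Pi_flag Ls *v v = (\<Sum>i<length lam. \<Sum>j<lam ! i. (w j \<bullet> v) *\<^sub>R w j)"
    by (simp add: Pi_flag_def matrix_vector_mult_sum assms(1))
  then show ?thesis by (simp add: inner_sum_right inner_commute mult.commute)
qed

lemma inner_axis_matrix: "axis i 1 \<bullet> (X *v axis j 1) = X $ i $ j" for X :: "real^'n^'n"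
  by (simp add: inner_axis' matrix_vector_mult_basis column_def)

text \<open>Contracting the isotropic tensor twice with H: the B term gives the squared trace, and
  the two C terms coincide for symmetric H, each giving the squared norm.\<close>

lemma symmetric_quadratic_sum:
  fixes A :: "'a \<Rightarrow> real^'n^'n"
  assumes M: "\<And>i j k l. (\<Sum>f\<in>F. A f $ i $ j * A f $ k $ l)
    = (if i = j \<and> k = l then B else 0) + (if i = k \<and> j = l then C else 0) + (if i = l \<and> j = k then C else 0)"
    and H: "transpose H = H"
  shows "(\<Sum>f\<in>F. (A f \<bullet> H)\<^sup>2) = B * (mat 1 \<bullet> H)\<^sup>2 + 2 * C * (H \<bullet> H)"
proof -
  have Hs: "H $ i $ j = H $ j $ i" for i j
  proof -
    have "H $ i $ j = transpose H $ j $ i" by (simp add: Finite_Cartesian_Product.transpose_def)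
    then show ?thesis by (simp only: H)
  qed
  have inn: "X \<bullet> Y = (\<Sum>i\<in>UNIV. \<Sum>j\<in>UNIV. X $ i $ j * Y $ i $ j)" for X Y :: "real^'n^'n"
    by (simp add: inner_vec_def)
  have tr: "mat 1 \<bullet> H = (\<Sum>i\<in>UNIV. H $ i $ i)"
    unfolding inn by (simp add: Finite_Cartesian_Product.mat_def if_distrib[of "\<lambda>x. x * _"] cong: if_cong)
  have "(\<Sum>f\<in>F. (A f \<bullet> H)\<^sup>2)
      = (\<Sum>f\<in>F. \<Sum>i\<in>UNIV. \<Sum>j\<in>UNIV. \<Sum>k\<in>UNIV. \<Sum>l\<in>UNIV. (A f $ i $ j * A f $ k $ l) * (H $ i $ j * H $ k $ l))"
    unfolding inn power2_eq_square sum_product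
    by (rule sum.cong[OF refl], rule sum.cong[OF refl], rule trans[OF sum.swap]) (intro sum.cong refl, simp add: mult_ac)
  also have "\<dots> = (\<Sum>i\<in>UNIV. \<Sum>j\<in>UNIV. \<Sum>k\<in>UNIV. \<Sum>l\<in>UNIV. (\<Sum>f\<in>F. A f $ i $ j * A f $ k $ l) * (H $ i $ j * H $ k $ l))"
    unfolding sum_distrib_right
    by (rule trans[OF sum.swap], rule sum.cong[OF refl], rule trans[OF sum.swap], rule sum.cong[OF refl],
        rule trans[OF sum.swap], rule sum.cong[OF refl], rule sum.swap)
  also have "\<dots> = (\<Sum>i\<in>UNIV. \<Sum>j\<in>UNIV. \<Sum>k\<in>UNIV. \<Sum>l\<in>UNIV.
        (if l = k then if j = i then B * (H $ i $ i * H $ k $ k) else 0 else 0)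
      + (if l = j then if k = i then C * (H $ i $ j * H $ i $ j) else 0 else 0)
      + (if l = i then if k = j then C * (H $ i $ j * H $ i $ j) else 0 else 0))"
    unfolding M by (intro sum.cong refl) (auto simp: Hs algebra_simps)
  also have "\<dots> = (\<Sum>i\<in>UNIV. \<Sum>j\<in>UNIV. (if j = i then \<Sum>k\<in>UNIV. B * (H $ i $ i * H $ k $ k) else 0)
      + C * (H $ i $ j * H $ i $ j) + C * (H $ i $ j * H $ i $ j))"
    by (intro sum.cong refl) (simp add: sum.distrib)
  also have "\<dots> = (\<Sum>i\<in>UNIV. \<Sum>k\<in>UNIV. B * (H $ i $ i * H $ k $ k)) + 2 * C * (H \<bullet> H)"
    by (simp add: sum.distrib inn sum_distrib_left mult.assoc)
  also have "(\<Sum>i\<in>UNIV. \<Sum>k\<in>UNIV. B * (H $ i $ i * H $ k $ k)) = B * (mat 1 \<bullet> H)\<^sup>2"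
    unfolding tr power2_eq_square sum_product by (simp add: sum_distrib_left)
  finally show ?thesis .
qed

section \<open>From minimal flags of lattices to flags of subspaces\<close>

lemma min_flag_chain: "Ls \<in> min_flags L lam \<Longrightarrow> lat_chain L lam Ls"
  by (simp add: min_flags_def)

text \<open>Duplicates are removed separately from \<open>lam\<close> and from the list of spans, so
  nothing aligns the positions beforehand. Dimensions do: the r-th space has dimension
  \<open>remdups lam ! r\<close>, and the span of \<open>Ls ! i\<close> has dimension
  \<open>lam ! i\<close>.\<close>

lemma chain_flag_index:
  assumes c: "lat_chain L lam Ls" and F: "is_flag (remdups lam) (remdups (map span Ls))" and i: "i < length lam"
  obtains r where "r < length (remdups lam)" "remdups (map span Ls) ! r = span (Ls ! i)" "remdups lam ! r = lam ! i"
proof -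
  have "span (Ls ! i) \<in> set (remdups (map span Ls))"
    using c i by (auto simp: lat_chain_def)
  then obtain r where r: "r < length (remdups (map span Ls))" "remdups (map span Ls) ! r = span (Ls ! i)"
    by (metis in_set_conv_nth)
  then have r': "r < length (remdups lam)" using F by (simp add: is_flag_def)
  then have "dim (span (Ls ! i)) = remdups lam ! r" using F r(2) by (metis is_flag_def)
  moreover have "dim (span (Ls ! i)) = lam ! i" using lat_chainD(2)[OF c i] lattice_dim by blast
  ultimately show ?thesis using that r r' by simp
qed

lemma chain_flag_seq:
  fixes Ls :: "(real^'n) set list"
  assumes c: "lat_chain L lam Ls" and F: "is_flag (remdups lam) (remdups (map span Ls))" and i: "i < length lam"
  shows "orthonormal_seq (lam ! i) (col (rep (remdups lam) (remdups (map span Ls))))"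
    and "span (col (rep (remdups lam) (remdups (map span Ls))) ` {..<lam ! i}) = span (Ls ! i)"
proof -
  obtain r where r: "r < length (remdups lam)" "remdups (map span Ls) ! r = span (Ls ! i)" "remdups lam ! r = lam ! i"
    using chain_flag_index[OF assms] .
  have ne: "remdups lam \<noteq> []" using i by auto
  note o = rep_orthonormal_seq[OF F ne]
  show "span (col (rep (remdups lam) (remdups (map span Ls))) ` {..<lam ! i}) = span (Ls ! i)"
    using o(2)[OF r(1)] r by simp
  have "lam ! i \<le> hd (remdups lam)" using is_flag_dim_le[OF F r(1)] r(3) by simp
  then show "orthonormal_seq (lam ! i) (col (rep (remdups lam) (remdups (map span Ls))))"
    using o(1) unfolding orthonormal_seq_def by auto
qed

lemma flag_form_rep:
  fixes Ls :: "(real^'n) set list"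
  assumes c: "lat_chain L lam Ls" and F: "is_flag (remdups lam) (remdups (map span Ls))"
  shows "flag_form lam u v (rep (remdups lam) (remdups (map span Ls))) = u \<bullet> (Pi_flag Ls *v v)"
  unfolding flag_form_def using c chain_flag_seq[OF assms]
  by (intro inner_Pi_flag[symmetric]) (auto simp: lat_chain_def)

text \<open>The flag yields the span of each member as its space of dimension
  \<open>lam ! i\<close>, and saturation yields the member from its span. Sums over the design can
  then be reindexed by minimal flags, and finiteness passes to \<open>min_flags\<close>.\<close>

lemma inj_on_min_flags_span:
  fixes L :: "(real^'n) set"
  assumes L: "is_lattice_basis L CARD('n) b"
    and F: "\<And>Ls. Ls \<in> min_flags L lam \<Longrightarrow> is_flag (remdups lam) (remdups (map span Ls))"
  shows "inj_on (\<lambda>Ls. remdups (map span Ls)) (min_flags L lam)"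
proof (rule inj_onI)
  fix Ls Ls' assume m: "Ls \<in> min_flags L lam" "Ls' \<in> min_flags L lam" and eq: "remdups (map span Ls) = remdups (map span Ls')"
  have len: "length Ls = length lam" "length Ls' = length lam" using m by (auto simp: min_flags_def lat_chain_def)
  show "Ls = Ls'"
  proof (rule nth_equalityI)
    fix i assume "i < length Ls"
    then have i: "i < length lam" using len by simp
    obtain r where r: "r < length (remdups lam)" "remdups (map span Ls) ! r = span (Ls ! i)" "remdups lam ! r = lam ! i"
      using chain_flag_index[OF min_flag_chain[OF m(1)] F[OF m(1)] i] .
    obtain r' where r': "r' < length (remdups lam)" "remdups (map span Ls') ! r' = span (Ls' ! i)" "remdups lam ! r' = lam ! i"
      using chain_flag_index[OF min_flag_chain[OF m(2)] F[OF m(2)] i] .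
    have "r = r'" using r r' by (metis distinct_remdups nth_eq_iff_index_eq)
    then have "span (Ls ! i) = span (Ls' ! i)" using r r' eq by simp
    then show "Ls ! i = Ls' ! i" using min_flag_saturated[OF L m(1) i] min_flag_saturated[OF L m(2) i] by simp
  qed (simp add: len)
qed

lemma Pi_flag_symmetric_psd:
  fixes Ls :: "(real^'n) set list"
  assumes c: "lat_chain L lam Ls" and F: "is_flag (remdups lam) (remdups (map span Ls))"
  shows "transpose (Pi_flag Ls) = Pi_flag Ls" and "u \<bullet> (Pi_flag Ls *v u) \<ge> 0"
proof -
  have "Pi_flag Ls $ i $ j = Pi_flag Ls $ j $ i" for i j
    by (simp only: inner_axis_matrix[symmetric] flag_form_rep[OF assms, symmetric] flag_form_def mult.commute)
  then show "transpose (Pi_flag Ls) = Pi_flag Ls"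
    by (simp add: Finite_Cartesian_Product.transpose_def Finite_Cartesian_Product.vec_eq_iff)
  show "u \<bullet> (Pi_flag Ls *v u) \<ge> 0"
    unfolding flag_form_rep[OF assms, symmetric] flag_form_def by (intro sum_nonneg) auto
qed

text \<open>The form is positive at a unit vector lying in every member and vanishes at a vector
  orthogonal to the largest one, which exists since \<open>lam ! 0\<close> is smaller than
  n.\<close>

lemma Pi_flag_not_scalar:
  fixes Ls :: "(real^'n) set list"
  assumes ok: "conj_partition_ok lam CARD('n)" and c: "lat_chain L lam Ls"
    and F: "is_flag (remdups lam) (remdups (map span Ls))"
  shows "\<exists>u. u \<bullet> (Pi_flag Ls *v u) > 0" and "Pi_flag Ls \<noteq> s *\<^sub>R mat 1"
proof -
  define w where "w = col (rep (remdups lam) (remdups (map span Ls)))"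
  note ws = chain_flag_seq[OF c F, folded w_def]
  have form: "u \<bullet> (Pi_flag Ls *v u) = (\<Sum>i<length lam. \<Sum>j<lam ! i. (u \<bullet> w j) * (u \<bullet> w j))" for u
    unfolding flag_form_rep[OF c F, symmetric] flag_form_def w_def ..
  have l0: "0 < length lam" and lam: "\<And>i. i < length lam \<Longrightarrow> 0 < lam ! i \<and> lam ! i < CARD('n)"
    using ok by (auto simp: conj_partition_ok_def)
  have le: "lam ! i \<le> lam ! 0" if "i < length lam" for i
    using ok that unfolding conj_partition_ok_def by (cases "i = 0") (auto dest: sorted_wrt_nth_less)
  have "w 0 \<bullet> w 0 = 1" using orthonormal_seqD[OF ws(1)[OF l0], of 0 0] lam[OF l0] by simp
  then have "0 < (w 0 \<bullet> w 0) * (w 0 \<bullet> w 0)" by simp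
  also have "\<dots> \<le> (\<Sum>j<lam ! 0. (w 0 \<bullet> w j) * (w 0 \<bullet> w j))"
    using lam[OF l0] by (intro member_le_sum) auto
  also have "\<dots> \<le> w 0 \<bullet> (Pi_flag Ls *v w 0)"
    unfolding form using l0
    by (intro member_le_sum[where f="\<lambda>i. \<Sum>j<lam ! i. (w 0 \<bullet> w j) * (w 0 \<bullet> w j)"] sum_nonneg) auto
  finally have pos: "0 < w 0 \<bullet> (Pi_flag Ls *v w 0)" .
  then show "\<exists>u. u \<bullet> (Pi_flag Ls *v u) > 0" by blast
  have "dim (span (w ` {..<lam ! 0})) < DIM(real^'n)"
    using seq_indep_dim[OF orthonormal_seq_indep[OF ws(1)[OF l0]]] lam[OF l0] by simp
  then obtain x where x: "x \<noteq> 0" "\<And>y. y \<in> span (w ` {..<lam ! 0}) \<Longrightarrow> Linear_Algebra.orthogonal x y"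
    using orthogonal_to_subspace_exists by (metis dim_span)
  have xw: "x \<bullet> w j = 0" if "j < lam ! 0" for j
    using x(2)[of "w j"] that by (auto simp: Linear_Algebra.orthogonal_def intro: span_base)
  have "x \<bullet> (Pi_flag Ls *v x) = 0"
    unfolding form using xw le by (intro sum.neutral ballI) (auto dest: less_le_trans)
  then show "Pi_flag Ls \<noteq> s *\<^sub>R mat 1"
    using pos x(1) by (auto simp: scaleR_matrix_vector_assoc[symmetric])
qed

text \<open>All that extremality, perfection and eutaxy use of the design: a scalar first moment and
  a second moment that is definite on traceless symmetric matrices.\<close>

lemma strongly_perfect_moments:
  fixes L :: "(real^'n) set"
  assumes ok: "conj_partition_ok lam CARD('n)" and L: "full_rank_lattice L" and sp: "strongly_perfect_lam L lam"
  obtains B C c where "finite (min_flags L lam)" "min_flags L lam \<noteq> {}"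
    "\<And>Ls. Ls \<in> min_flags L lam \<Longrightarrow> is_flag (remdups lam) (remdups (map span Ls))"
    "c > 0" "(\<Sum>Ls\<in>min_flags L lam. Pi_flag Ls) = c *\<^sub>R mat 1"
    "C > 0" "\<And>H. transpose H = H \<Longrightarrow>
       (\<Sum>Ls\<in>min_flags L lam. (Pi_flag Ls \<bullet> H)\<^sup>2) = B * (mat 1 \<bullet> H)\<^sup>2 + 2 * C * (H \<bullet> H)"
proof -
  let ?M = "min_flags L lam" and ?d = "remdups lam" and ?s = "\<lambda>Ls. remdups (map span Ls)"
  have des: "vexillar_design 4 ?d (?s ` ?M)" using sp by (simp add: strongly_perfect_lam_def)
  have F: "is_flag ?d (?s Ls)" if "Ls \<in> ?M" for Ls
    using des that by (auto simp: vexillar_design_def)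
  obtain b where b: "is_lattice_basis L CARD('n) b" using L by (auto simp: full_rank_lattice_def)
  have inj: "inj_on ?s ?M" using inj_on_min_flags_span[OF b] F by blast
  have fin: "finite ?M" and ne: "?M \<noteq> {}"
    using des finite_image_iff[OF inj] by (auto simp: vexillar_design_def)
  obtain Ls0 where Ls0: "Ls0 \<in> ?M" using ne by blast
  have hd: "x \<le> hd ?d" if "x \<in> set lam" for x
    using is_flag_dim_le[OF F[OF Ls0]] that by (metis in_set_conv_nth set_remdups)
  have form: "flag_form lam u v (rep ?d (?s Ls)) = u \<bullet> (Pi_flag Ls *v v)" if "Ls \<in> ?M" for Ls u v
    by (rule flag_form_rep[OF min_flag_chain[OF that] F[OF that]])
  have orth: "\<exists>m. orthogonal_matrix m \<and> (\<forall>x. h x = m *v x)" if "orthogonal_transformation h" for h :: "real^'n \<Rightarrow> real^'n"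
    using that by (intro exI[of _ "matrix h"]) (auto simp: orthogonal_transformation_matrix matrix_works)
  have inv2: "(\<Sum>Ls\<in>?M. (h u \<bullet> (Pi_flag Ls *v h v)) * (h u' \<bullet> (Pi_flag Ls *v h v')))
      = (\<Sum>Ls\<in>?M. (u \<bullet> (Pi_flag Ls *v v)) * (u' \<bullet> (Pi_flag Ls *v v')))"
    and inv1: "(\<Sum>Ls\<in>?M. h u \<bullet> (Pi_flag Ls *v h v)) = (\<Sum>Ls\<in>?M. u \<bullet> (Pi_flag Ls *v v))"
    if h: "orthogonal_transformation h" for h :: "real^'n \<Rightarrow> real^'n" and u v u' v'
  proof -
    obtain m where m: "orthogonal_matrix m" "\<And>x. h x = m *v x" using orth[OF h] by blast
    note I = design_moment_invariant[OF des set_remdups[symmetric] hd m(1), folded m(2), unfolded sum.reindex[OF inj] comp_def]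
    show "(\<Sum>Ls\<in>?M. (h u \<bullet> (Pi_flag Ls *v h v)) * (h u' \<bullet> (Pi_flag Ls *v h v')))
      = (\<Sum>Ls\<in>?M. (u \<bullet> (Pi_flag Ls *v v)) * (u' \<bullet> (Pi_flag Ls *v v')))"
      using I(1)[where u=u and v=v and u'=u' and v'=v'] by (simp add: form cong: sum.cong)
    show "(\<Sum>Ls\<in>?M. h u \<bullet> (Pi_flag Ls *v h v)) = (\<Sum>Ls\<in>?M. u \<bullet> (Pi_flag Ls *v v))"
      using I(2)[where u=u and v=v] by (simp add: form cong: sum.cong)
  qed
  obtain c where c: "(\<Sum>Ls\<in>?M. Pi_flag Ls) = c *\<^sub>R mat 1"
    using invariant_second_moments[where F="?M" and A=Pi_flag] inv1 by blast
  have sym: "transpose (Pi_flag Ls) = Pi_flag Ls" and psd: "u \<bullet> (Pi_flag Ls *v u) \<ge> 0"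
    if "Ls \<in> ?M" for Ls u
    using Pi_flag_symmetric_psd[OF min_flag_chain[OF that] F[OF that]] by auto
  note ns = Pi_flag_not_scalar[OF ok min_flag_chain[OF Ls0] F[OF Ls0]]
  have "c > 0"
  proof -
    obtain u where u: "u \<bullet> (Pi_flag Ls0 *v u) > 0" using ns(1) by blast
    have "0 < (\<Sum>Ls\<in>?M. u \<bullet> (Pi_flag Ls *v u))"
      using u psd Ls0 fin by (intro sum_pos2[of _ Ls0]) auto
    also have "\<dots> = c * (u \<bullet> u)"
      using arg_cong[OF c, of "\<lambda>A. u \<bullet> (A *v u)"]
      by (simp add: matrix_vector_mult_sum inner_sum_right scaleR_matrix_vector_assoc[symmetric])
    finally have pos: "0 < c * (u \<bullet> u)" .
    show ?thesis
    proof (rule ccontr)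
      assume "\<not> c > 0"
      then have "c * (u \<bullet> u) \<le> 0" by (intro mult_nonpos_nonneg) auto
      then show False using pos by simp
    qed
  qed
  have n: "CARD('n) \<ge> 2"
  proof -
    have "lam \<noteq> []" "\<forall>x\<in>set lam. 0 < x \<and> x < CARD('n)" using ok by (auto simp: conj_partition_ok_def)
    then have "0 < hd lam \<and> hd lam < CARD('n)" by simp
    then show ?thesis by linarith
  qed
  obtain B C where BC: "\<And>i j k l. (\<Sum>Ls\<in>?M. Pi_flag Ls $ i $ j * Pi_flag Ls $ k $ l)
    = (if i = j \<and> k = l then B else 0) + (if i = k \<and> j = l then C else 0) + (if i = l \<and> j = k then C else 0)"
    using invariant_fourth_moments[where F="?M" and A=Pi_flag] sym n inv2 by blast
  \<comment> \<open>C is the sum of squares of an off-diagonal entry over the minimal flags, and 4 C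
    = 2 (B + 2 C) - 2 B is that of a difference of two diagonal entries. If C were not positive, all
    of these would vanish.\<close>
  have "C > 0"
  proof (rule ccontr)
    assume neg: "\<not> C > 0"
    have off: "Pi_flag Ls0 $ i $ k = 0" if "i \<noteq> k" for i k
    proof -
      have s: "(\<Sum>Ls\<in>?M. Pi_flag Ls $ i $ k * Pi_flag Ls $ i $ k) = C" using BC[of i k i k] that by simp
      have "Pi_flag Ls0 $ i $ k * Pi_flag Ls0 $ i $ k \<le> C"
        unfolding s[symmetric] using Ls0 fin
        by (intro member_le_sum[where f="\<lambda>Ls. Pi_flag Ls $ i $ k * Pi_flag Ls $ i $ k"]) auto
      then have "Pi_flag Ls0 $ i $ k * Pi_flag Ls0 $ i $ k \<le> 0" using neg by linarith
      then show ?thesis by (auto simp: mult_le_0_iff)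
    qed
    have dia: "Pi_flag Ls0 $ i $ i = Pi_flag Ls0 $ k $ k" for i k
    proof (cases "i = k")
      case False
      let ?x = "\<lambda>Ls. Pi_flag Ls $ i $ i - Pi_flag Ls $ k $ k"
      have "(\<Sum>Ls\<in>?M. ?x Ls * ?x Ls) = (\<Sum>Ls\<in>?M. Pi_flag Ls $ i $ i * Pi_flag Ls $ i $ i)
          + (\<Sum>Ls\<in>?M. Pi_flag Ls $ k $ k * Pi_flag Ls $ k $ k) - 2 * (\<Sum>Ls\<in>?M. Pi_flag Ls $ i $ i * Pi_flag Ls $ k $ k)"
        by (simp add: sum.distrib[symmetric] sum_subtractf[symmetric] sum_distrib_left algebra_simps)
      also have "\<dots> = 4 * C" unfolding BC using False by simp
      finally have s: "(\<Sum>Ls\<in>?M. ?x Ls * ?x Ls) = 4 * C" .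
      have "?x Ls0 * ?x Ls0 \<le> 4 * C"
        unfolding s[symmetric] using Ls0 fin by (intro member_le_sum[where f="\<lambda>Ls. ?x Ls * ?x Ls"]) auto
      then have "?x Ls0 * ?x Ls0 \<le> 0" using neg by linarith
      then show ?thesis by (auto simp: mult_le_0_iff)
    qed simp
    have "Pi_flag Ls0 = (Pi_flag Ls0 $ undefined $ undefined) *\<^sub>R mat 1"
      using off dia by (auto simp: Finite_Cartesian_Product.vec_eq_iff Finite_Cartesian_Product.mat_def)
    then show False using ns(2) by blast
  qed
  then show ?thesis
    using that[OF fin ne F \<open>c > 0\<close> c _ symmetric_quadratic_sum[OF BC]] by blast
qed

section \<open>Second-order expansion of the flag ratio\<close>

lemma prod_one_plus_expansion:
  "\<exists>K\<ge>0. \<forall>(a::nat \<Rightarrow> real) h. 0 \<le> h \<longrightarrow> h \<le> 1 \<longrightarrow> (\<forall>i<k. \<bar>a i\<bar> \<le> h) \<longrightarrow>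
     \<bar>(\<Prod>i<k. 1 + a i) - 1 - (\<Sum>i<k. a i)\<bar> \<le> K * h\<^sup>2"
proof (induction k)
  case 0
  then show ?case by (intro exI[of _ 0]) auto
next
  case (Suc k)
  then obtain K where K: "K \<ge> 0" "\<And>(a::nat \<Rightarrow> real) h. 0 \<le> h \<Longrightarrow> h \<le> 1 \<Longrightarrow> (\<forall>i<k. \<bar>a i\<bar> \<le> h) \<Longrightarrow>
     \<bar>(\<Prod>i<k. 1 + a i) - 1 - (\<Sum>i<k. a i)\<bar> \<le> K * h\<^sup>2" by blast
  \<comment> \<open>The new error is (P - 1 - S) + a k * (P - 1). The first part costs K and the
    second K + k, because P - 1 is at most (K + k) h in absolute value.\<close>
  have "\<bar>(\<Prod>i<Suc k. 1 + a i) - 1 - (\<Sum>i<Suc k. a i)\<bar> \<le> (2 * K + real k) * h\<^sup>2"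
    if h: "0 \<le> h" "h \<le> 1" and a: "\<forall>i<Suc k. \<bar>a i\<bar> \<le> h" for a :: "nat \<Rightarrow> real" and h
  proof -
    define P where "P = (\<Prod>i<k. 1 + a i)"
    define S where "S = (\<Sum>i<k. a i)"
    have P: "\<bar>P - 1 - S\<bar> \<le> K * h\<^sup>2" unfolding P_def S_def using K(2)[OF h] a by simp
    have "\<bar>S\<bar> \<le> (\<Sum>i<k. \<bar>a i\<bar>)" unfolding S_def by (rule sum_abs)
    also have "\<dots> \<le> (\<Sum>i<k. h)" using a by (intro sum_mono) auto
    finally have S: "\<bar>S\<bar> \<le> real k * h" by simp
    have "h\<^sup>2 \<le> h" using h by (simp add: power2_eq_square mult_left_le)
    then have "K * h\<^sup>2 \<le> K * h" using K(1) by (rule mult_left_mono)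
    then have "\<bar>P - 1\<bar> \<le> (K + real k) * h" using P S by (simp add: distrib_right)
    then have "\<bar>a k\<bar> * \<bar>P - 1\<bar> \<le> h * ((K + real k) * h)" using a h by (intro mult_mono) auto
    then have "\<bar>a k * (P - 1)\<bar> \<le> (K + real k) * h\<^sup>2" by (simp add: abs_mult power2_eq_square mult_ac)
    moreover have "(\<Prod>i<Suc k. 1 + a i) - 1 - (\<Sum>i<Suc k. a i) = (P - 1 - S) + a k * (P - 1)"
      by (simp add: P_def S_def algebra_simps)
    ultimately show ?thesis using P by (simp add: distrib_right)
  qed
  then show ?case using K(1) by (intro exI[of _ "2 * K + real k"]) auto
qed

text \<open>A permutation moving i also moves \<open>p i\<close>, so at least two factors lack the
  diagonal 1 and are bounded by h; each of the others is at most 2.\<close>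

lemma prod_nonidentity_bound:
  fixes m :: "nat \<Rightarrow> nat \<Rightarrow> real"
  assumes p: "p permutes {..<k}" "p \<noteq> id" and h: "0 \<le> h" "h \<le> 1"
    and m: "\<And>i j. i < k \<Longrightarrow> j < k \<Longrightarrow> \<bar>m i j\<bar> \<le> h"
  shows "\<bar>\<Prod>i<k. (if i = p i then 1 else 0) + m i (p i)\<bar> \<le> 2 ^ k * h\<^sup>2"
proof -
  obtain i where i: "p i \<noteq> i" using p(2) by (auto simp: fun_eq_iff)
  have ik: "i < k" using p(1) i by (auto simp: permutes_def)
  have pk: "p j < k" if "j < k" for j using permutes_in_image[OF p(1), of j] that by simp
  have pp: "p (p i) \<noteq> p i" using i permutes_inj[OF p(1)] by (auto simp: inj_def)
  define f where "f = (\<lambda>i. \<bar>(if i = p i then 1 else 0) + m i (p i)\<bar>)"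
  have f2: "f j \<le> 2" if "j < k" for j using m[OF that pk[OF that]] h by (auto simp: f_def)
  have f0: "f j \<ge> 0" for j by (simp add: f_def)
  have fh: "f j \<le> h" if "j < k" "p j \<noteq> j" for j using m[OF that(1) pk[OF that(1)]] that by (auto simp: f_def)
  have "\<bar>\<Prod>i<k. (if i = p i then 1 else 0) + m i (p i)\<bar> = (\<Prod>j<k. f j)" by (simp add: f_def abs_prod)
  also have "\<dots> = f i * (f (p i) * (\<Prod>j\<in>{..<k} - {i} - {p i}. f j))"
    using ik pk[OF ik] i by (subst prod.remove[of _ i], simp, simp, subst prod.remove[of _ "p i"]) auto
  also have "\<dots> \<le> h * (h * 2 ^ k)"
  proof (intro mult_mono mult_nonneg_nonneg prod_nonneg)
    have "(\<Prod>j\<in>{..<k} - {i} - {p i}. f j) \<le> (\<Prod>j\<in>{..<k} - {i} - {p i}. 2)"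
      using f0 f2 by (intro prod_mono) auto
    also have "\<dots> = 2 ^ card ({..<k} - {i} - {p i})" by simp
    also have "\<dots> \<le> 2 ^ k"
      using card_mono[of "{..<k}" "{..<k} - {i} - {p i}"] by (intro power_increasing) auto
    finally show "(\<Prod>j\<in>{..<k} - {i} - {p i}. f j) \<le> 2 ^ k" .
  qed (use f0 fh ik pk i pp h in auto)
  finally show ?thesis by (simp add: power2_eq_square mult_ac)
qed

lemma pdet_near_identity:
  "\<exists>K\<ge>0. \<forall>(m::nat \<Rightarrow> nat \<Rightarrow> real) h. 0 \<le> h \<longrightarrow> h \<le> 1 \<longrightarrow> (\<forall>i<k. \<forall>j<k. \<bar>m i j\<bar> \<le> h) \<longrightarrow>
     \<bar>pdet k (\<lambda>i j. (if i = j then 1 else 0) + m i j) - 1 - (\<Sum>i<k. m i i)\<bar> \<le> K * h\<^sup>2"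
proof -
  obtain K where K: "K \<ge> 0" "\<And>(a::nat \<Rightarrow> real) h. 0 \<le> h \<Longrightarrow> h \<le> 1 \<Longrightarrow> (\<forall>i<k. \<bar>a i\<bar> \<le> h) \<Longrightarrow>
     \<bar>(\<Prod>i<k. 1 + a i) - 1 - (\<Sum>i<k. a i)\<bar> \<le> K * h\<^sup>2" using prod_one_plus_expansion[of k] by blast
  let ?P = "{p. p permutes {..<k}}"
  have fin: "finite ?P" by (rule finite_permutations) simp
  define N where "N = real (card (?P - {id}))"
  have "\<bar>pdet k (\<lambda>i j. (if i = j then 1 else 0) + m i j) - 1 - (\<Sum>i<k. m i i)\<bar> \<le> (K + N * 2 ^ k) * h\<^sup>2"
    if h: "0 \<le> h" "h \<le> 1" and m: "\<forall>i<k. \<forall>j<k. \<bar>m i j\<bar> \<le> h" for m :: "nat \<Rightarrow> nat \<Rightarrow> real" and h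
  proof -
    let ?t = "\<lambda>p. of_int (sign p) * (\<Prod>i<k. (if i = p i then 1 else 0) + m i (p i))"
    have "pdet k (\<lambda>i j. (if i = j then 1 else 0) + m i j) = ?t id + (\<Sum>p\<in>?P - {id}. ?t p)"
      unfolding pdet_def using fin by (rule sum.remove) (simp add: permutes_id)
    also have "?t id = (\<Prod>i<k. 1 + m i i)" by (simp add: sign_id)
    finally have eq: "pdet k (\<lambda>i j. (if i = j then 1 else 0) + m i j) = (\<Prod>i<k. 1 + m i i) + (\<Sum>p\<in>?P - {id}. ?t p)" .
    have "\<bar>\<Sum>p\<in>?P - {id}. ?t p\<bar> \<le> (\<Sum>p\<in>?P - {id}. \<bar>?t p\<bar>)" by (rule sum_abs)
    also have "\<dots> \<le> (\<Sum>p\<in>?P - {id}. 2 ^ k * h\<^sup>2)"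
    proof (rule sum_mono)
      fix p assume "p \<in> ?P - {id}"
      then have "\<bar>\<Prod>i<k. (if i = p i then 1 else 0) + m i (p i)\<bar> \<le> 2 ^ k * h\<^sup>2"
        using m h by (intro prod_nonidentity_bound) auto
      then show "\<bar>?t p\<bar> \<le> 2 ^ k * h\<^sup>2" by (simp add: abs_mult sign_def)
    qed
    also have "\<dots> = N * 2 ^ k * h\<^sup>2" by (simp add: N_def)
    finally have "\<bar>\<Sum>p\<in>?P - {id}. ?t p\<bar> \<le> N * 2 ^ k * h\<^sup>2" .
    moreover have "\<bar>(\<Prod>i<k. 1 + m i i) - 1 - (\<Sum>i<k. m i i)\<bar> \<le> K * h\<^sup>2"
      using K(2)[OF h, of "\<lambda>i. m i i"] m by simp
    ultimately show ?thesis unfolding eq by (simp add: distrib_right)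
  qed
  then show ?thesis using K(1) by (intro exI[of _ "K + N * 2 ^ k"]) (auto simp: N_def)
qed

section \<open>The flag ratio of a deformed lattice\<close>

lemma norm_matrix_vector_mult_le: "norm (H *v x) \<le> norm H * norm x" for H :: "real^'n^'n"
proof -
  have "norm (H *v x) = L2_set (\<lambda>i. \<bar>H $ i \<bullet> x\<bar>) UNIV"
    by (simp add: norm_vec_def matrix_vector_mult_def inner_vec_def)
  also have "\<dots> \<le> L2_set (\<lambda>i. norm (H $ i) * norm x) UNIV"
    by (intro L2_set_mono) (simp_all add: Cauchy_Schwarz_ineq2)
  also have "\<dots> = norm H * norm x"
    by (simp add: L2_set_left_distrib[symmetric] norm_vec_def[of H])
  finally show ?thesis .
qed

lemma gram_det_deform:
  fixes g H :: "real^'n^'n"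
  assumes g: "transpose g ** g = t *\<^sub>R (mat 1 + H)"
    and u: "orthonormal_seq k u"
  shows "gram_det k (\<lambda>i. g *v u i) = t ^ k * pdet k (\<lambda>i j. (if i = j then 1 else 0) + u i \<bullet> (H *v u j))"
proof -
  have "(g *v u i) \<bullet> (g *v u j) = t * ((if i = j then 1 else 0) + u i \<bullet> (H *v u j))" if "i < k" "j < k" for i j
  proof -
    have "(g *v u i) \<bullet> (g *v u j) = u i \<bullet> ((transpose g ** g) *v u j)"
      by (metis dot_lmul_matrix matrix_vector_mul_assoc vector_transpose_matrix transpose_transpose)
    also have "\<dots> = t * (u i \<bullet> u j + u i \<bullet> (H *v u j))"
      unfolding g by (simp add: scaleR_matrix_vector_assoc[symmetric] matrix_vector_mult_add_rdistrib inner_add_right)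
    finally show ?thesis using orthonormal_seqD[OF u that] by simp
  qed
  then have "gram_det k (\<lambda>i. g *v u i) = pdet k (\<lambda>i j. t * ((if i = j then 1 else 0) + u i \<bullet> (H *v u j)))"
    unfolding gram_det_pdet by (intro pdet_cong) auto
  also have "\<dots> = t ^ k * pdet k (\<lambda>i j. (if i = j then 1 else 0) + u i \<bullet> (H *v u j))"
    unfolding pdet_def by (simp add: prod.distrib sum_distrib_left mult_ac)
  finally show ?thesis .
qed

lemma abs_inner_matrix_le:
  fixes H :: "real^'n^'n"
  assumes "orthonormal_seq k u" "i < k" "j < k"
  shows "\<bar>u i \<bullet> (H *v u j)\<bar> \<le> norm H"
proof -
  have n: "norm (u i) = 1" "norm (u j) = 1" using orthonormal_seqD[OF assms(1)] assms(2,3) by (simp_all add: norm_eq_1)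
  have "\<bar>u i \<bullet> (H *v u j)\<bar> \<le> norm (u i) * norm (H *v u j)" by (rule Cauchy_Schwarz_ineq2)
  then show ?thesis using norm_matrix_vector_mult_le[of H "u j"] n by simp
qed

text \<open>The constant has to be independent of the chain; it only depends on the ranks.\<close>
lemma gram_det_expansion:
  obtains K where "K \<ge> 0" "\<And>k (u :: nat \<Rightarrow> real^'n) H. k \<le> n \<Longrightarrow> orthonormal_seq k u \<Longrightarrow> norm H \<le> 1 \<Longrightarrow>
     \<bar>pdet k (\<lambda>i j. (if i = j then 1 else 0) + u i \<bullet> (H *v u j)) - 1 - (\<Sum>i<k. u i \<bullet> (H *v u i))\<bar> \<le> K * (norm H)\<^sup>2"
proof -
  let ?P = "\<lambda>k K. K \<ge> 0 \<and> (\<forall>(m::nat \<Rightarrow> nat \<Rightarrow> real) h. 0 \<le> h \<longrightarrow> h \<le> 1 \<longrightarrow> (\<forall>i<k. \<forall>j<k. \<bar>m i j\<bar> \<le> h) \<longrightarrow>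
     \<bar>pdet k (\<lambda>i j. (if i = j then 1 else 0) + m i j) - 1 - (\<Sum>i<k. m i i)\<bar> \<le> K * h\<^sup>2)"
  have "\<forall>k. \<exists>K. ?P k K" by (rule allI) (rule pdet_near_identity)
  then obtain K where "\<forall>k. ?P k (K k)" by (rule choice[THEN exE])
  then have K: "\<And>k. K k \<ge> 0" "\<And>k (m::nat \<Rightarrow> nat \<Rightarrow> real) h. 0 \<le> h \<Longrightarrow> h \<le> 1 \<Longrightarrow> (\<forall>i<k. \<forall>j<k. \<bar>m i j\<bar> \<le> h) \<Longrightarrow>
     \<bar>pdet k (\<lambda>i j. (if i = j then 1 else 0) + m i j) - 1 - (\<Sum>i<k. m i i)\<bar> \<le> K k * h\<^sup>2"
    by blast+
  show ?thesis
  proof (rule that[of "\<Sum>k\<le>n. K k"])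
    show "(\<Sum>k\<le>n. K k) \<ge> 0" using K(1) by (intro sum_nonneg) auto
    fix k and u :: "nat \<Rightarrow> real^'n" and H :: "real^'n^'n" assume k: "k \<le> n" and u: "orthonormal_seq k u" and H: "norm H \<le> 1"
    have "\<bar>pdet k (\<lambda>i j. (if i = j then 1 else 0) + u i \<bullet> (H *v u j)) - 1 - (\<Sum>i<k. u i \<bullet> (H *v u i))\<bar> \<le> K k * (norm H)\<^sup>2"
      using H abs_inner_matrix_le[OF u] by (intro K(2)) auto
    also have "\<dots> \<le> (\<Sum>k\<le>n. K k) * (norm H)\<^sup>2"
      using k K(1) by (intro mult_right_mono member_le_sum) auto
    finally show "\<bar>pdet k (\<lambda>i j. (if i = j then 1 else 0) + u i \<bullet> (H *v u j)) - 1 - (\<Sum>i<k. u i \<bullet> (H *v u i))\<bar> \<le> (\<Sum>k\<le>n. K k) * (norm H)\<^sup>2" .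
  qed
qed

text \<open>The right-hand side adds up the traces of H compressed to the members of the flag, the
  linear part of the logarithm of their determinant factors.\<close>

lemma Pi_flag_inner_matrix:
  fixes w :: "nat \<Rightarrow> real^'n"
  assumes "length Ls = length lam"
    and w: "\<And>i. i < length lam \<Longrightarrow> orthonormal_seq (lam ! i) w \<and> span (w ` {..<lam ! i}) = span (Ls ! i)"
  shows "Pi_flag Ls \<bullet> H = (\<Sum>i<length lam. \<Sum>j<lam ! i. w j \<bullet> (H *v w j))"
proof -
  have P: "Pi_flag Ls $ r $ s = (\<Sum>i<length lam. \<Sum>j<lam ! i. w j $ r * w j $ s)" for r s
  proof -
    have "Pi_flag Ls $ r $ s = axis r 1 \<bullet> (Pi_flag Ls *v axis s 1)" by (rule inner_axis_matrix[symmetric])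
    also have "\<dots> = (\<Sum>i<length lam. \<Sum>j<lam ! i. (axis r 1 \<bullet> w j) * (axis s 1 \<bullet> w j))"
      by (rule inner_Pi_flag[OF assms])
    finally show ?thesis by (simp add: inner_axis')
  qed
  have "Pi_flag Ls \<bullet> H = (\<Sum>r\<in>UNIV. \<Sum>s\<in>UNIV. \<Sum>i<length lam. \<Sum>j<lam ! i. (w j $ r * w j $ s) * H $ r $ s)"
    by (simp add: inner_vec_def P sum_distrib_right)
  also have "\<dots> = (\<Sum>r\<in>UNIV. \<Sum>i<length lam. \<Sum>j<lam ! i. \<Sum>s\<in>UNIV. (w j $ r * w j $ s) * H $ r $ s)"
    by (rule sum.cong[OF refl], rule trans[OF sum.swap], rule sum.cong[OF refl], rule sum.swap)
  also have "\<dots> = (\<Sum>i<length lam. \<Sum>j<lam ! i. \<Sum>r\<in>UNIV. \<Sum>s\<in>UNIV. (w j $ r * w j $ s) * H $ r $ s)"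
    by (rule trans[OF sum.swap], rule sum.cong[OF refl], rule sum.swap)
  also have "\<dots> = (\<Sum>i<length lam. \<Sum>j<lam ! i. w j \<bullet> (H *v w j))"
    by (intro sum.cong refl) (simp add: inner_vec_def matrix_vector_mult_def sum_distrib_left mult_ac)
  finally show ?thesis .
qed

text \<open>The whole space is treated as a chain with one member, whose projection is the
  identity.\<close>

lemma trace_orthonormal_seq:
  fixes H :: "real^'n^'n"
  assumes u: "orthonormal_seq CARD('n) u" "span (u ` {..<CARD('n)}) = UNIV"
  shows "(\<Sum>j<CARD('n). u j \<bullet> (H *v u j)) = mat 1 \<bullet> H"
proof -
  have "orth_proj (UNIV :: (real^'n) set) = id"
    using orth_proj_orthonormal_seq[OF u] orthonormal_seq_expand[OF u(1)] u(2) by (auto simp: fun_eq_iff)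
  then have "Pi_flag [UNIV :: (real^'n) set] = mat 1"
    by (simp add: Pi_flag_def matrix_id_mat_1)
  then show ?thesis
    using Pi_flag_inner_matrix[of "[UNIV :: (real^'n) set]" "[CARD('n)]" u H] u by simp
qed

text \<open>On this range (1 + 2x)(1 - x) is at least 1. The bound serves the determinant of the
  whole lattice, which stands in the denominator of the flag ratio.\<close>

lemma exp_minus_two_le:
  assumes "0 \<le> x" "x \<le> 1 / 2"
  shows "exp (- 2 * x) \<le> 1 - (x::real)"
proof -
  have "x * (2 * x) \<le> x * 1" using assms by (intro mult_left_mono) auto
  then have "1 \<le> (1 + 2 * x) * (1 - x)" by (simp add: algebra_simps)
  also have "\<dots> \<le> exp (2 * x) * (1 - x)"
    using assms by (intro mult_right_mono exp_ge_add_one_self) auto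
  finally have "exp (- 2 * x) * 1 \<le> exp (- 2 * x) * (exp (2 * x) * (1 - x))" by (intro mult_left_mono) auto
  then show ?thesis by (simp add: mult.assoc[symmetric] exp_add[symmetric])
qed

text \<open>Each determinant acquires a power of t and the determinant \<open>q\<close> of the
  compression of 1 + H to its span. In the numerator 1 + y \<le> exp y leaves one error K |H|^2 per
  member; in the denominator \<open>exp_minus_two_le\<close> leaves twice that error, times the
  exponent \<open>a\<close>.\<close>

lemma chain_ratio_deform:
  fixes L :: "(real^'n) set" and g H :: "real^'n^'n"
  assumes L: "is_lattice_basis L CARD('n) b" and c: "lat_chain L lam Ls"
    and w: "\<And>i. i < length lam \<Longrightarrow> orthonormal_seq (lam ! i) w \<and> span (w ` {..<lam ! i}) = span (Ls ! i)"
    and lam: "\<And>i. i < length lam \<Longrightarrow> lam ! i \<le> CARD('n)"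
    and g: "invertible g" "transpose g ** g = t *\<^sub>R (mat 1 + H)" "t > 0"
    and H: "mat 1 \<bullet> H = 0" "norm H \<le> 1" "K * (norm H)\<^sup>2 \<le> 1 / 2"
    and K: "K \<ge> 0" "\<And>k (u :: nat \<Rightarrow> real^'n) H. k \<le> CARD('n) \<Longrightarrow> orthonormal_seq k u \<Longrightarrow> norm H \<le> 1 \<Longrightarrow>
     \<bar>pdet k (\<lambda>i j. (if i = j then 1 else 0) + u i \<bullet> (H *v u j)) - 1 - (\<Sum>i<k. u i \<bullet> (H *v u i))\<bar> \<le> K * (norm H)\<^sup>2"
  shows "chain_ratio ((*v) g ` L) lam (map ((`) ((*v) g)) Ls)
    \<le> chain_ratio L lam Ls * exp (Pi_flag Ls \<bullet> H
        + K * (real (length lam) + 2 * real (sum_list lam) / real CARD('n)) * (norm H)\<^sup>2)"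
proof -
  let ?n = "CARD('n)"
  define x where "x = K * (norm H)\<^sup>2"
  define a where "a = real (sum_list lam) / real ?n"
  define q where "q = (\<lambda>k u. pdet k (\<lambda>i j. (if i = j then 1 else 0) + u i \<bullet> (H *v (u j :: real^'n))))"
  have x: "0 \<le> x" "x \<le> 1 / 2" using H K(1) by (auto simp: x_def)
  have a0: "a \<ge> 0" by (simp add: a_def)
  have len: "length Ls = length lam" using c by (simp add: lat_chain_def)
  have lin: "linear ((*v) g)" and inj: "inj ((*v) g)"
    using g(1) by (auto simp: inj_matrix_vector_mult)
  have det: "lat_det ((*v) g ` Lam) k = lat_det Lam k * (t ^ k * q k u)" and qpos: "q k u > 0"
    if "is_lattice_basis Lam k b'" "orthonormal_seq k u" "span (u ` {..<k}) = span Lam" for Lam k b' u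
  proof -
    show eq: "lat_det ((*v) g ` Lam) k = lat_det Lam k * (t ^ k * q k u)"
      using lat_det_image[OF that(1) lin inj that(2,3)] gram_det_deform[OF g(2) that(2)] by (simp add: q_def)
    have "0 < lat_det ((*v) g ` Lam) k" "0 < lat_det Lam k"
      using lat_det_pos[OF lattice_basis_image[OF that(1) lin inj]] lat_det_pos[OF that(1)] by auto
    then show "q k u > 0" using eq g(3) by (simp add: zero_less_mult_iff)
  qed
  define P where "P = (\<Prod>i<length lam. lat_det (Ls ! i) (lam ! i))"
  define Q where "Q = (\<Prod>i<length lam. q (lam ! i) w)"
  have ls: "\<exists>b. is_lattice_basis (Ls ! i) (lam ! i) b" if "i < length lam" for i
    using lat_chainD(2)[OF c that] .
  have P0: "P > 0" unfolding P_def using ls lat_det_pos by (intro prod_pos) blast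
  have sum: "sum_list lam = (\<Sum>i<length lam. lam ! i)"
    by (simp add: sum_list_sum_nth atLeast0LessThan)
  have num: "(\<Prod>i<length lam. lat_det (map ((`) ((*v) g)) Ls ! i) (lam ! i)) = P * (t ^ sum_list lam * Q)"
  proof -
    have "(\<Prod>i<length lam. lat_det (map ((`) ((*v) g)) Ls ! i) (lam ! i))
        = (\<Prod>i<length lam. lat_det (Ls ! i) (lam ! i) * (t ^ (lam ! i) * q (lam ! i) w))"
    proof (rule prod.cong[OF refl])
      fix i assume "i \<in> {..<length lam}"
      then have i: "i < length lam" by simp
      obtain b' where b': "is_lattice_basis (Ls ! i) (lam ! i) b'" using ls[OF i] by blast
      show "lat_det (map ((`) ((*v) g)) Ls ! i) (lam ! i) = lat_det (Ls ! i) (lam ! i) * (t ^ (lam ! i) * q (lam ! i) w)"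
        using det[OF b', of w] w[OF i] i len by simp
    qed
    then show ?thesis by (simp add: prod.distrib P_def Q_def sum power_sum)
  qed
  have Q0: "Q \<ge> 0" unfolding Q_def using qpos ls w by (intro prod_nonneg) (meson less_imp_le lessThan_iff)
  have "Q \<le> (\<Prod>i<length lam. exp ((\<Sum>j<lam ! i. w j \<bullet> (H *v w j)) + x))"
    unfolding Q_def
  proof (rule prod_mono)
    fix i assume "i \<in> {..<length lam}"
    then have i: "i < length lam" by simp
    have "q (lam ! i) w \<le> 1 + ((\<Sum>j<lam ! i. w j \<bullet> (H *v w j)) + x)"
      using K(2)[OF lam[OF i] _ H(2), of w] w[OF i] unfolding q_def x_def by auto
    also have "\<dots> \<le> exp ((\<Sum>j<lam ! i. w j \<bullet> (H *v w j)) + x)" by (rule exp_ge_add_one_self)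
    finally show "0 \<le> q (lam ! i) w \<and> q (lam ! i) w \<le> exp ((\<Sum>j<lam ! i. w j \<bullet> (H *v w j)) + x)"
      using qpos ls[OF i] w[OF i] by (meson less_imp_le)
  qed
  also have "\<dots> = exp (Pi_flag Ls \<bullet> H + real (length lam) * x)"
    by (simp add: exp_sum[symmetric] sum.distrib Pi_flag_inner_matrix[OF len w])
  finally have Q: "Q \<le> exp (Pi_flag Ls \<bullet> H + real (length lam) * x)" .
  obtain v :: "nat \<Rightarrow> real^'n" where v0: "orthonormal_seq (dim (UNIV :: (real^'n) set)) v" "span (v ` {..<dim (UNIV :: (real^'n) set)}) = UNIV"
    using orthonormal_seq_exists[OF subspace_UNIV] .
  then have v: "orthonormal_seq ?n v" "span (v ` {..<?n}) = UNIV" by simp_all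
  have spL: "span L = UNIV"
    using lattice_dim[OF L] dim_eq_full[of L] by simp
  have vL: "span (v ` {..<?n}) = span L" using v spL by simp
  define D where "D = lat_det L ?n"
  have D0: "D > 0" unfolding D_def by (rule lat_det_pos[OF L])
  have den: "lat_det ((*v) g ` L) ?n = D * (t ^ ?n * q ?n v)"
    unfolding D_def by (rule det[OF L v(1) vL])
  have q0: "q ?n v > 0" by (rule qpos[OF L v(1) vL])
  \<comment> \<open>As H is traceless, the linear term of the determinant on the whole space is 0,
    and \<open>q\<close> there is at least 1 - x.\<close>
  have "exp (- 2 * x) \<le> q ?n v"
    using exp_minus_two_le[OF x] K(2)[OF _ v(1) H(2)] trace_orthonormal_seq[OF v, of H] H(1)
    unfolding q_def x_def by fastforce
  then have "exp (- 2 * x) powr a \<le> q ?n v powr a" using a0 by (intro powr_mono2) auto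
  then have qa: "exp (- (2 * x * a)) \<le> q ?n v powr a" by (simp add: powr_def mult_ac)
  \<comment> \<open>The exponent \<open>a\<close> is the sum of the ranks divided by n; this makes
    the powers of t in numerator and denominator equal.\<close>
  have "(t ^ ?n) powr a = t powr (real ?n * a)"
    using g(3) by (simp add: powr_realpow[symmetric] powr_powr)
  also have "real ?n * a = real (sum_list lam)" by (simp add: a_def)
  finally have ta: "(t ^ ?n) powr a = t ^ sum_list lam" using g(3) by (simp add: powr_realpow)
  have denp: "lat_det ((*v) g ` L) ?n powr a = D powr a * (t ^ sum_list lam * q ?n v powr a)"
    unfolding den using D0 g(3) q0 by (simp add: powr_mult ta)
  have "chain_ratio ((*v) g ` L) lam (map ((`) ((*v) g)) Ls) = P * (t ^ sum_list lam * Q) / (D powr a * (t ^ sum_list lam * q ?n v powr a))"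
    unfolding chain_ratio_def num a_def[symmetric] denp ..
  also have "\<dots> = (P / D powr a) * (Q / (q ?n v powr a))" using g(3) by simp
  also have "\<dots> \<le> (P / D powr a) * (exp (Pi_flag Ls \<bullet> H + real (length lam) * x) / exp (- (2 * x * a)))"
    using P0 D0 Q Q0 qa by (intro mult_left_mono frac_le) auto
  also have "P / D powr a = chain_ratio L lam Ls" unfolding chain_ratio_def P_def D_def a_def ..
  also have "exp (Pi_flag Ls \<bullet> H + real (length lam) * x) / exp (- (2 * x * a))
      = exp (Pi_flag Ls \<bullet> H + K * (real (length lam) + 2 * real (sum_list lam) / real ?n) * (norm H)\<^sup>2)"
    by (simp add: exp_diff[symmetric] x_def a_def algebra_simps)
  finally show ?thesis .
qed

text \<open>Put k = a / (2 |F| M). If every x f exceeded - k h, each product (x f + k h) (M h - x f)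
  would be nonnegative, yet their sum is - a h^2 + |F| k M h^2 = - a h^2 / 2.\<close>

lemma exists_very_negative:
  fixes x :: "'a \<Rightarrow> real"
  assumes F: "finite F" "F \<noteq> {}" and sum: "(\<Sum>f\<in>F. x f) = 0" and sq: "(\<Sum>f\<in>F. (x f)\<^sup>2) = a * h\<^sup>2"
    and bd: "\<And>f. f \<in> F \<Longrightarrow> \<bar>x f\<bar> \<le> M * h" and pos: "a > 0" "M > 0" "h \<ge> 0"
  shows "\<exists>f\<in>F. x f \<le> - (a / (2 * real (card F) * M)) * h"
proof (cases "h = 0")
  case True
  then show ?thesis using F bd by force
next
  case False
  define k where "k = a / (2 * real (card F) * M)"
  have N: "real (card F) > 0" using F by (simp add: card_gt_0_iff)
  show ?thesis
  proof (rule ccontr)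
    assume "\<not> ?thesis"
    then have lt: "x f > - k * h" if "f \<in> F" for f using that unfolding k_def by force
    have "0 \<le> (\<Sum>f\<in>F. (x f + k * h) * (M * h - x f))"
      using lt bd by (intro sum_nonneg mult_nonneg_nonneg) (force simp: abs_le_iff)+
    also have "\<dots> = (\<Sum>f\<in>F. (M * h - k * h) * x f - (x f)\<^sup>2 + k * M * h\<^sup>2)"
      by (intro sum.cong refl) (simp add: algebra_simps power2_eq_square)
    also have "\<dots> = (M * h - k * h) * (\<Sum>f\<in>F. x f) - (\<Sum>f\<in>F. (x f)\<^sup>2) + real (card F) * (k * M * h\<^sup>2)"
      by (simp add: sum.distrib sum_subtractf sum_distrib_left)
    also have "\<dots> = - (a * h\<^sup>2) / 2"
      unfolding sum sq k_def using N pos by (simp add: field_simps)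
    finally show False using pos False by (simp add: mult_le_0_iff zero_le_mult_iff)
  qed
qed

section \<open>Extremality\<close>

text \<open>t is the trace of the Gram matrix divided by n, which makes the remainder H traceless.
  Both are continuous at the identity, where t = 1 and H = 0.\<close>

lemma gram_matrix_near_identity:
  assumes "\<delta> > 0"
  obtains \<epsilon> where "\<epsilon> > 0" "\<And>g :: real^'n^'n. norm (g - mat 1) < \<epsilon> \<Longrightarrow>
    \<exists>t H. t > 0 \<and> transpose g ** g = t *\<^sub>R (mat 1 + H)
      \<and> mat 1 \<bullet> H = 0 \<and> transpose H = H \<and> norm H < \<delta>"
proof -
  let ?I = "mat 1 :: real^'n^'n"
  define S where "S = (\<lambda>g :: real^'n^'n. transpose g ** g)"
  define t where "t = (\<lambda>g. (?I \<bullet> S g) / real CARD('n))"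
  define H where "H = (\<lambda>g. (1 / t g) *\<^sub>R S g - ?I)"
  have SI: "S ?I = ?I" by (simp add: S_def transpose_mat matrix_mul_lid)
  have II: "?I \<bullet> ?I = real CARD('n)"
    by (simp add: inner_vec_def Finite_Cartesian_Product.mat_def if_distrib[of "\<lambda>x. x * _"] cong: if_cong)
  have tI: "t ?I = 1" by (simp add: t_def SI II)
  have HI: "H ?I = 0" by (simp add: H_def SI tI)
  have "continuous_on UNIV S"
    unfolding S_def Finite_Cartesian_Product.transpose_def matrix_matrix_mult_def by (intro continuous_intros)
  then have cS: "isCont S ?I" by (simp add: continuous_on_eq_continuous_at)
  then have ct: "isCont t ?I" unfolding t_def by (intro continuous_intros) auto
  then have cH: "isCont H ?I" unfolding H_def using cS tI by (intro continuous_intros) auto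
  have "\<forall>\<^sub>F g in nhds ?I. t g > 0"
    using order_tendstoD(1)[OF ct[unfolded isCont_def tendsto_at_iff_tendsto_nhds], of 0] tI by simp
  moreover have "\<forall>\<^sub>F g in nhds ?I. dist (H g) 0 < \<delta>"
    using tendstoD[OF cH[unfolded isCont_def tendsto_at_iff_tendsto_nhds] assms] HI by simp
  ultimately have "\<forall>\<^sub>F g in nhds ?I. t g > 0 \<and> norm (H g) < \<delta>"
    by eventually_elim simp
  then obtain \<epsilon> where \<epsilon>: "\<epsilon> > 0" "\<And>g. dist g ?I < \<epsilon> \<Longrightarrow> t g > 0 \<and> norm (H g) < \<delta>"
    unfolding eventually_nhds_metric by blast
  show ?thesis
  proof (rule that[OF \<epsilon>(1)])
    fix g :: "real^'n^'n" assume "norm (g - ?I) < \<epsilon>"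
    then have g: "t g > 0" "norm (H g) < \<delta>" using \<epsilon>(2)[of g] by (auto simp: dist_norm)
    have "transpose (S g) = S g"
      by (simp add: S_def matrix_transpose_mul)
    then have "transpose (H g) = H g"
      by (simp add: H_def Finite_Cartesian_Product.vec_eq_iff Finite_Cartesian_Product.transpose_def Finite_Cartesian_Product.mat_def)
    moreover have "S g = t g *\<^sub>R (?I + H g)" using g(1) by (simp add: H_def)
    moreover have "?I \<bullet> S g = t g * real CARD('n)" by (simp add: t_def)
    then have "?I \<bullet> H g = 0" using g(1) II by (simp add: H_def inner_diff_right)
    ultimately show "\<exists>t H. t > 0 \<and> transpose g ** g = t *\<^sub>R (?I + H)
      \<and> ?I \<bullet> H = 0 \<and> transpose H = H \<and> norm H < \<delta>"
      using g unfolding S_def by blast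
  qed
qed

lemma strongly_perfect_imp_extreme:
  fixes L :: "(real^'n) set"
  assumes ok: "conj_partition_ok lam CARD('n)" and L: "full_rank_lattice L" and sp: "strongly_perfect_lam L lam"
  shows "extreme_lam L lam"
proof -
  let ?I = "mat 1 :: real^'n^'n" and ?M = "min_flags L lam"
  obtain B C c where fin: "finite ?M" and ne: "?M \<noteq> {}"
    and F: "\<And>Ls. Ls \<in> ?M \<Longrightarrow> is_flag (remdups lam) (remdups (map span Ls))"
    and c: "c > 0" "(\<Sum>Ls\<in>?M. Pi_flag Ls) = c *\<^sub>R ?I" and C: "C > 0"
    and quad: "\<And>H. transpose H = H \<Longrightarrow>
       (\<Sum>Ls\<in>?M. (Pi_flag Ls \<bullet> H)\<^sup>2) = B * (?I \<bullet> H)\<^sup>2 + 2 * C * (H \<bullet> H)"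
    using strongly_perfect_moments[OF assms] by metis
  obtain b where b: "is_lattice_basis L CARD('n) b" using L by (auto simp: full_rank_lattice_def)
  obtain K where K: "K \<ge> 0" "\<And>k (u :: nat \<Rightarrow> real^'n) H. k \<le> CARD('n) \<Longrightarrow> orthonormal_seq k u \<Longrightarrow> norm H \<le> 1 \<Longrightarrow>
     \<bar>pdet k (\<lambda>i j. (if i = j then 1 else 0) + u i \<bullet> (H *v u j)) - 1 - (\<Sum>i<k. u i \<bullet> (H *v u i))\<bar> \<le> K * (norm H)\<^sup>2"
    using gram_det_expansion[where n = "CARD('n)" and 'n = 'n] by blast
  define M where "M = 1 + (\<Sum>Ls\<in>?M. norm (Pi_flag Ls))"
  have M: "M > 0" unfolding M_def by (intro add_pos_nonneg sum_nonneg) auto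
  \<comment> \<open>The rate from \<open>exists_very_negative\<close> with a = 2 C, the coefficient
    of |H|^2 in the second moment of a traceless H.\<close>
  define \<kappa> where "\<kappa> = 2 * C / (2 * real (card ?M) * M)"
  have \<kappa>: "\<kappa> > 0" unfolding \<kappa>_def using C M fin ne by (simp add: card_gt_0_iff)
  define K' where "K' = K * (real (length lam) + 2 * real (sum_list lam) / real CARD('n))"
  have K': "K' \<ge> 0" unfolding K'_def using K(1) by simp
  \<comment> \<open>The entries ensure in turn |H| \<le> 1, K |H|^2 \<le> 1/2 and K' |H|^2 \<le>
    \<kappa> |H|; adding 1 to \<open>K\<close> and \<open>K'\<close> keeps the denominators
    positive.\<close>
  define \<delta> where "\<delta> = min 1 (min (1 / (2 * (K + 1))) (\<kappa> / (K' + 1)))"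
  have \<delta>: "\<delta> > 0" unfolding \<delta>_def using K(1) \<kappa> K' by simp
  obtain \<epsilon> where \<epsilon>: "\<epsilon> > 0" "\<And>g :: real^'n^'n. norm (g - ?I) < \<epsilon> \<Longrightarrow>
    \<exists>t H. t > 0 \<and> transpose g ** g = t *\<^sub>R (?I + H)
      \<and> ?I \<bullet> H = 0 \<and> transpose H = H \<and> norm H < \<delta>"
    using gram_matrix_near_identity[OF \<delta>] by blast
  have "gamma_lam ((*v) g ` L) lam \<le> gamma_lam L lam" if g: "invertible g" "norm (g - ?I) < \<epsilon>" for g
  proof -
    obtain t H where tH: "t > 0" "transpose g ** g = t *\<^sub>R (?I + H)"
      "?I \<bullet> H = 0" "transpose H = H" "norm H < \<delta>"
      using \<epsilon>(2)[OF g(2)] by blast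
    have h1: "norm H \<le> 1" and hK: "norm H \<le> 1 / (2 * (K + 1))" and h\<kappa>: "norm H \<le> \<kappa> / (K' + 1)"
      using tH(5) by (auto simp: \<delta>_def)
    have "K * (norm H)\<^sup>2 \<le> K * norm H"
      using h1 K(1) by (intro mult_left_mono) (auto simp: power2_eq_square mult_left_le)
    also have "\<dots> \<le> (K + 1) * norm H" by (intro mult_right_mono) auto
    also have "\<dots> \<le> 1 / 2" using hK K(1) by (simp add: field_simps)
    finally have hK2: "K * (norm H)\<^sup>2 \<le> 1 / 2" .
    have "K' * norm H \<le> (K' + 1) * norm H" by (intro mult_right_mono) auto
    also have "\<dots> \<le> \<kappa>" using h\<kappa> K' by (simp add: field_simps)
    finally have "K' * norm H * norm H \<le> \<kappa> * norm H" by (intro mult_right_mono) auto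
    then have hK': "K' * (norm H)\<^sup>2 \<le> \<kappa> * norm H" by (simp add: power2_eq_square mult_ac)
    have "(\<Sum>Ls\<in>?M. Pi_flag Ls \<bullet> H) = c * (?I \<bullet> H)"
      by (simp add: inner_sum_left[symmetric] c(2))
    then have s0: "(\<Sum>Ls\<in>?M. Pi_flag Ls \<bullet> H) = 0" using tH(3) by simp
    have s2: "(\<Sum>Ls\<in>?M. (Pi_flag Ls \<bullet> H)\<^sup>2) = 2 * C * (norm H)\<^sup>2"
      using quad[OF tH(4)] tH(3) by (simp add: dot_square_norm)
    have bd: "\<bar>Pi_flag Ls \<bullet> H\<bar> \<le> M * norm H" if "Ls \<in> ?M" for Ls
    proof -
      have "\<bar>Pi_flag Ls \<bullet> H\<bar> \<le> norm (Pi_flag Ls) * norm H" by (rule Cauchy_Schwarz_ineq2)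
      also have "norm (Pi_flag Ls) \<le> (\<Sum>Ls\<in>?M. norm (Pi_flag Ls))"
        using that fin by (intro member_le_sum) auto
      then have "norm (Pi_flag Ls) * norm H \<le> M * norm H"
        by (intro mult_right_mono) (auto simp: M_def)
      finally show ?thesis .
    qed
    obtain Ls where Ls: "Ls \<in> ?M" "Pi_flag Ls \<bullet> H \<le> - \<kappa> * norm H"
      using exists_very_negative[OF fin ne s0 s2 bd _ M] C unfolding \<kappa>_def by auto
    have ch: "lat_chain L lam Ls" and val: "chain_ratio L lam Ls = gamma_lam L lam"
      using Ls(1) by (auto simp: min_flags_def)
    define w where "w = col (rep (remdups lam) (remdups (map span Ls)))"
    have w: "orthonormal_seq (lam ! i) w \<and> span (w ` {..<lam ! i}) = span (Ls ! i)" if "i < length lam" for i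
      using chain_flag_seq[OF ch F[OF Ls(1)] that] by (simp add: w_def)
    have lam: "lam ! i \<le> CARD('n)" if "i < length lam" for i
      using ok that by (auto simp: conj_partition_ok_def intro: less_imp_le)
    \<comment> \<open>The image of this one flag bounds the infimum for the deformed lattice. The
      exponent that appears is at most - \<kappa> |H| + \<kappa> |H| = 0.\<close>
    have "gamma_lam ((*v) g ` L) lam \<le> chain_ratio ((*v) g ` L) lam (map ((`) ((*v) g)) Ls)"
      using g(1) by (intro gamma_lam_le lat_chain_image[OF ch]) (auto simp: inj_matrix_vector_mult)
    also have "\<dots> \<le> chain_ratio L lam Ls * exp (Pi_flag Ls \<bullet> H + K' * (norm H)\<^sup>2)"
      unfolding K'_def by (rule chain_ratio_deform[OF b ch w lam g(1) tH(2,1,3) h1 hK2 K])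
    also have "\<dots> \<le> chain_ratio L lam Ls * 1"
      using Ls(2) hK' by (intro mult_left_mono chain_ratio_nonneg[OF ch]) auto
    finally show ?thesis by (simp add: val)
  qed
  then show ?thesis unfolding extreme_lam_def using \<epsilon>(1) by blast
qed

text \<open>By orthogonal decomposition it suffices that a symmetric matrix orthogonal to every
  \<open>Pi_flag\<close> vanishes.\<close>

lemma strongly_perfect_imp_perfect:
  fixes L :: "(real^'n) set"
  assumes ok: "conj_partition_ok lam CARD('n)" and L: "full_rank_lattice L" and sp: "strongly_perfect_lam L lam"
  shows "perfect_lam L lam"
proof -
  let ?I = "mat 1 :: real^'n^'n" and ?M = "min_flags L lam"
  obtain B C c where F: "\<And>Ls. Ls \<in> ?M \<Longrightarrow> is_flag (remdups lam) (remdups (map span Ls))"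
    and c: "c > 0" "(\<Sum>Ls\<in>?M. Pi_flag Ls) = c *\<^sub>R ?I" and C: "C > 0"
    and quad: "\<And>H. transpose H = H \<Longrightarrow>
       (\<Sum>Ls\<in>?M. (Pi_flag Ls \<bullet> H)\<^sup>2) = B * (?I \<bullet> H)\<^sup>2 + 2 * C * (H \<bullet> H)"
    using strongly_perfect_moments[OF assms] by metis
  let ?Sym = "{A :: real^'n^'n. transpose A = A}"
  have sub: "subspace ?Sym"
    by (auto simp: subspace_def Finite_Cartesian_Product.vec_eq_iff Finite_Cartesian_Product.transpose_def)
  have Pi: "Pi_flag ` ?M \<subseteq> ?Sym"
    using Pi_flag_symmetric_psd(1)[OF min_flag_chain F] by auto
  have le: "span (Pi_flag ` ?M) \<subseteq> ?Sym" using Pi sub by (rule span_minimal)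
  moreover have "A \<in> span (Pi_flag ` ?M)" if A: "A \<in> ?Sym" for A
  proof -
    obtain Y Z where YZ: "Y \<in> span (Pi_flag ` ?M)" "\<And>W. W \<in> span (Pi_flag ` ?M) \<Longrightarrow> Linear_Algebra.orthogonal Z W" "A = Y + Z"
      using orthogonal_subspace_decomp_exists[of "Pi_flag ` ?M" A] by blast
    have "A - Y \<in> ?Sym" using A YZ(1) le sub by (intro subspace_diff) auto
    then have Z: "transpose Z = Z" using YZ(3) by simp
    have PZ: "Pi_flag Ls \<bullet> Z = 0" if "Ls \<in> ?M" for Ls
      using YZ(2)[of "Pi_flag Ls"] that
      by (auto simp: Linear_Algebra.orthogonal_def inner_commute intro: span_base)
    \<comment> \<open>The first moment makes the trace of Z zero; the second moment then reads 0 = 2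
      C |Z|^2.\<close>
    have "c * (?I \<bullet> Z) = (\<Sum>Ls\<in>?M. Pi_flag Ls \<bullet> Z)"
      by (simp add: inner_sum_left[symmetric] c(2))
    then have "?I \<bullet> Z = 0" using PZ c(1) by simp
    then have "Z \<bullet> Z = 0" using quad[OF Z] PZ C by simp
    then show ?thesis using YZ by simp
  qed
  ultimately show ?thesis unfolding perfect_lam_def by blast
qed

lemma strongly_perfect_imp_strongly_eutactic:
  fixes L :: "(real^'n) set"
  assumes "conj_partition_ok lam CARD('n)" and "full_rank_lattice L" and "strongly_perfect_lam L lam"
  shows "strongly_eutactic_lam L lam"
proof -
  obtain c where c: "c > 0" "(\<Sum>Ls\<in>min_flags L lam. Pi_flag Ls) = c *\<^sub>R (mat 1 :: real^'n^'n)"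
    using strongly_perfect_moments[OF assms] by metis
  have "(\<Sum>Ls\<in>min_flags L lam. (1 / c) *\<^sub>R Pi_flag Ls) = mat 1"
    using c by (simp add: scaleR_sum_right[symmetric])
  then show ?thesis unfolding strongly_eutactic_lam_def using c(1) by (intro exI[of _ "1 / c"]) auto
qed

theorem mainTheorem6:
  fixes L :: "(real^'n) set" and lam :: "nat list"
  assumes "conj_partition_ok lam CARD('n)"
    and "full_rank_lattice L"
    and "strongly_perfect_lam L lam"
  shows "extreme_lam L lam \<and> perfect_lam L lam \<and> strongly_eutactic_lam L lam"
  using strongly_perfect_imp_extreme[OF assms] strongly_perfect_imp_perfect[OF assms]
    strongly_perfect_imp_strongly_eutactic[OF assms] by blast

end
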